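(* Let $X$ be a simplicial complex, $f:X\to X$ an open (continuous) map and $A\subset X$ a definable subspace such that $f(A)\subset A$ and $f(X\setminus A)\subset X\setminus A$. If $\varLambda(f,A)_X\neq 0$, then $f$ has a fixed point in $\overline{A}$.
   Context: Fix an o-minimal structure on $\mathbb{R}$ containing all semilinear sets; "definable" refers to this structure. Simplicial complexes are finite (geometric, in some $\mathbb{R}^n$) and are identified with their underlying compact polyhedra. $\overline{A}$ is the closure of $A$ in $X$. Combinatorial Lefschetz number. Let $Z$ be a simplicial complex, $D\subset Z$ definable and $l:Z\to Z$ a continuous map. By the definable triangulation theorem there are a simplicial complex $X$ and a definable homeomorphism $\tau:X\to Z$ such that $A=\tau^{-1}(D)$ is a union of open simplices (interiors of simplices) of $X$; put $f=\tau^{-1}\circ l\circ\tau$. Let $f^{\mathrm{simp}}:X'\to X$ be a simplicial approximation of $f$, where $X'$ is a subdivision of $X$, and let $M_p(f^{\mathrm{simp}},X)$ be the matrix, in the basis of (oriented) $p$-simplices of $X$, of the composite $C_p(X;\mathbb{Q})\to C_p(X';\mathbb{Q})\to C_p(X;\mathbb{Q})$ of the subdivision operator with the chain map induced by $f^{\mathrm{simp}}$. Let $M_p(f^{\mathrm{simp}},X)_{|A}$ be the submatrix with rows and columns indexed by the $p$-simplices whose interior is contained in $A$. The combinatorial Lefschetz number of $l$ in $D$ with respect to $Z$ is $$\varLambda(l,D)_Z:=\sum_p(-1)^p\,\mathrm{tr}\bigl(M_p(f^{\mathrm{simp}},X)_{|A}\bigr).$$ It is independent of the choices when $l$ is open,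 $l(D)\subset D$ and $l(Z\setminus D)\subset Z\setminus D$. *)

theory Defs
  imports "HOL-Analysis.Analysis" "HOL-Combinatorics.Permutations"
    "Jordan_Normal_Form.Determinant"
begin

section \<open>O-minimal structures and definable sets\<close>

text \<open>A structure is a family \<open>S\<close>, where \<open>S n\<close> is a collection of subsets of the space of real
  \<open>n\<close>-tuples; tuples are lists, because the axioms relate different \<open>n\<close>.\<close>

definition tuples :: "nat \<Rightarrow> real list set" where
  "tuples n = {xs. length xs = n}"

definition real_structure :: "(nat \<Rightarrow> real list set set) \<Rightarrow> bool" where
  "real_structure S \<longleftrightarrow>
     (\<forall>n. \<forall>A\<in>S n. A \<subseteq> tuples n) \<and>
     (\<forall>n. {} \<in> S n) \<and>
     (\<forall>n. \<forall>A\<in>S n. \<forall>B\<in>S n. A \<union> B \<in> S n) \<and>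
     (\<forall>n. \<forall>A\<in>S n. tuples n - A \<in> S n) \<and>
     (\<forall>n. \<forall>A\<in>S n. {x # xs | x xs. xs \<in> A} \<in> S (Suc n) \<and> {xs @ [x] | x xs. xs \<in> A} \<in> S (Suc n)) \<and>
     (\<forall>n. \<forall>i<n. \<forall>j<n. {xs \<in> tuples n. xs ! i = xs ! j} \<in> S n) \<and>
     (\<forall>n. \<forall>A\<in>S (Suc n). butlast ` A \<in> S n)"

text \<open>For subsets of the line, \<^const>\<open>is_interval\<close> means order-convex, so points and bounded or
  unbounded intervals of every kind are covered.\<close>

definition ominimal_structure :: "(nat \<Rightarrow> real list set set) \<Rightarrow> bool" where
  "ominimal_structure S \<longleftrightarrow>
     real_structure S \<and>
     {[x, y] | x y. x < y} \<in> S 2 \<and>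
     (\<forall>A. A \<in> S 1 \<longleftrightarrow>
        (\<exists>\<I> :: real set set. finite \<I> \<and> (\<forall>I\<in>\<I>. is_interval I) \<and> A = (\<lambda>x. [x]) ` \<Union>\<I>))"

inductive semilinear :: "nat \<Rightarrow> real list set \<Rightarrow> bool" for n where
  gt: "length a = n \<Longrightarrow> semilinear n {xs \<in> tuples n. (\<Sum>i<n. a ! i * xs ! i) + b > 0}"
| eq: "length a = n \<Longrightarrow> semilinear n {xs \<in> tuples n. (\<Sum>i<n. a ! i * xs ! i) + b = 0}"
| union: "semilinear n A \<Longrightarrow> semilinear n B \<Longrightarrow> semilinear n (A \<union> B)"
| compl: "semilinear n A \<Longrightarrow> semilinear n (tuples n - A)"

definition contains_semilinear :: "(nat \<Rightarrow> real list set set) \<Rightarrow> bool" where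
  "contains_semilinear S \<longleftrightarrow> (\<forall>n A. semilinear n A \<longrightarrow> A \<in> S n)"

text \<open>The coordinates of a vector listed in a fixed order. A structure is closed under permuting
  coordinates, so the order chosen does not affect definability.\<close>

definition index_list :: "'n::finite list" where
  "index_list = (SOME is. distinct is \<and> set is = UNIV)"

definition coords :: "real ^ 'n \<Rightarrow> real list" where
  "coords x = map (\<lambda>i. vec_nth x i) index_list"

definition definable :: "(nat \<Rightarrow> real list set set) \<Rightarrow> (real ^ 'n) set \<Rightarrow> bool" where
  "definable S A \<longleftrightarrow> coords ` A \<in> S CARD('n)"

definition definable_map_on ::
    "(nat \<Rightarrow> real list set set) \<Rightarrow> (real ^ 'm) set \<Rightarrow> (real ^ 'm \<Rightarrow> real ^ 'n) \<Rightarrow> bool" where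
  "definable_map_on S A h \<longleftrightarrow> (\<lambda>x. coords x @ coords (h x)) ` A \<in> S (CARD('m) + CARD('n))"


section \<open>Subdivisions and simplicial approximations\<close>

text \<open>A \<^const>\<open>simplicial_complex\<close> of the library is a finite set of closed simplices, and it
  contains the empty simplex as soon as it is nonempty. Its polyhedron is the union.\<close>

definition vertices :: "'a::euclidean_space set \<Rightarrow> 'a set" where
  "vertices s = {v. v extreme_point_of s}"

definition simplices :: "nat \<Rightarrow> 'a::euclidean_space set set \<Rightarrow> 'a set set" where
  "simplices p T = {s \<in> T. int p simplex s}"

definition subdivision_of :: "'a::euclidean_space set set \<Rightarrow> 'a set set \<Rightarrow> bool" where
  "subdivision_of T T' \<longleftrightarrow>
     simplicial_complex T' \<and>
     (\<forall>s\<in>T'. \<exists>t\<in>T. s \<subseteq> t) \<and>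
     (\<forall>t\<in>T. \<exists>F\<subseteq>T'. t = \<Union>F)"

definition open_star :: "'a::euclidean_space set set \<Rightarrow> 'a \<Rightarrow> 'a set" where
  "open_star T v = \<Union> (rel_interior ` {s \<in> T. v \<in> vertices s})"

text \<open>A simplicial map is given by its values on vertices.\<close>

definition simplicial_vertex_map ::
    "'a::euclidean_space set set \<Rightarrow> 'b::euclidean_space set set \<Rightarrow> ('a \<Rightarrow> 'b) \<Rightarrow> bool" where
  "simplicial_vertex_map T' T \<phi> \<longleftrightarrow> (\<forall>s\<in>T'. \<exists>t\<in>T. \<phi> ` vertices s = vertices t)"

definition simplicial_approximation ::
    "'a::euclidean_space set set \<Rightarrow> 'b::euclidean_space set set \<Rightarrow> ('a \<Rightarrow> 'b) \<Rightarrow> ('a \<Rightarrow> 'b) \<Rightarrow> bool" where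
  "simplicial_approximation T' T g \<phi> \<longleftrightarrow>
     simplicial_vertex_map T' T \<phi> \<and>
     (\<forall>v. {v} \<in> T' \<longrightarrow> g ` open_star T' v \<subseteq> open_star T (\<phi> v))"


section \<open>Oriented simplices and the matrices of the chain maps\<close>

text \<open>An orientation of a simplex is represented by an ordering of its vertices; two orderings
  represent the same orientation iff they differ by an even permutation. The chosen oriented
  \<open>p\<close>-simplices form the basis of the \<open>p\<close>-chains, and a linear map of chains is given by its matrix
  in these bases, indexed by simplices (row first).\<close>

definition orientation :: "'a::euclidean_space set set \<Rightarrow> ('a set \<Rightarrow> 'a list) \<Rightarrow> bool" where
  "orientation T \<omega> \<longleftrightarrow> (\<forall>s\<in>T. distinct (\<omega> s) \<and> set (\<omega> s) = vertices s)"

text \<open>The coefficient of \<open>[v\<^sub>0, \<dots>, v\<^sub>p]\<close> in the oriented simplex \<open>[u\<^sub>0, \<dots>, u\<^sub>p]\<close>, the latter being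
  zero if a vertex is repeated.\<close>

definition oriented_coeff :: "'a list \<Rightarrow> 'a list \<Rightarrow> rat" where
  "oriented_coeff vs us =
     (if distinct us \<and> set us = set vs
      then of_int (sign (THE \<pi>. \<pi> permutes {..<length vs} \<and> permute_list \<pi> vs = us))
      else 0)"

text \<open>The chain map induced by \<open>\<phi>\<close> sends \<open>[w\<^sub>0, \<dots>, w\<^sub>p]\<close> to \<open>[\<phi> w\<^sub>0, \<dots>, \<phi> w\<^sub>p]\<close>.\<close>

definition simplicial_chain_matrix ::
    "('b set \<Rightarrow> 'b list) \<Rightarrow> ('a set \<Rightarrow> 'a list) \<Rightarrow> ('a \<Rightarrow> 'b) \<Rightarrow> 'b set \<Rightarrow> 'a set \<Rightarrow> rat" where
  "simplicial_chain_matrix \<omega> \<omega>' \<phi> t s = oriented_coeff (\<omega> t) (map \<phi> (\<omega>' s))"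

text \<open>For affinely independent \<open>[v\<^sub>0, \<dots>, v\<^sub>p]\<close> and \<open>[w\<^sub>0, \<dots>, w\<^sub>p]\<close> in the same \<open>p\<close>-dimensional affine
  subspace: \<open>1\<close> or \<open>-1\<close> according to whether they orient it in the same way, i.e. the sign of the
  determinant of the change of basis between \<open>v\<^sub>j - v\<^sub>0\<close> and \<open>w\<^sub>i - w\<^sub>0\<close> (\<open>1 \<le> i, j \<le> p\<close>).\<close>

definition relative_orientation :: "'a::euclidean_space list \<Rightarrow> 'a list \<Rightarrow> rat" where
  "relative_orientation vs ws =
     (let p = length vs - 1;
          B = (\<lambda>v. v - vs ! 0) ` set (tl vs);
          d = Determinant.det (Matrix.mat p p (\<lambda>(i, j).
                representation B (ws ! Suc i - ws ! 0) (vs ! Suc j - vs ! 0)))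
      in if d > 0 then 1 else if d < 0 then - 1 else 0)"

text \<open>The subdivision operator sends an oriented \<open>p\<close>-simplex \<open>u\<close> to the sum of the \<open>p\<close>-simplices of
  the subdivision that lie in \<open>u\<close>, each with the orientation induced by that of \<open>u\<close>.\<close>

definition subdivision_matrix ::
    "('a::euclidean_space set \<Rightarrow> 'a list) \<Rightarrow> ('a set \<Rightarrow> 'a list) \<Rightarrow> 'a set \<Rightarrow> 'a set \<Rightarrow> rat" where
  "subdivision_matrix \<omega> \<omega>' s u = (if s \<subseteq> u then relative_orientation (\<omega> u) (\<omega>' s) else 0)"

definition chain_endo_matrix ::
    "nat \<Rightarrow> 'a::euclidean_space set set \<Rightarrow> ('a set \<Rightarrow> 'a list) \<Rightarrow> ('a set \<Rightarrow> 'a list) \<Rightarrow> ('a \<Rightarrow> 'a)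
      \<Rightarrow> 'a set \<Rightarrow> 'a set \<Rightarrow> rat" where
  "chain_endo_matrix p T' \<omega> \<omega>' \<phi> t u =
     (\<Sum>s\<in>simplices p T'. simplicial_chain_matrix \<omega> \<omega>' \<phi> t s * subdivision_matrix \<omega> \<omega>' s u)"


section \<open>The combinatorial Lefschetz number\<close>

text \<open>Simplices have dimension at most \<open>DIM('a)\<close>, so the sum runs over all dimensions \<open>p\<close>.\<close>

definition alternating_trace ::
    "'a::euclidean_space set set \<Rightarrow> 'a set set \<Rightarrow> ('a set \<Rightarrow> 'a list) \<Rightarrow> ('a set \<Rightarrow> 'a list)
      \<Rightarrow> ('a \<Rightarrow> 'a) \<Rightarrow> 'a set \<Rightarrow> rat" where
  "alternating_trace T T' \<omega> \<omega>' \<phi> A =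
     (\<Sum>p\<le>DIM('a). (-1) ^ p *
        (\<Sum>t\<in>{t \<in> simplices p T. rel_interior t \<subseteq> A}. chain_endo_matrix p T' \<omega> \<omega>' \<phi> t t))"

definition definable_triangulation ::
    "(nat \<Rightarrow> real list set set) \<Rightarrow> (real ^ 'n) set \<Rightarrow> (real ^ 'n) set \<Rightarrow> (real ^ 'm) set set
      \<Rightarrow> (real ^ 'm \<Rightarrow> real ^ 'n) \<Rightarrow> (real ^ 'n \<Rightarrow> real ^ 'm) \<Rightarrow> bool" where
  "definable_triangulation S Z D T \<tau> \<tau>' \<longleftrightarrow>
     simplicial_complex T \<and>
     homeomorphism (\<Union>T) Z \<tau> \<tau>' \<and>
     definable_map_on S (\<Union>T) \<tau> \<and>
     (\<exists>F\<subseteq>T. {x \<in> \<Union>T. \<tau> x \<in> D} = \<Union> (rel_interior ` F))"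

text \<open>\<open>\<Lambda>\<close> is the value of the combinatorial Lefschetz number of \<open>l\<close> in \<open>D\<close> with respect to the
  polyhedron \<open>Z\<close> for some admissible choice of triangulation, subdivision, orientations and
  simplicial approximation. The type argument fixes the Euclidean space containing the triangulating
  complex, which need not be the one containing \<open>Z\<close>.\<close>

definition is_combinatorial_Lefschetz_number ::
    "'m::finite itself \<Rightarrow> (nat \<Rightarrow> real list set set) \<Rightarrow> (real ^ 'n) set \<Rightarrow> (real ^ 'n \<Rightarrow> real ^ 'n)
      \<Rightarrow> (real ^ 'n) set \<Rightarrow> rat \<Rightarrow> bool" where
  "is_combinatorial_Lefschetz_number _ S Z l D \<Lambda> \<longleftrightarrow>
     (\<exists>(T :: (real ^ 'm) set set) \<tau> \<tau>' T' \<phi> \<omega> \<omega>'.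
        definable_triangulation S Z D T \<tau> \<tau>' \<and>
        subdivision_of T T' \<and>
        simplicial_approximation T' T (\<tau>' \<circ> l \<circ> \<tau>) \<phi> \<and>
        orientation T \<omega> \<and> orientation T' \<omega>' \<and>
        \<Lambda> = alternating_trace T T' \<omega> \<omega>' \<phi> {x \<in> \<Union>T. \<tau> x \<in> D})"

end

theory Submission
  imports Defs "HOL-Library.Poly_Mapping"
begin

text \<open>Let \<open>B\<close> be the union of open simplices that corresponds to \<open>A\<close> in the triangulation, and \<open>g\<close>
  the map \<open>f\<close> transported there. The alternating trace is additive in \<open>B\<close>, and \<open>g\<close> preserves the
  closure of \<open>B\<close> as well as the boundary of \<open>B\<close> in it. Inductively the number of \<open>B\<close> becomes an
  alternating sum of the numbers of closed invariant subcomplexes contained in the closure of \<open>B\<close>,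
  so it suffices to prove the Lefschetz fixed point theorem for a closed complex.

  There the trace is that of a chain map, and homotopic chain maps have equal traces. Chain
  homotopies come from acyclic carriers in the complex of tuples of points of small diameter, which
  is acyclic on convex sets and on which a continuous map acts point by point. This moves the trace
  to a fine subdivision, on which a map without fixed points has no diagonal entries. That the given
  subdivision operator is a chain map is a geometric fact: a simplex of codimension one in the
  interior of a subdivided simplex is a face of exactly two top-dimensional simplices, which lie on
  opposite sides, and one in the boundary is a face of exactly one.\<close>

section \<open>Ordered chains\<close>

text \<open>\<open>T\<close> and \<open>T'\<close> are fixed and may be coarse compared with the
  displacement of \<open>g\<close>, so diagonal entries need not vanish there. The trace has to be
  moved to a finer subdivision, and small tuples are the common target in which all the complexes
  can be compared: chain maps with the same convex carriers become homotopic there, and no new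
  approximation of \<open>g\<close> is needed. Homology is never formed; everything is an equality
  of traces of chain maps. Two kinds of chains occur, because cones and prisms are free of sign
  bookkeeping on ordered chains, while traces have to be taken on oriented ones, where degenerate
  tuples vanish. All complexes are augmented by the empty simplex. It starts the carrier recursions,
  and it makes a vanishing Lefschetz number appear as an augmented trace equal to 1. For a set that
  is not closed the submatrix need not belong to a chain map of a subcomplex, whence the detour
  through closures.\<close>

type_synonym 'a chain = "'a list \<Rightarrow>\<^sub>0 int"

definition join_pt :: "'a \<Rightarrow> 'a chain \<Rightarrow> 'a chain" where
  "join_pt x = frag_extend (\<lambda>us. frag_of (x # us))"

definition push :: "('a \<Rightarrow> 'b) \<Rightarrow> 'a chain \<Rightarrow> 'b chain" where
  "push p = frag_extend (\<lambda>us. frag_of (map p us))"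

text \<open>The recursion is the cone formula for the alternating sum of faces. As
  \<open>bdl [x] = frag_of []\<close>, the boundary is augmented: a chain of points is a cycle iff
  its coefficients sum to zero.\<close>

fun bdl :: "'a list \<Rightarrow> 'a chain" where
  "bdl [] = 0"
| "bdl (x # us) = frag_of us - join_pt x (bdl us)"

definition bd :: "'a chain \<Rightarrow> 'a chain" where
  "bd = frag_extend bdl"

text \<open>Unfolded, this is the alternating sum of the lists
  \<open>p x0, ..., p xi, q xi, ..., q xn\<close>, the standard prism between two vertex
  maps.\<close>

fun prisml :: "('a \<Rightarrow> 'b) \<Rightarrow> ('a \<Rightarrow> 'b) \<Rightarrow> 'a list \<Rightarrow> 'b chain" where
  "prisml p q [] = 0"
| "prisml p q (x # us) = frag_of (p x # q x # map q us) - join_pt (p x) (prisml p q us)"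

definition prism :: "('a \<Rightarrow> 'b) \<Rightarrow> ('a \<Rightarrow> 'b) \<Rightarrow> 'a chain \<Rightarrow> 'b chain" where
  "prism p q = frag_extend (prisml p q)"

lemma frag_of_list_simps [simp]:
  "join_pt x (frag_of us) = frag_of (x # us)" "push p (frag_of us) = frag_of (map p us)"
  "bd (frag_of us) = bdl us" "prism p q (frag_of us) = prisml p q us"
  by (simp_all add: join_pt_def push_def bd_def prism_def)

lemma linear_simps [simp]:
  "join_pt x 0 = 0" "push p 0 = 0" "bd 0 = 0" "prism p q 0 = 0"
  "join_pt x (c - d) = join_pt x c - join_pt x d" "push p (a - b) = push p a - push p b"
  "bd (c - d) = bd c - bd d" "prism p q (a - b) = prism p q a - prism p q b"
  "join_pt x (c + d) = join_pt x c + join_pt x d" "push p (a + b) = push p a + push p b"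
  "bd (c + d) = bd c + bd d" "prism p q (a + b) = prism p q a + prism p q b"
  "join_pt x (frag_cmul n c) = frag_cmul n (join_pt x c)" "push p (frag_cmul n a) = frag_cmul n (push p a)"
  "bd (frag_cmul n c) = frag_cmul n (bd c)" "prism p q (frag_cmul n a) = frag_cmul n (prism p q a)"
  by (simp_all add: join_pt_def push_def bd_def prism_def frag_extend_diff frag_extend_add frag_extend_cmul)

lemma linear_sum:
  "bd (sum c I) = (\<Sum>i\<in>I. bd (c i))" "push p (sum c' I) = (\<Sum>i\<in>I. push p (c' i))"
  by (induction I rule: infinite_finite_induct) simp_all

lemma frag_ext:
  fixes f g :: "('a \<Rightarrow>\<^sub>0 int) \<Rightarrow> ('b \<Rightarrow>\<^sub>0 int)"
  assumes "\<And>x. x \<in> S \<Longrightarrow> f (frag_of x) = g (frag_of x)"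
    and "f 0 = 0" "g 0 = 0"
    and "\<And>c d. f (c - d) = f c - f d" "\<And>c d. g (c - d) = g c - g d"
    and "Poly_Mapping.keys c \<subseteq> S"
  shows "f c = g c"
  by (rule frag_induction[OF assms(6)]) (simp_all add: assms)

lemma bd_join [simp]: "bd (join_pt x c) = c - join_pt x (bd c)"
  by (rule frag_ext[of UNIV "\<lambda>c. bd (join_pt x c)" "\<lambda>c. c - join_pt x (bd c)"]) (simp_all add: algebra_simps)

lemma bd_bdl [simp]: "bd (bdl us) = 0"
  by (induction us) simp_all

lemma bd_bd [simp]: "bd (bd c) = 0"
  by (rule frag_ext[of UNIV "\<lambda>c. bd (bd c)" "\<lambda>c. 0"]) simp_all

lemma push_join [simp]: "push p (join_pt x c) = join_pt (p x) (push p c)"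
  by (rule frag_ext[of UNIV "\<lambda>c. push p (join_pt x c)" "\<lambda>c. join_pt (p x) (push p c)"]) simp_all

lemma push_bdl: "push p (bdl us) = bdl (map p us)"
  by (induction us) simp_all

lemma bd_push: "bd (push p c) = push p (bd c)"
  by (rule frag_ext[of UNIV "\<lambda>c. bd (push p c)" "\<lambda>c. push p (bd c)"]) (simp_all add: push_bdl)

lemma push_push: "push p (push q c) = push (p \<circ> q) c"
  by (rule frag_ext[of UNIV "\<lambda>c. push p (push q c)" "\<lambda>c. push (p \<circ> q) c"]) simp_all

lemma prism_join: "prism p q (join_pt x c) = join_pt (p x) (join_pt (q x) (push q c)) - join_pt (p x) (prism p q c)"
  by (rule frag_ext[of UNIV "\<lambda>c. prism p q (join_pt x c)"
        "\<lambda>c. join_pt (p x) (join_pt (q x) (push q c)) - join_pt (p x) (prism p q c)"]) simp_all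

lemma bd_prisml: "bd (prisml p q us) = frag_of (map q us) - frag_of (map p us) - prism p q (bdl us)"
  by (induction us) (simp_all add: prism_join push_bdl)

lemma bd_prism: "bd (prism p q c) = push q c - push p c - prism p q (bd c)"
  by (rule frag_ext[of UNIV "\<lambda>c. bd (prism p q c)" "\<lambda>c. push q c - push p c - prism p q (bd c)"])
    (simp_all add: bd_prisml)

text \<open>Chains of degree \<open>n - 1\<close> with simplices taken from \<open>\<Omega>\<close>; the empty list has degree \<open>-1\<close>.\<close>

definition chain_group :: "'a list set \<Rightarrow> nat \<Rightarrow> 'a chain set" where
  "chain_group \<Omega> n = {c. Poly_Mapping.keys c \<subseteq> \<Omega> \<inter> {us. length us = n}}"

lemma chains_0 [simp]: "0 \<in> chain_group \<Omega> n"
  by (simp add: chain_group_def)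

lemma chains_of [simp]: "frag_of us \<in> chain_group \<Omega> n \<longleftrightarrow> us \<in> \<Omega> \<and> length us = n"
  by (simp add: chain_group_def)

lemma chains_diff: "c \<in> chain_group \<Omega> n \<Longrightarrow> d \<in> chain_group \<Omega> n \<Longrightarrow> c - d \<in> chain_group \<Omega> n"
  unfolding chain_group_def using keys_diff[of c d] by blast

lemma chains_add: "c \<in> chain_group \<Omega> n \<Longrightarrow> d \<in> chain_group \<Omega> n \<Longrightarrow> c + d \<in> chain_group \<Omega> n"
  unfolding chain_group_def using keys_add[of c d] by blast

lemma chains_cmul: "c \<in> chain_group \<Omega> n \<Longrightarrow> frag_cmul k c \<in> chain_group \<Omega> n"
  unfolding chain_group_def using keys_cmul[of k c] by blast

lemma chains_sum: "(\<And>i. i \<in> I \<Longrightarrow> c i \<in> chain_group \<Omega> n) \<Longrightarrow> sum c I \<in> chain_group \<Omega> n"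
  by (induction I rule: infinite_finite_induct) (simp_all add: chains_add)

lemma chains_extend:
  assumes "Poly_Mapping.keys c \<subseteq> S" "\<And>x. x \<in> S \<Longrightarrow> f x \<in> chain_group \<Omega> n"
  shows "frag_extend f c \<in> chain_group \<Omega> n"
  using keys_frag_extend[of f c] assms unfolding chain_group_def by fastforce

lemma chains_mono: "\<Omega> \<subseteq> \<Omega>' \<Longrightarrow> chain_group \<Omega> n \<subseteq> chain_group \<Omega>' n"
  by (auto simp: chain_group_def)

lemma chains_push:
  assumes "c \<in> chain_group \<Omega> n" "\<And>us. us \<in> \<Omega> \<Longrightarrow> map p us \<in> \<Omega>'"
  shows "push p c \<in> chain_group \<Omega>' n"
  unfolding push_def
  by (rule chains_extend[of _ "\<Omega> \<inter> {us. length us = n}"]) (use assms in \<open>auto simp: chain_group_def\<close>)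

lemma chains_join:
  assumes "c \<in> chain_group \<Omega> n" "\<And>us. us \<in> \<Omega> \<Longrightarrow> x # us \<in> \<Omega>'"
  shows "join_pt x c \<in> chain_group \<Omega>' (Suc n)"
  unfolding join_pt_def
  by (rule chains_extend[of _ "\<Omega> \<inter> {us. length us = n}"]) (use assms in \<open>auto simp: chain_group_def\<close>)

lemma prisml_chains: "prisml p q us \<in> chain_group {vs. set vs \<subseteq> p ` set us \<union> q ` set us} (Suc (length us))"
proof (induction us)
  case (Cons x us)
  show ?case
    using chains_join[OF Cons.IH, of "p x" "{vs. set vs \<subseteq> p ` set (x # us) \<union> q ` set (x # us)}"]
    by (auto intro!: chains_diff)
qed simp

lemma prism_chains:
  assumes "c \<in> chain_group \<Omega> n" and "\<And>us vs. us \<in> \<Omega> \<Longrightarrow> set vs \<subseteq> p ` set us \<union> q ` set us \<Longrightarrow> vs \<in> \<Omega>'"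
  shows "prism p q c \<in> chain_group \<Omega>' (Suc n)"
  unfolding prism_def
proof (rule chains_extend)
  show "Poly_Mapping.keys c \<subseteq> \<Omega> \<inter> {us. length us = n}" using assms by (simp add: chain_group_def)
  fix us assume us: "us \<in> \<Omega> \<inter> {us. length us = n}"
  then have "{vs. set vs \<subseteq> p ` set us \<union> q ` set us} \<subseteq> \<Omega>'"
    using assms(2) by blast
  from chains_mono[OF this] prisml_chains[of p q us] us show "prisml p q us \<in> chain_group \<Omega>' (Suc n)"
    by auto
qed

text \<open>Exactness of the augmented complex. The case \<open>n = 0\<close> is included: if the
  empty list is in \<Omega>, it must bound, so \<Omega> contains a one-element list.\<close>

definition acyclic_lists :: "'a list set \<Rightarrow> bool" where
  "acyclic_lists \<Omega> \<longleftrightarrow> (\<forall>n. \<forall>z\<in>chain_group \<Omega> n. bd z = 0 \<longrightarrow> (\<exists>y\<in>chain_group \<Omega> (Suc n). bd y = z))"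

text \<open>The cone with apex \<open>x\<close> is a contracting homotopy, by
  \<open>bd_join\<close>.\<close>

lemma acyclic_lists_all:
  assumes "x \<in> W" shows "acyclic_lists {us. set us \<subseteq> W}"
  unfolding acyclic_lists_def
proof (intro allI ballI impI)
  fix n z assume z: "z \<in> chain_group {us. set us \<subseteq> W} n" "bd z = 0"
  then have "join_pt x z \<in> chain_group {us. set us \<subseteq> W} (Suc n)" using assms by (intro chains_join) auto
  then show "\<exists>y\<in>chain_group {us. set us \<subseteq> W} (Suc n). bd y = z" using z by force
qed

section \<open>Signs and oriented chains\<close>

text \<open>A fixed linear order of the points orients every finite set; \<open>ord_sign v u\<close> is the sign
  of the oriented pair \<open>[v, u]\<close>.\<close>

definition pt_order :: "('a \<times> 'a) set" where
  "pt_order = (SOME r. well_order_on UNIV r)"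

definition ord_sign :: "'a \<Rightarrow> 'a \<Rightarrow> int" where
  "ord_sign v u = (if v = u then 0 else if (v, u) \<in> pt_order then 1 else - 1)"

lemma well_order_pt_order: "well_order_on UNIV (pt_order :: ('a \<times> 'a) set)"
proof -
  obtain r :: "('a \<times> 'a) set" where "well_order_on UNIV r"
    using well_order_on by blast
  then show ?thesis
    unfolding pt_order_def by (rule someI[of "well_order_on UNIV" r])
qed

lemma pt_order_props:
  "antisym (pt_order :: ('a \<times> 'a) set)" "total (pt_order :: ('a \<times> 'a) set)"
  "wf (pt_order - Id :: ('a \<times> 'a) set)"
  using well_order_pt_order[where 'a = 'a]
  by (auto simp: well_order_on_def linear_order_on_def partial_order_on_def preorder_on_def)

lemma pt_order_antisym: "(u, v) \<in> pt_order \<Longrightarrow> (v, u) \<in> pt_order \<Longrightarrow> u = v"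
  by (rule antisymD[OF pt_order_props(1)])

lemma pt_order_total: "(u :: 'a) \<noteq> v \<Longrightarrow> (u, v) \<in> pt_order \<or> (v, u) \<in> pt_order"
  using pt_order_props(2)[where 'a = 'a] unfolding total_on_def by simp

lemma ord_sign_self [simp]: "ord_sign v v = 0"
  by (simp add: ord_sign_def)

lemma ord_sign_swap: "ord_sign u v = - ord_sign v u"
  using pt_order_antisym[of u v] pt_order_total[of u v] by (auto simp: ord_sign_def)

lemma ord_sign_sq: "u \<noteq> v \<Longrightarrow> ord_sign u v * ord_sign u v = 1"
  by (auto simp: ord_sign_def)

text \<open>The sign of moving \<open>v\<close> from the front of \<open>w\<close> to its place in
  increasing order, that is, -1 to the number of elements of \<open>w\<close> below
  \<open>v\<close>; zero if \<open>v\<close> already lies in a finite \<open>w\<close>.\<close>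

definition eps :: "'a \<Rightarrow> 'a set \<Rightarrow> int" where
  "eps v w = (\<Prod>u\<in>w. ord_sign v u)"

text \<open>The parity of the sorting permutation as a product over pairs, zero on lists with
  repetitions. The product form reduces the behaviour under maps and exchanges to a computation with
  factors.\<close>

fun list_sign :: "'a list \<Rightarrow> int" where
  "list_sign [] = 1"
| "list_sign (x # us) = (\<Prod>u\<leftarrow>us. ord_sign x u) * list_sign us"

lemma eps_mem: "finite w \<Longrightarrow> v \<in> w \<Longrightarrow> eps v w = 0"
  unfolding eps_def by (rule prod_zero) (auto intro: bexI[of _ v])

lemma eps_sq: "v \<notin> w \<Longrightarrow> eps v w * eps v w = 1"
  unfolding eps_def prod.distrib[symmetric]
  by (rule prod.neutral) (metis ord_sign_sq)

lemma eps_insert: "finite w \<Longrightarrow> u \<notin> w \<Longrightarrow> eps v (insert u w) = ord_sign v u * eps v w"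
  by (simp add: eps_def)

lemma list_sign_not_distinct: "\<not> distinct us \<Longrightarrow> list_sign us = 0"
proof (induction us)
  case (Cons x us)
  then show ?case by (auto simp: prod_list_zero_iff image_iff intro: bexI[of _ x])
qed simp

lemma list_sign_distinct_Cons: "list_sign (x # us) = eps x (set us) * list_sign us"
proof (cases "distinct us")
  case True
  then show ?thesis by (simp add: eps_def prod.distinct_set_conv_list)
qed (simp add: list_sign_not_distinct)

lemma list_sign_sq: "distinct us \<Longrightarrow> list_sign us * list_sign us = 1"
proof (induction us)
  case (Cons x us)
  have "list_sign (x # us) * list_sign (x # us) =
      (eps x (set us) * eps x (set us)) * (list_sign us * list_sign us)"
    unfolding list_sign_distinct_Cons by (simp only: ac_simps)
  also have "\<dots> = 1" using Cons eps_sq[of x "set us"] by simp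
  finally show ?case .
qed simp

lemma frag_cmul_diff_distrib2: "frag_cmul k (c - d) = frag_cmul k c - frag_cmul k d"
  by (rule poly_mapping_eqI) (simp add: lookup_minus algebra_simps)

text \<open>The projection from ordered to oriented chains: a finite set stands for its increasing
  orientation, and degenerate lists vanish. By \<open>alt_bd\<close> it is a chain map to the
  complex with boundary \<open>sbd\<close>.\<close>

definition alt :: "'a chain \<Rightarrow> 'a set \<Rightarrow>\<^sub>0 int" where
  "alt = frag_extend (\<lambda>us. frag_cmul (list_sign us) (frag_of (set us)))"

definition sbd :: "'a set \<Rightarrow> 'a set \<Rightarrow>\<^sub>0 int" where
  "sbd s = (\<Sum>v\<in>s. frag_cmul (eps v (s - {v})) (frag_of (s - {v})))"

lemma alt_simps [simp]:
  "alt 0 = 0" "alt (frag_of us) = frag_cmul (list_sign us) (frag_of (set us))"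
  "alt (c - d) = alt c - alt d" "alt (c + d) = alt c + alt d" "alt (frag_cmul n c) = frag_cmul n (alt c)"
  by (simp_all add: alt_def frag_extend_diff frag_extend_add frag_extend_cmul)

lemma alt_join:
  "alt (join_pt x c) = frag_extend (\<lambda>w. frag_cmul (eps x w) (frag_of (insert x w))) (alt c)"
proof (rule frag_ext[of UNIV "\<lambda>c. alt (join_pt x c)"
      "\<lambda>c. frag_extend (\<lambda>w. frag_cmul (eps x w) (frag_of (insert x w))) (alt c)"])
  fix us
  show "alt (join_pt x (frag_of us)) =
    frag_extend (\<lambda>w. frag_cmul (eps x w) (frag_of (insert x w))) (alt (frag_of us))"
    by (simp only: frag_of_list_simps alt_simps list_sign_distinct_Cons frag_extend_cmul)
      (simp add: mult.commute)
qed (simp_all add: frag_extend_diff)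

text \<open>The cone formula of \<open>bdl\<close> in oriented form. For \<open>x\<close> in
  \<open>w\<close> the left side vanishes, and on the right only the face opposite to
  \<open>x\<close> survives and cancels \<open>frag_of w\<close>. Otherwise exchanging the insertion
  of \<open>x\<close> with the removal of \<open>v\<close> costs one sign.\<close>

lemma sbd_join:
  assumes "finite w"
  shows "frag_cmul (eps x w) (sbd (insert x w)) = frag_of w -
    frag_extend (\<lambda>w. frag_cmul (eps x w) (frag_of (insert x w))) (sbd w)"
proof (cases "x \<in> w")
  case True
  have "frag_extend (\<lambda>w. frag_cmul (eps x w) (frag_of (insert x w))) (sbd w)
    = (\<Sum>v\<in>w. frag_cmul (eps v (w - {v}) * eps x (w - {v})) (frag_of (insert x (w - {v}))))"
    unfolding sbd_def by (simp add: frag_extend_sum assms frag_extend_cmul o_def)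
  also have "\<dots> = (\<Sum>v\<in>w. if v = x then frag_of w else 0)"
  proof (rule sum.cong)
    fix v assume "v \<in> w"
    show "frag_cmul (eps v (w - {v}) * eps x (w - {v})) (frag_of (insert x (w - {v}))) =
      (if v = x then frag_of w else 0)"
    proof (cases "v = x")
      case v: True
      have "eps x (w - {x}) * eps x (w - {x}) = 1" by (simp add: eps_sq)
      then show ?thesis using v True by (simp add: insert_absorb)
    next
      case False
      then have "eps x (w - {v}) = 0" using True assms by (intro eps_mem) auto
      then show ?thesis using False by simp
    qed
  qed simp
  also have "\<dots> = frag_of w" using True assms by simp
  finally show ?thesis using True assms by (simp add: eps_mem)
next
  case False
  have *: "eps x w * eps v (insert x (w - {v})) = - (eps v (w - {v}) * eps x (w - {v}))" if "v \<in> w" for v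
  proof -
    have "eps x w = ord_sign x v * eps x (w - {v})"
      using eps_insert[of "w - {v}" v x] assms that by (simp add: insert_absorb)
    moreover have "eps v (insert x (w - {v})) = ord_sign v x * eps v (w - {v})"
      using eps_insert[of "w - {v}" x v] assms False by simp
    moreover have "ord_sign x v * ord_sign v x = - 1"
      using ord_sign_sq[of x v] ord_sign_swap[of v x] that False by auto
    moreover have "ord_sign x v * e * (ord_sign v x * e') = ord_sign x v * ord_sign v x * (e' * e)" for e e'
      by (simp only: ac_simps)
    ultimately show ?thesis by simp
  qed
  have ne: "insert x w - {v} = insert x (w - {v})" if "v \<in> w" for v using that False by auto
  have "frag_cmul (eps x w) (sbd (insert x w)) =
    frag_of w + (\<Sum>v\<in>w. frag_cmul (eps x w * eps v (insert x (w - {v}))) (frag_of (insert x (w - {v}))))"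
    unfolding sbd_def using assms False
    by (simp add: frag_cmul_distrib2 frag_cmul_sum eps_sq ne cong: sum.cong)
  also have "\<dots> = frag_of w - (\<Sum>v\<in>w. frag_cmul (eps v (w - {v}) * eps x (w - {v})) (frag_of (insert x (w - {v}))))"
    by (simp add: * sum_negf[symmetric])
  also have "(\<Sum>v\<in>w. frag_cmul (eps v (w - {v}) * eps x (w - {v})) (frag_of (insert x (w - {v})))) =
    frag_extend (\<lambda>w. frag_cmul (eps x w) (frag_of (insert x w))) (sbd w)"
    unfolding sbd_def by (simp add: frag_extend_sum assms frag_extend_cmul o_def)
  finally show ?thesis .
qed

lemma alt_bdl: "alt (bdl us) = frag_cmul (list_sign us) (sbd (set us))"
proof (induction us)
  case (Cons x us)
  let ?e = "\<lambda>w. frag_cmul (eps x w) (frag_of (insert x w))"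
  have "frag_cmul (list_sign (x # us)) (sbd (set (x # us))) =
    frag_cmul (list_sign us) (frag_cmul (eps x (set us)) (sbd (insert x (set us))))"
    unfolding list_sign_distinct_Cons by (simp add: mult.commute)
  also have "\<dots> = frag_cmul (list_sign us) (frag_of (set us)) - frag_extend ?e (alt (bdl us))"
    by (simp add: sbd_join Cons.IH frag_extend_cmul frag_cmul_diff_distrib2)
  finally show ?case by (simp add: alt_join)
qed (simp add: sbd_def)

lemma alt_bd: "alt (bd c) = frag_extend sbd (alt c)"
  by (rule frag_ext[of UNIV "\<lambda>c. alt (bd c)" "\<lambda>c. frag_extend sbd (alt c)"])
    (simp_all add: alt_bdl frag_extend_diff frag_extend_cmul)

section \<open>Increasing lists as representatives of oriented simplices\<close>

definition sorted_list :: "'a set \<Rightarrow> 'a list" where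
  "sorted_list s = (SOME us. set us = s \<and> distinct us \<and> sorted_wrt (\<lambda>u v. (u, v) \<in> pt_order) us)"

lemma sorted_list:
  assumes "finite s"
  shows "set (sorted_list s) = s" "distinct (sorted_list s)"
    "sorted_wrt (\<lambda>u v. (u, v) \<in> pt_order) (sorted_list s)"
proof -
  have "\<exists>us. set us = s \<and> distinct us \<and> sorted_wrt (\<lambda>u v. (u, v) \<in> pt_order) us"
    using assms
  proof (induction "card s" arbitrary: s)
    case (Suc n)
    obtain z where z: "z \<in> s" using Suc.hyps(2) by fastforce
    obtain x where x: "x \<in> s" "\<And>y. (y, x) \<in> pt_order - Id \<Longrightarrow> y \<notin> s"
      by (rule wfE_min[OF pt_order_props(3) z]) blast
    have "n = card (s - {x})" "finite (s - {x})" using Suc.hyps(2) Suc.prems x(1) by simp_all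
    from Suc.hyps(1)[OF this] obtain us where us: "set us = s - {x}" "distinct us"
      "sorted_wrt (\<lambda>u v. (u, v) \<in> pt_order) us"
      by blast
    have "(x, y) \<in> pt_order" if "y \<in> set us" for y
      using pt_order_total[of x y] x(2)[of y] us(1) that by blast
    then show ?case
      using x(1) us by (intro exI[of _ "x # us"]) auto
  qed (simp add: exI[of _ "[]"])
  from someI_ex[OF this]
  show "set (sorted_list s) = s" "distinct (sorted_list s)"
    "sorted_wrt (\<lambda>u v. (u, v) \<in> pt_order) (sorted_list s)"
    unfolding sorted_list_def by auto
qed

lemma length_sorted_list: "finite s \<Longrightarrow> length (sorted_list s) = card s"
  by (metis distinct_card sorted_list(1,2))

lemma sorted_list_unique:
  assumes "distinct us" "sorted_wrt (\<lambda>u v. (u, v) \<in> pt_order) us"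
  shows "sorted_list (set us) = us"
proof -
  have "us = vs" if "distinct us" "sorted_wrt (\<lambda>u v. (u, v) \<in> pt_order) us"
    "distinct vs" "sorted_wrt (\<lambda>u v. (u, v) \<in> pt_order) vs" "set us = set vs" for us vs :: "'a list"
    using that
  proof (induction us arbitrary: vs)
    case (Cons x us)
    then obtain y ws where vs: "vs = y # ws" by (cases vs) auto
    have "x = y"
    proof (rule ccontr)
      assume "x \<noteq> y"
      then have "y \<in> set us" "x \<in> set ws" using Cons.prems(5) unfolding vs by auto
      then show False using Cons.prems(2,4) \<open>x \<noteq> y\<close> pt_order_antisym[of x y] unfolding vs by simp
    qed
    moreover from this have "us = ws" using Cons.prems unfolding vs by (intro Cons.IH) auto
    ultimately show ?case by (simp add: vs)
  qed simp
  then show ?thesis using assms sorted_list[of "set us"] by blast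
qed

lemma list_sign_sorted:
  "distinct us \<Longrightarrow> sorted_wrt (\<lambda>u v. (u, v) \<in> pt_order) us \<Longrightarrow> list_sign us = 1"
proof (induction us)
  case (Cons x us)
  have "eps x (set us) = 1" unfolding eps_def using Cons.prems by (intro prod.neutral) (auto simp: ord_sign_def)
  then show ?case using Cons by (simp only: list_sign_distinct_Cons) simp
qed simp

lemma alt_sorted_list [simp]: "finite s \<Longrightarrow> alt (frag_of (sorted_list s)) = frag_of s"
  by (simp add: list_sign_sorted sorted_list)

lemma bdl_sorted:
  assumes "distinct us" "sorted_wrt (\<lambda>u v. (u, v) \<in> pt_order) us"
  shows "bdl us = (\<Sum>v\<in>set us. frag_cmul (eps v (set us - {v})) (frag_of (sorted_list (set us - {v}))))"
  using assms
proof (induction us)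
  case (Cons x us)
  have x: "x \<notin> set us" and e1: "eps x (set us) = 1"
    using Cons.prems unfolding eps_def by (auto simp: ord_sign_def intro!: prod.neutral)
  have "join_pt x (bdl us) = (\<Sum>v\<in>set us. frag_cmul (eps v (set us - {v})) (frag_of (x # sorted_list (set us - {v}))))"
    using Cons by (simp add: join_pt_def frag_extend_sum frag_extend_cmul o_def)
  also have "\<dots> = (\<Sum>v\<in>set us. - frag_cmul (eps v (set (x # us) - {v})) (frag_of (sorted_list (set (x # us) - {v}))))"
  proof (rule sum.cong)
    fix v assume v: "v \<in> set us"
    then have s: "set (x # us) - {v} = insert x (set us - {v})" using x by auto
    have "sorted_list (insert x (set us - {v})) = x # sorted_list (set us - {v})"
      using sorted_list_unique[of "x # sorted_list (set us - {v})"] sorted_list[of "set us - {v}"] Cons.prems by auto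
    moreover have "eps v (insert x (set us - {v})) = ord_sign v x * eps v (set us - {v})"
      using x by (intro eps_insert) auto
    moreover have "ord_sign v x = - 1" using v Cons.prems pt_order_antisym[of x v] x by (auto simp: ord_sign_def)
    ultimately show "frag_cmul (eps v (set us - {v})) (frag_of (x # sorted_list (set us - {v}))) =
      - frag_cmul (eps v (set (x # us) - {v})) (frag_of (sorted_list (set (x # us) - {v})))"
      unfolding s by simp
  qed simp
  finally show ?case
    using x e1 Cons.prems sorted_list_unique[of us] by (simp add: sum_negf del: minus_frag_cmul)
qed simp

text \<open>Together with \<open>alt_sorted_list\<close> this makes the increasing lists a chain map
  that splits \<open>alt\<close>.\<close>

lemma bd_sorted_list:
  "finite s \<Longrightarrow> bd (frag_of (sorted_list s)) = frag_extend (\<lambda>w. frag_of (sorted_list w)) (sbd s)"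
  using bdl_sorted[of "sorted_list s"] sorted_list[of s]
  by (simp add: sbd_def frag_extend_sum frag_extend_cmul o_def)

section \<open>Acyclic carriers and the alternating trace\<close>

definition abstract_complex :: "'a set set \<Rightarrow> bool" where
  "abstract_complex X \<longleftrightarrow> finite X \<and> {} \<in> X \<and> (\<forall>s\<in>X. finite s \<and> (\<forall>w\<subseteq>s. w \<in> X))"

text \<open>An augmentation-preserving chain map from the oriented chains of \<open>X\<close> to
  ordered chains with carrier \<Phi>, given by its values on simplices and extended by
  \<open>frag_extend\<close>.\<close>

definition carried_map :: "'a set set \<Rightarrow> ('a set \<Rightarrow> 'b list set) \<Rightarrow> ('a set \<Rightarrow> 'b chain) \<Rightarrow> bool" where
  "carried_map X \<Phi> F \<longleftrightarrow> F {} = frag_of [] \<and>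
     (\<forall>s\<in>X. F s \<in> chain_group (\<Phi> s) (card s) \<and> bd (F s) = frag_extend F (sbd s))"

lemma extend_sbd:
  "finite s \<Longrightarrow> frag_extend f (sbd s) = (\<Sum>v\<in>s. frag_cmul (eps v (s - {v})) (f (s - {v})))"
  unfolding sbd_def by (simp add: frag_extend_sum frag_extend_cmul o_def)

lemma extend_sbd_cong:
  assumes "finite s" "\<And>w. (w, s) \<in> finite_psubset \<Longrightarrow> f w = g w"
  shows "frag_extend f (sbd s) = frag_extend g (sbd s)"
  using assms(1)
  by (auto simp: extend_sbd finite_psubset_def intro!: sum.cong arg_cong[where f = "frag_cmul _"] assms(2))

lemma keys_sbd: "Poly_Mapping.keys (sbd s) \<subseteq> (\<lambda>v. s - {v}) ` s"
  unfolding sbd_def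
  by (rule order.trans[OF keys_sum]) auto

lemma sbd_sbd: "finite s \<Longrightarrow> frag_extend sbd (sbd s) = 0"
  using alt_bd[of "bd (frag_of (sorted_list s))"] alt_bd[of "frag_of (sorted_list s)"]
  by (simp only: bd_bd alt_simps(1) alt_sorted_list frag_extend_of)

lemma frag_extend_frag_extend:
  "frag_extend f (frag_extend g c) = frag_extend (\<lambda>x. frag_extend f (g x)) c"
  by (rule frag_ext[of UNIV "\<lambda>c. frag_extend f (frag_extend g c)"]) (simp_all add: frag_extend_diff)

lemma extend_carried:
  assumes "carried_map X \<Phi> F" "Poly_Mapping.keys c \<subseteq> X"
  shows "bd (frag_extend F c) = frag_extend F (frag_extend sbd c)"
  by (rule frag_ext[of X "\<lambda>c. bd (frag_extend F c)" "\<lambda>c. frag_extend F (frag_extend sbd c)"])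
    (use assms in \<open>auto simp: carried_map_def frag_extend_diff\<close>)

lemma extend_sbd_chains:
  assumes "finite s" "\<And>v. v \<in> s \<Longrightarrow> f (s - {v}) \<in> chain_group \<Omega> n"
  shows "frag_extend f (sbd s) \<in> chain_group \<Omega> n"
  using assms by (auto simp: extend_sbd intro!: chains_sum chains_cmul)

text \<open>The values chosen on the faces of \<open>s\<close> add up to a cycle, which monotonicity
  places in the carrier of \<open>s\<close>; acyclicity makes it bound there.\<close>

theorem carried_map_exists:
  assumes X: "abstract_complex X" and "[] \<in> \<Phi> {}"
    and mono: "\<And>w s. s \<in> X \<Longrightarrow> w \<subseteq> s \<Longrightarrow> \<Phi> w \<subseteq> \<Phi> s"
    and acyclic: "\<And>s. s \<in> X \<Longrightarrow> s \<noteq> {} \<Longrightarrow> acyclic_lists (\<Phi> s)"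
  shows "\<exists>F. carried_map X \<Phi> F"
proof -
  \<comment> \<open>\<open>P\<close> imposes nothing on nonempty sets outside \<open>X\<close>,
    since the well-founded choice runs over all sets.\<close>
  define P where "P F s y \<longleftrightarrow> (s = {} \<longrightarrow> y = frag_of []) \<and> (s \<in> X \<longrightarrow>
    y \<in> chain_group (\<Phi> s) (card s) \<and> bd y = frag_extend F (sbd s))" for F s y
  have finite_X: "finite s" if "s \<in> X" for s using X that by (auto simp: abstract_complex_def)
  have "\<exists>F. \<forall>s. P F s (F s)"
  proof (rule dependent_wf_choice[OF wf_finite_psubset])
    fix F G :: "'a set \<Rightarrow> 'b chain" and s y
    assume "\<And>w. (w, s) \<in> finite_psubset \<Longrightarrow> F w = G w"
    then show "P F s y = P G s y" using extend_sbd_cong[of s F G] finite_X[of s] by (auto simp: P_def)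
  next
    fix s and F :: "'a set \<Rightarrow> 'b chain"
    assume IH: "\<And>w. (w, s) \<in> finite_psubset \<Longrightarrow> P F w (F w)"
    show "\<exists>y. P F s y"
    proof (cases "s \<in> X \<and> s \<noteq> {}")
      case False
      then show ?thesis using assms(2) by (intro exI[of _ "frag_of []"]) (auto simp: P_def sbd_def)
    next
      case True
      then have fin: "finite s" using X by (auto simp: abstract_complex_def)
      have sub: "w \<in> X" if "w \<subseteq> s" for w using that X True by (auto simp: abstract_complex_def)
      have IH': "F w \<in> chain_group (\<Phi> w) (card w)" "bd (F w) = frag_extend F (sbd w)" if "w \<subset> s" for w
        using IH[of w] sub[of w] fin that by (auto simp: P_def finite_psubset_def)
      let ?z = "frag_extend F (sbd s)"
      have "?z \<in> chain_group (\<Phi> s) (card s - 1)"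
      proof (rule extend_sbd_chains[OF fin])
        fix v assume "v \<in> s"
        then show "F (s - {v}) \<in> chain_group (\<Phi> s) (card s - 1)"
          using IH'(1)[of "s - {v}"] chains_mono[OF mono[of s "s - {v}"], of "card s - 1"] True fin by auto
      qed
      moreover have "bd ?z = frag_extend F (frag_extend sbd (sbd s))"
        unfolding frag_extend_frag_extend[of F]
        unfolding extend_sbd[OF fin] linear_sum
        using IH'(2) by (auto intro!: sum.cong arg_cong[where f = "frag_cmul _"])
      then have "bd ?z = 0" using fin by (simp add: sbd_sbd)
      ultimately obtain y where "y \<in> chain_group (\<Phi> s) (Suc (card s - 1))" "bd y = ?z"
        using acyclic[of s] True unfolding acyclic_lists_def by blast
      moreover have "Suc (card s - 1) = card s" using True fin by (simp add: card_gt_0_iff)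
      ultimately show ?thesis using True by (auto simp: P_def)
    qed
  qed
  then show ?thesis using X by (auto simp: P_def carried_map_def)
qed

text \<open>The recursion of \<open>carried_map_exists\<close> one degree higher: the difference of
  the two maps, corrected by the homotopy on the faces, is a cycle in the carrier of
  \<open>s\<close>.\<close>

theorem carried_maps_homotopic:
  assumes X: "abstract_complex X" 
    and mono: "\<And>w s. s \<in> X \<Longrightarrow> w \<subseteq> s \<Longrightarrow> \<Phi> w \<subseteq> \<Phi> s"
    and acyclic: "\<And>s. s \<in> X \<Longrightarrow> s \<noteq> {} \<Longrightarrow> acyclic_lists (\<Phi> s)"
    and F: "carried_map X \<Phi> F" and G: "carried_map X \<Phi> G"
  shows "\<exists>D. \<forall>s\<in>X. D s \<in> chain_group (\<Phi> s) (Suc (card s)) \<and>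
    bd (D s) = F s - G s - frag_extend D (sbd s)"
proof -
  define P where "P D s y \<longleftrightarrow> (s \<in> X \<longrightarrow>
    y \<in> chain_group (\<Phi> s) (Suc (card s)) \<and> bd y = F s - G s - frag_extend D (sbd s))" for D s y
  have finite_X: "finite s" if "s \<in> X" for s using X that by (auto simp: abstract_complex_def)
  have "\<exists>D. \<forall>s. P D s (D s)"
  proof (rule dependent_wf_choice[OF wf_finite_psubset])
    fix D D' :: "'a set \<Rightarrow> 'b chain" and s y
    assume "\<And>w. (w, s) \<in> finite_psubset \<Longrightarrow> D w = D' w"
    then show "P D s y = P D' s y" using extend_sbd_cong[of s D D'] finite_X[of s] by (auto simp: P_def)
  next
    fix s and D :: "'a set \<Rightarrow> 'b chain"
    assume IH: "\<And>w. (w, s) \<in> finite_psubset \<Longrightarrow> P D w (D w)"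
    show "\<exists>y. P D s y"
    proof (cases "s \<in> X \<and> s \<noteq> {}")
      case False
      then show ?thesis
        using F G by (intro exI[of _ 0]) (auto simp: P_def carried_map_def sbd_def)
    next
      case True
      then have fin: "finite s" using X by (auto simp: abstract_complex_def)
      have sub: "w \<in> X" if "w \<subseteq> s" for w using that X True by (auto simp: abstract_complex_def)
      have IH': "D w \<in> chain_group (\<Phi> w) (Suc (card w))" "bd (D w) = F w - G w - frag_extend D (sbd w)"
        if "w \<subset> s" for w
        using IH[of w] sub[of w] fin that by (auto simp: P_def finite_psubset_def)
      let ?z = "F s - G s - frag_extend D (sbd s)"
      have "frag_extend D (sbd s) \<in> chain_group (\<Phi> s) (card s)"
      proof (rule extend_sbd_chains[OF fin])
        fix v assume v: "v \<in> s"
        then have "Suc (card (s - {v})) = card s" using fin by (intro card.remove[symmetric])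
        then show "D (s - {v}) \<in> chain_group (\<Phi> s) (card s)"
          using IH'(1)[of "s - {v}"] chains_mono[OF mono[of s "s - {v}"], of "card s"] True v by auto
      qed
      then have z: "?z \<in> chain_group (\<Phi> s) (card s)"
        using F G True by (auto simp: carried_map_def intro!: chains_diff)
      have "bd (frag_extend D (sbd s)) =
        frag_extend (\<lambda>w. F w - G w - frag_extend D (sbd w)) (sbd s)"
        unfolding extend_sbd[OF fin] linear_sum
        using IH'(2) by (auto intro!: sum.cong arg_cong[where f = "frag_cmul _"])
      also have "\<dots> = frag_extend F (sbd s) - frag_extend G (sbd s) - frag_extend D (frag_extend sbd (sbd s))"
        unfolding frag_extend_frag_extend[of D] extend_sbd[OF fin]
        using fin by (simp add: frag_cmul_diff_distrib2 sum_subtractf frag_extend_sum frag_extend_cmul o_def)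
      finally have "bd ?z = 0"
        using F G True fin by (simp add: carried_map_def sbd_sbd)
      with z show ?thesis
        using acyclic[of s] True unfolding acyclic_lists_def P_def by blast
    qed
  qed
  then show ?thesis by (auto simp: P_def)
qed

text \<open>The alternating trace of a map from the oriented simplices of \<open>X\<close> to ordered chains,
  augmented by the empty simplex in degree \<open>-1\<close>.\<close>

definition aug_trace :: "'a set set \<Rightarrow> ('a set \<Rightarrow> 'a chain) \<Rightarrow> int" where
  "aug_trace X F = (\<Sum>t\<in>X. (- 1) ^ card t * Poly_Mapping.lookup (alt (F t)) t)"

lemma lookup_extend:
  assumes "finite X" "Poly_Mapping.keys c \<subseteq> X"
  shows "Poly_Mapping.lookup (frag_extend F c) t =
    (\<Sum>s\<in>X. Poly_Mapping.lookup c s * Poly_Mapping.lookup (F s) t)"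
proof -
  have "Poly_Mapping.lookup (frag_extend F c) t =
    (\<Sum>s\<in>Poly_Mapping.keys c. Poly_Mapping.lookup c s * Poly_Mapping.lookup (F s) t)"
    by (simp add: frag_extend_def lookup_sum)
  also have "\<dots> = (\<Sum>s\<in>X. Poly_Mapping.lookup c s * Poly_Mapping.lookup (F s) t)"
    by (rule sum.mono_neutral_left) (use assms in \<open>auto simp: in_keys_iff\<close>)
  finally show ?thesis .
qed

lemma alt_extend: "alt (frag_extend F c) = frag_extend (\<lambda>s. alt (F s)) c"
  unfolding alt_def by (rule frag_extend_frag_extend)

lemma keys_alt:
  assumes "c \<in> chain_group {us. set us \<in> X} n"
  shows "Poly_Mapping.keys (alt c) \<subseteq> X"
    and "s \<in> Poly_Mapping.keys (alt c) \<Longrightarrow> card s = n"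
proof -
  have "\<exists>us \<in> Poly_Mapping.keys c. s = set us \<and> list_sign us \<noteq> 0" if "s \<in> Poly_Mapping.keys (alt c)" for s
    using subsetD[OF keys_frag_extend that[unfolded alt_def]] by auto
  moreover have "card (set us) = length us" if "list_sign us \<noteq> 0" for us :: "'a list"
    using that list_sign_not_distinct distinct_card by blast
  ultimately show "Poly_Mapping.keys (alt c) \<subseteq> X" "s \<in> Poly_Mapping.keys (alt c) \<Longrightarrow> card s = n"
    using assms unfolding chain_group_def by fastforce+
qed

lemma lookup_sbd: "Poly_Mapping.lookup (sbd s) t \<noteq> 0 \<Longrightarrow> finite s \<Longrightarrow> card s = Suc (card t)"
  using subsetD[OF keys_sbd, of t s] card.remove[of s] by (auto simp: in_keys_iff[symmetric] simp del: card_Diff_insert)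

text \<open>The trace of \<open>D\<close> followed by a boundary equals that of a boundary followed
  by \<open>D\<close> in the neighbouring degree, so the two contributions cancel in the alternating
  sum.\<close>

theorem aug_trace_homotopic:
  assumes X: "abstract_complex X"
    and D: "\<And>s. s \<in> X \<Longrightarrow> D s \<in> chain_group {us. set us \<in> X} (Suc (card s))"
    and hom: "\<And>s. s \<in> X \<Longrightarrow> bd (D s) = F s - G s - frag_extend D (sbd s)"
  shows "aug_trace X F = aug_trace X G"
proof -
  define a where "a t s = Poly_Mapping.lookup (alt (D t)) s" for t s
  define b where "b s t = Poly_Mapping.lookup (sbd s) t" for s t :: "'a set"
  have X': "finite X" "finite s" "w \<subseteq> s \<Longrightarrow> w \<in> X" if "s \<in> X" for s w
    using X that by (auto simp: abstract_complex_def)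
  have fX: "finite X" using X by (simp add: abstract_complex_def)
  have eq: "Poly_Mapping.lookup (alt (F t)) t - Poly_Mapping.lookup (alt (G t)) t =
    (\<Sum>s\<in>X. a t s * b s t) + (\<Sum>s\<in>X. b t s * a s t)" if t: "t \<in> X" for t
  proof -
    have "alt (F t) - alt (G t) = alt (bd (D t)) + alt (frag_extend D (sbd t))"
      unfolding hom[OF t] by simp
    also have "\<dots> = frag_extend sbd (alt (D t)) + frag_extend (\<lambda>s. alt (D s)) (sbd t)"
      by (simp add: alt_bd alt_extend)
    finally have "Poly_Mapping.lookup (alt (F t) - alt (G t)) t =
      Poly_Mapping.lookup (frag_extend sbd (alt (D t)) + frag_extend (\<lambda>s. alt (D s)) (sbd t)) t"
      by simp
    moreover have "Poly_Mapping.keys (sbd t) \<subseteq> X"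
      using keys_sbd[of t] X'(3)[OF t] by blast
    ultimately show ?thesis
      using keys_alt(1)[OF D[OF t]] by (simp add: lookup_minus lookup_add lookup_extend[OF fX] a_def b_def)
  qed
  have "aug_trace X F - aug_trace X G =
    (\<Sum>t\<in>X. (- 1) ^ card t * ((\<Sum>s\<in>X. a t s * b s t) + (\<Sum>s\<in>X. b t s * a s t)))"
    unfolding aug_trace_def sum_subtractf[symmetric] by (rule sum.cong) (simp_all add: eq[symmetric] right_diff_distrib)
  also have "\<dots> = (\<Sum>t\<in>X. \<Sum>s\<in>X. (- 1) ^ card t * (a t s * b s t)) + (\<Sum>t\<in>X. \<Sum>s\<in>X. (- 1) ^ card t * (b t s * a s t))"
    by (simp add: distrib_left sum.distrib sum_distrib_left)
  also have "(\<Sum>t\<in>X. \<Sum>s\<in>X. (- 1) ^ card t * (b t s * a s t)) = (\<Sum>t\<in>X. \<Sum>s\<in>X. (- 1) ^ card s * (b s t * a t s))"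
    by (rule sum.swap)
  also have "\<dots> = (\<Sum>t\<in>X. \<Sum>s\<in>X. - ((- 1) ^ card t * (a t s * b s t)))"
  proof (intro sum.cong refl)
    fix t s assume "t \<in> X" "s \<in> X"
    show "(- 1) ^ card s * (b s t * a t s) = - ((- 1) ^ card t * (a t s * b s t))"
    proof (cases "b s t = 0")
      case False
      then have "card s = Suc (card t)" using lookup_sbd[of s t] X'(2)[OF \<open>s \<in> X\<close>] by (simp add: b_def)
      then show ?thesis by simp
    qed simp
  qed
  finally show ?thesis by (simp add: sum_negf)
qed

section \<open>Vertex maps on oriented simplices\<close>

fun pair_prod :: "('a \<Rightarrow> 'a \<Rightarrow> int) \<Rightarrow> 'a list \<Rightarrow> int" where
  "pair_prod h [] = 1"
| "pair_prod h (x # us) = (\<Prod>u\<leftarrow>us. h x u) * pair_prod h us"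

lemma pair_prod_move:
  assumes "\<And>x y. h x y = h y x"
  shows "pair_prod h (us @ x # vs) = pair_prod h (x # us @ vs)"
  by (induction us) (simp_all add: assms[of _ x] mult_ac)

lemma pair_prod_mset:
  assumes "\<And>x y. h x y = h y x" "mset us = mset vs"
  shows "pair_prod h us = pair_prod h vs"
  using assms(2)
proof (induction us arbitrary: vs)
  case (Cons x us)
  then have "x \<in> set vs" by (metis list.set_intros(1) mset_eq_setD)
  then obtain as bs where vs: "vs = as @ x # bs" by (meson split_list)
  then have m: "mset us = mset (as @ bs)" using Cons.prems by simp
  have "(\<Prod>u\<leftarrow>us. h x u) = (\<Prod>u\<leftarrow>as @ bs. h x u)"
    using m by (metis mset_map prod_mset_prod_list)
  then show ?case unfolding vs pair_prod_move[OF assms(1)] using Cons.IH[OF m] by simp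
qed simp

lemma prod_list_map_mult:
  fixes f g :: "'a \<Rightarrow> int"
  shows "prod_list (map (\<lambda>x. f x * g x) us) = prod_list (map f us) * prod_list (map g us)"
  by (induction us) (simp_all add: mult_ac)

lemma list_sign_map: "list_sign (map p us) * list_sign us = pair_prod (\<lambda>x y. ord_sign (p x) (p y) * ord_sign x y) us"
  by (induction us) (simp_all add: prod_list_map_mult o_def mult_ac)

text \<open>Each of the two signs depends on the order of the list, but their product is a product
  over pairs of a symmetric function, since both factors change sign when a pair is
  reversed.\<close>

lemma list_sign_map_permute:
  assumes "distinct us" "distinct vs" "set us = set vs"
  shows "list_sign (map p us) * list_sign us = list_sign (map p vs) * list_sign vs"
proof -
  have "mset us = mset vs" using assms by (simp add: set_eq_iff_mset_eq_distinct[symmetric])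
  then show ?thesis
    unfolding list_sign_map by (intro pair_prod_mset) (metis ord_sign_swap minus_mult_minus)
qed

lemma alt_push: "alt (push p (frag_of us)) =
  frag_cmul (list_sign us) (alt (push p (frag_of (sorted_list (set us)))))"
proof (cases "distinct us")
  case True
  let ?vs = "sorted_list (set us)"
  have vs: "set ?vs = set us" "distinct ?vs" "list_sign ?vs = 1"
    by (simp_all add: sorted_list list_sign_sorted)
  then have "list_sign (map p us) * list_sign us = list_sign (map p ?vs) * list_sign ?vs"
    using True by (intro list_sign_map_permute) simp_all
  then have "list_sign (map p us) * (list_sign us * list_sign us) = list_sign us * list_sign (map p ?vs)"
    using vs by (simp add: mult_ac)
  then show ?thesis using list_sign_sq[OF True] vs by simp
next
  case False
  then have "\<not> distinct (map p us)" using distinct_map by blast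
  with False show ?thesis by (simp add: list_sign_not_distinct)
qed

text \<open>Pushing along a vertex map descends to oriented chains, because lists that differ by a
  reordering have images that differ by the same sign, and lists with repetitions vanish on both
  sides.\<close>

lemma alt_push_sorted: "alt (push p c) = alt (push p (frag_extend (\<lambda>s. frag_of (sorted_list s)) (alt c)))"
proof (rule frag_ext[of UNIV "\<lambda>c. alt (push p c)"])
  fix us
  show "alt (push p (frag_of us)) = alt (push p (frag_extend (\<lambda>s. frag_of (sorted_list s)) (alt (frag_of us))))"
    unfolding alt_push[of p us] by (simp add: frag_extend_cmul)
qed (simp_all add: frag_extend_diff)

text \<open>Invariance of the trace under cyclic permutation, for \<open>A\<close> from
  \<open>X\<close> to \<open>Y\<close> and the vertex map \<open>p\<close> back. The signs agree
  because \<open>A\<close> preserves the degree.\<close>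

theorem aug_trace_cyclic:
  assumes X: "finite X" and Y: "finite Y" and p: "\<And>s. s \<in> Y \<Longrightarrow> finite s \<and> p ` s \<in> X"
    and A: "\<And>t. t \<in> X \<Longrightarrow> A t \<in> chain_group {us. set us \<in> Y} (card t)"
  shows "aug_trace X (\<lambda>t. push p (A t)) =
    aug_trace Y (\<lambda>s. frag_extend A (alt (push p (frag_of (sorted_list s)))))"
proof -
  define a where "a t s = Poly_Mapping.lookup (alt (A t)) s" for t s
  define q where "q s t = Poly_Mapping.lookup (alt (push p (frag_of (sorted_list s)))) t" for s t
  have l: "Poly_Mapping.lookup (alt (push p (A t))) t = (\<Sum>s\<in>Y. a t s * q s t)" if t: "t \<in> X" for t
  proof -
    have "alt (push p (A t)) = frag_extend (\<lambda>s. alt (push p (frag_of (sorted_list s)))) (alt (A t))"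
      unfolding alt_push_sorted[of p "A t"] by (simp only: alt_def push_def frag_extend_frag_extend)
    then show ?thesis using keys_alt(1)[OF A[OF t]] by (simp add: lookup_extend[OF Y] a_def q_def del: frag_of_list_simps)
  qed
  have r: "Poly_Mapping.lookup (alt (frag_extend A (alt (push p (frag_of (sorted_list s)))))) s =
    (\<Sum>t\<in>X. q s t * a t s)" if s: "s \<in> Y" for s
  proof -
    have "push p (frag_of (sorted_list s)) \<in> chain_group {us. set us \<in> X} (length (sorted_list s))"
      using p[OF s] sorted_list(1)[of s] by simp
    from keys_alt(1)[OF this] show ?thesis
      by (simp add: alt_extend lookup_extend[OF X] a_def q_def del: frag_of_list_simps)
  qed
  have "aug_trace X (\<lambda>t. push p (A t)) = (\<Sum>t\<in>X. \<Sum>s\<in>Y. (- 1) ^ card t * (a t s * q s t))"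
    by (simp add: aug_trace_def l sum_distrib_left)
  also have "\<dots> = (\<Sum>s\<in>Y. \<Sum>t\<in>X. (- 1) ^ card t * (a t s * q s t))"
    by (rule sum.swap)
  also have "\<dots> = (\<Sum>s\<in>Y. \<Sum>t\<in>X. (- 1) ^ card s * (q s t * a t s))"
  proof (intro sum.cong refl)
    fix s t assume "s \<in> Y" "t \<in> X"
    show "(- 1) ^ card t * (a t s * q s t) = (- 1) ^ card s * (q s t * a t s)"
    proof (cases "a t s = 0")
      case False
      then have "card s = card t"
        using keys_alt(2)[OF A[OF \<open>t \<in> X\<close>]] by (simp add: a_def in_keys_iff)
      then show ?thesis by simp
    qed simp
  qed
  also have "\<dots> = aug_trace Y (\<lambda>s. frag_extend A (alt (push p (frag_of (sorted_list s)))))"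
    by (simp add: aug_trace_def r sum_distrib_left del: frag_of_list_simps)
  finally show ?thesis .
qed

section \<open>Carried maps under composition\<close>

lemma push_extend: "push p (frag_extend D c) = frag_extend (\<lambda>s. push p (D s)) c"
  unfolding push_def by (rule frag_extend_frag_extend)

lemma prism_extend: "prism p q (frag_extend D c) = frag_extend (\<lambda>s. prism p q (D s)) c"
  unfolding prism_def by (rule frag_extend_frag_extend)

lemma frag_extend_fun_diff: "frag_extend (\<lambda>s. f s - g s) c = frag_extend f c - frag_extend g c"
  by (rule frag_ext[of UNIV "frag_extend (\<lambda>s. f s - g s)"]) (simp_all add: frag_extend_diff)

lemma carried_chains: "carried_map X \<Phi> F \<Longrightarrow> s \<in> X \<Longrightarrow> F s \<in> chain_group (\<Phi> s) (card s)"
  by (simp add: carried_map_def)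

lemma carried_push:
  assumes "carried_map X \<Phi> F" "\<And>s us. s \<in> X \<Longrightarrow> us \<in> \<Phi> s \<Longrightarrow> map p us \<in> \<Psi> s"
  shows "carried_map X \<Psi> (\<lambda>s. push p (F s))"
  using assms by (auto simp: carried_map_def bd_push push_extend intro!: chains_push)

lemma carried_mono:
  assumes "carried_map X \<Phi> F" "\<And>s. s \<in> X \<Longrightarrow> \<Phi> s \<subseteq> \<Psi> s"
  shows "carried_map X \<Psi> F"
  using assms chains_mono unfolding carried_map_def by blast

lemma sorted_list_empty [simp]: "sorted_list {} = []"
  using sorted_list(1)[of "{}"] by simp

lemma carried_sorted_list:
  "abstract_complex X \<Longrightarrow> carried_map X (\<lambda>s. {us. set us \<subseteq> s}) (\<lambda>s. frag_of (sorted_list s))"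
  using bd_sorted_list
  by (auto simp: carried_map_def abstract_complex_def sorted_list length_sorted_list)

text \<open>The composition passes through oriented chains by \<open>alt\<close>, because
  \<open>B\<close> is given on sets and not on lists.\<close>

lemma carried_comp:
  assumes Y: "abstract_complex Y" and A: "carried_map X \<Phi> A" and B: "carried_map Y \<Psi> B"
    and \<Phi>: "\<And>s us. s \<in> X \<Longrightarrow> us \<in> \<Phi> s \<Longrightarrow> set us \<in> Y \<and> \<Psi> (set us) \<subseteq> \<Omega> s"
  shows "carried_map X \<Omega> (\<lambda>s. frag_extend B (alt (A s)))"
  unfolding carried_map_def
proof (intro conjI ballI)
  show "frag_extend B (alt (A {})) = frag_of []" using A B by (simp add: carried_map_def)
  fix s assume s: "s \<in> X"
  have As: "A s \<in> chain_group {us. set us \<in> Y} (card s)"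
    using carried_chains[OF A s] chains_mono[of "\<Phi> s" "{us. set us \<in> Y}"] \<Phi>[OF s] by blast
  show "frag_extend B (alt (A s)) \<in> chain_group (\<Omega> s) (card s)"
  proof (rule chains_extend[OF order.refl])
    fix r assume r: "r \<in> Poly_Mapping.keys (alt (A s))"
    then obtain us where "us \<in> Poly_Mapping.keys (A s)" "r = set us"
      using subsetD[OF keys_frag_extend r[unfolded alt_def]] by (auto split: if_splits)
    then have "r \<in> Y" "\<Psi> r \<subseteq> \<Omega> s"
      using carried_chains[OF A s] \<Phi>[OF s] by (auto simp: chain_group_def)
    then show "B r \<in> chain_group (\<Omega> s) (card s)"
      using carried_chains[OF B, of r] keys_alt(2)[OF As r] chains_mono[of "\<Psi> r" "\<Omega> s" "card s"] by auto
  qed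
  have "bd (frag_extend B (alt (A s))) = frag_extend B (alt (bd (A s)))"
    using extend_carried[OF B keys_alt(1)[OF As]] by (simp add: alt_bd)
  also have "\<dots> = frag_extend (\<lambda>s. frag_extend B (alt (A s))) (sbd s)"
    using A s by (simp add: carried_map_def alt_extend frag_extend_frag_extend)
  finally show "bd (frag_extend B (alt (A s))) = frag_extend (\<lambda>s. frag_extend B (alt (A s))) (sbd s)" .
qed

text \<open>Combines a homotopy between \<open>F\<close> and \<open>G\<close> with the prism between
  two vertex maps that send every tuple of the carrier into a common simplex.\<close>

theorem aug_trace_contiguous:
  assumes X: "abstract_complex X"
    and mono: "\<And>w s. s \<in> X \<Longrightarrow> w \<subseteq> s \<Longrightarrow> \<Phi> w \<subseteq> \<Phi> s"
    and acyclic: "\<And>s. s \<in> X \<Longrightarrow> s \<noteq> {} \<Longrightarrow> acyclic_lists (\<Phi> s)"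
    and F: "carried_map X \<Phi> F" and G: "carried_map X \<Phi> G"
    and contiguous: "\<And>s us. s \<in> X \<Longrightarrow> us \<in> \<Phi> s \<Longrightarrow> p ` set us \<union> q ` set us \<in> X"
  shows "aug_trace X (\<lambda>s. push p (F s)) = aug_trace X (\<lambda>s. push q (G s))"
proof -
  obtain D where D: "\<And>s. s \<in> X \<Longrightarrow> D s \<in> chain_group (\<Phi> s) (Suc (card s))"
    "\<And>s. s \<in> X \<Longrightarrow> bd (D s) = F s - G s - frag_extend D (sbd s)"
    using carried_maps_homotopic[OF X mono acyclic F G] by blast
  have sub: "w \<in> X" if "w \<subseteq> s" "s \<in> X" for w s using that X by (auto simp: abstract_complex_def)
  \<comment> \<open>The first summand leads from \<open>push q\<close> of \<open>F\<close> to
    \<open>push q\<close> of \<open>G\<close>; the prism accounts for the change from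
    \<open>p\<close> to \<open>q\<close> on \<open>F\<close>.\<close>
  show ?thesis
  proof (rule aug_trace_homotopic[OF X, where D = "\<lambda>s. push q (D s) - prism p q (F s)"])
    fix s assume s: "s \<in> X"
    show "push q (D s) - prism p q (F s) \<in> chain_group {us. set us \<in> X} (Suc (card s))"
    proof (rule chains_diff)
      show "push q (D s) \<in> chain_group {us. set us \<in> X} (Suc (card s))"
        by (rule chains_push[OF D(1)[OF s]]) (auto intro: sub[OF _ contiguous[OF s]])
      show "prism p q (F s) \<in> chain_group {us. set us \<in> X} (Suc (card s))"
        by (rule prism_chains[OF carried_chains[OF F s]]) (auto intro: sub[OF _ contiguous[OF s]])
    qed
    have "frag_extend (\<lambda>s. push q (D s) - prism p q (F s)) (sbd s) =
      push q (frag_extend D (sbd s)) - prism p q (bd (F s))"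
      using F s by (simp add: push_extend prism_extend carried_map_def frag_extend_fun_diff)
    then show "bd (push q (D s) - prism p q (F s)) =
      push p (F s) - push q (G s) - frag_extend (\<lambda>s. push q (D s) - prism p q (F s)) (sbd s)"
      using D(2)[OF s] by (simp add: bd_push bd_prism)
  qed
qed

text \<open>A homotopy between the second factors \<open>F\<close> and \<open>G\<close>, composed
  with the chain map \<open>A\<close>, is a homotopy between the composites.\<close>

theorem aug_trace_comp_cong:
  assumes X: "abstract_complex X" and Y: "abstract_complex Y"
    and A: "carried_map X (\<lambda>_. {us. set us \<in> Y}) A"
    and mono: "\<And>w s. s \<in> Y \<Longrightarrow> w \<subseteq> s \<Longrightarrow> \<Phi> w \<subseteq> \<Phi> s"
    and acyclic: "\<And>s. s \<in> Y \<Longrightarrow> s \<noteq> {} \<Longrightarrow> acyclic_lists (\<Phi> s)"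
    and F: "carried_map Y \<Phi> F" and G: "carried_map Y \<Phi> G"
    and p: "\<And>s us. s \<in> Y \<Longrightarrow> us \<in> \<Phi> s \<Longrightarrow> p ` set us \<in> X"
  shows "aug_trace X (\<lambda>s. push p (frag_extend F (alt (A s)))) =
    aug_trace X (\<lambda>s. push p (frag_extend G (alt (A s))))"
proof -
  obtain D where D: "\<And>s. s \<in> Y \<Longrightarrow> D s \<in> chain_group (\<Phi> s) (Suc (card s))"
    "\<And>s. s \<in> Y \<Longrightarrow> bd (D s) = F s - G s - frag_extend D (sbd s)"
    using carried_maps_homotopic[OF Y mono acyclic F G] by blast
  have bdD: "bd (frag_extend D c) = frag_extend F c - frag_extend G c - frag_extend D (frag_extend sbd c)"
    if "Poly_Mapping.keys c \<subseteq> Y" for c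
    by (rule frag_ext[of Y "\<lambda>c. bd (frag_extend D c)"
          "\<lambda>c. frag_extend F c - frag_extend G c - frag_extend D (frag_extend sbd c)"])
      (use that in \<open>simp_all add: D(2) frag_extend_diff\<close>)
  show ?thesis
  proof (rule aug_trace_homotopic[OF X, where D = "\<lambda>s. push p (frag_extend D (alt (A s)))"])
    fix s assume s: "s \<in> X"
    note k = keys_alt[OF carried_chains[OF A s]]
    show "push p (frag_extend D (alt (A s))) \<in> chain_group {us. set us \<in> X} (Suc (card s))"
    proof (rule chains_push)
      show "frag_extend D (alt (A s)) \<in> chain_group (\<Union>r\<in>Y. \<Phi> r) (Suc (card s))"
      proof (rule chains_extend[OF order.refl])
        fix r assume "r \<in> Poly_Mapping.keys (alt (A s))"
        then show "D r \<in> chain_group (\<Union>r\<in>Y. \<Phi> r) (Suc (card s))"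
          using D(1)[of r] k chains_mono[of "\<Phi> r" "\<Union>r\<in>Y. \<Phi> r" "Suc (card s)"] by auto
      qed
    qed (use p in auto)
    have "frag_extend sbd (alt (A s)) = alt (frag_extend A (sbd s))"
      using A s by (simp add: carried_map_def alt_bd[symmetric])
    then show "bd (push p (frag_extend D (alt (A s)))) =
      push p (frag_extend F (alt (A s))) - push p (frag_extend G (alt (A s))) -
      frag_extend (\<lambda>s. push p (frag_extend D (alt (A s)))) (sbd s)"
      by (simp add: bd_push bdD[OF k(1)] push_extend[symmetric] alt_extend frag_extend_frag_extend[symmetric])
  qed
qed

section \<open>Small tuples in convex sets and signs of permutations\<close>

definition small_lists :: "real \<Rightarrow> 'a::metric_space set \<Rightarrow> 'a list set" where
  "small_lists \<delta> C = {us. set us \<subseteq> C \<and> (\<forall>x\<in>set us. \<forall>y\<in>set us. dist x y < \<delta>)}"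

lemma small_lists_mono: "C \<subseteq> C' \<Longrightarrow> small_lists \<delta> C \<subseteq> small_lists \<delta> C'"
  by (auto simp: small_lists_def)

text \<open>A cycle is contracted to a point of \<open>C\<close> in so many steps that the prisms between consecutive
  steps stay small. The strict inequality in \<^const>\<open>small_lists\<close> leaves the room for this.\<close>

theorem acyclic_small_lists:
  fixes C :: "'a::real_normed_vector set"
  assumes "convex C" "C \<noteq> {}" "\<delta> > 0"
  shows "acyclic_lists (small_lists \<delta> C)"
  unfolding acyclic_lists_def
proof (intro allI ballI impI)
  let ?\<Omega> = "small_lists \<delta> C"
  fix n z assume z: "z \<in> chain_group ?\<Omega> n" "bd z = 0"
  obtain c where c: "c \<in> C" using assms by blast
  define K where "K = Poly_Mapping.keys z"
  have K: "finite K" "K \<subseteq> ?\<Omega>" using z by (auto simp: K_def chain_group_def)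
  define F where "F = \<Union> (set ` K)"
  have F: "finite F" "F \<subseteq> C" using K by (auto simp: F_def small_lists_def)
  obtain \<delta>' where \<delta>': "\<delta>' < \<delta>" "0 \<le> \<delta>'" "\<And>us x y. us \<in> K \<Longrightarrow> x \<in> set us \<Longrightarrow> y \<in> set us \<Longrightarrow> dist x y \<le> \<delta>'"
  proof
    let ?D = "insert 0 (\<Union>us\<in>K. \<Union>x\<in>set us. dist x ` set us)"
    have fin: "finite ?D" using K by auto
    show "Max ?D < \<delta>" using fin K assms(3) by (subst Max_less_iff) (auto simp: small_lists_def)
    show "0 \<le> Max ?D" using fin by (intro Max_ge) auto
    show "dist x y \<le> Max ?D" if "us \<in> K" "x \<in> set us" "y \<in> set us" for us x y
      using fin that by (intro Max_ge) auto
  qed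
  obtain R where R: "\<And>x. x \<in> F \<Longrightarrow> dist x c \<le> R"
    using F(1) that[of "Max ((\<lambda>x. dist x c) ` F)"] by simp
  \<comment> \<open>With \<open>N\<close> steps each point moves by at most |R| / N < \<delta> -
    \<delta>' per step, so tuples mixing two consecutive steps keep their diameter below \<delta>' +
    (\<delta> - \<delta>'). The absolute value covers an empty \<open>F\<close>, where nothing is
    known about \<open>R\<close>, and forces \<open>N > 0\<close>.\<close>
  obtain N :: nat where N: "\<bar>R\<bar> < real N * (\<delta> - \<delta>')"
    using reals_Archimedean3[of "\<delta> - \<delta>'"] \<delta>'(1) by force
  then have "N > 0" by (cases N) auto
  define h where "h i x = x + (real i / N) *\<^sub>R (c - x)" for i x
  have hC: "h i x \<in> C" if "i \<le> N" "x \<in> C" for i x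
  proof -
    have "h i x = (1 - real i / N) *\<^sub>R x + (real i / N) *\<^sub>R c" by (simp add: h_def algebra_simps)
    then show ?thesis using assms(1) that c \<open>N > 0\<close> by (auto intro!: convexD simp: divide_le_eq_1)
  qed
  have h1: "dist (h i x) (h i y) \<le> dist x y" if "i \<le> N" for i x y
  proof -
    have "h i x - h i y = (1 - real i / N) *\<^sub>R (x - y)" by (simp add: h_def algebra_simps)
    then have "dist (h i x) (h i y) = (1 - real i / N) * dist x y"
      using that \<open>N > 0\<close> by (simp add: dist_norm divide_le_eq_1)
    then show ?thesis using mult_right_mono[of "1 - real i / N" 1 "dist x y"] by simp
  qed
  have h2: "dist (h i x) (h (Suc i) x) < \<delta> - \<delta>'" if "x \<in> F" for i x
  proof -
    have "h i x - h (Suc i) x = (real i / N - real (Suc i) / N) *\<^sub>R (c - x)"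
      unfolding h_def scaleR_left_diff_distrib by simp
    also have "real i / N - real (Suc i) / N = - (1 / N)" by (simp add: diff_divide_distrib[symmetric])
    finally have "h i x - h (Suc i) x = (1 / N) *\<^sub>R (x - c)" by (simp add: scaleR_right_diff_distrib)
    then have "dist (h i x) (h (Suc i) x) = dist x c / N" by (simp add: dist_norm)
    also have "\<dots> \<le> \<bar>R\<bar> / N" using R[OF that] by (intro divide_right_mono) auto
    also have "\<dots> < \<delta> - \<delta>'" using N \<open>N > 0\<close> by (simp add: field_simps)
    finally show ?thesis .
  qed
  have prism: "prism (h i) (h (Suc i)) z \<in> chain_group ?\<Omega> (Suc n)" if i: "Suc i \<le> N" for i
  proof (rule prism_chains)
    show "z \<in> chain_group K n" using z by (auto simp: chain_group_def K_def)
    fix us vs assume us: "us \<in> K" and vs: "set vs \<subseteq> h i ` set us \<union> h (Suc i) ` set us"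
    have usF: "set us \<subseteq> F" using us by (auto simp: F_def)
    have d: "dist (h j x) (h k y) < \<delta>" if "x \<in> set us" "y \<in> set us" "j \<in> {i, Suc i}" "k \<in> {i, Suc i}" for j k x y
    proof -
      have "dist (h j x) (h j y) \<le> \<delta>'" using h1[of j x y] \<delta>'(3)[OF us that(1,2)] that(3) i by auto
      moreover have "dist (h j y) (h k y) < \<delta> - \<delta>'"
        using h2[of y i] that usF \<delta>'(1) by (auto simp: dist_commute)
      ultimately show ?thesis using dist_triangle[of "h j x" "h k y" "h j y"] by simp
    qed
    show "vs \<in> ?\<Omega>"
      unfolding small_lists_def
    proof (intro CollectI conjI ballI)
      have "h k ` set us \<subseteq> C" if "k \<le> N" for k using hC[OF that] usF F(2) by blast
      from this[of i] this[of "Suc i"] show "set vs \<subseteq> C"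
        using i by (intro order.trans[OF vs] Un_least) simp_all
      fix x y assume "x \<in> set vs" "y \<in> set vs"
      moreover have "\<exists>j\<in>{i, Suc i}. \<exists>x'\<in>set us. x = h j x'" if "x \<in> set vs" for x
        using subsetD[OF vs that] by auto
      ultimately obtain j k x' y' where "x = h j x'" "y = h k y'" "x' \<in> set us" "y' \<in> set us"
        "j \<in> {i, Suc i}" "k \<in> {i, Suc i}"
        by metis
      then show "dist x y < \<delta>" using d[of x' y' j k] by simp
    qed
  qed
  have "\<exists>y\<in>chain_group ?\<Omega> (Suc n). bd y = z - push (h i) z" if "i \<le> N" for i
    using that
  proof (induction i)
    case 0
    have "h 0 = (\<lambda>x. x)" by (auto simp: h_def)
    moreover have "push (\<lambda>x. x) z = z" unfolding push_def by (simp add: frag_expansion[symmetric])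
    ultimately show ?case by (intro bexI[of _ 0]) simp_all
  next
    case (Suc i)
    then obtain y where "y \<in> chain_group ?\<Omega> (Suc n)" "bd y = z - push (h i) z" by auto
    then show ?case using prism[OF Suc.prems] z(2)
      by (intro bexI[of _ "y - prism (h i) (h (Suc i)) z"]) (simp_all add: bd_prism chains_diff)
  qed
  then obtain y where y: "y \<in> chain_group ?\<Omega> (Suc n)" "bd y = z - push (h N) z" by blast
  have hN: "h N x = c" for x using \<open>N > 0\<close> by (simp add: h_def)
  \<comment> \<open>At the end all points equal \<open>c\<close>, but constant lists need not vanish
    as ordered chains, so this cycle still has to be filled, by a cone.\<close>
  have "push (h N) z \<in> chain_group {us. set us \<subseteq> {c}} n"
    by (rule chains_push[OF z(1)]) (auto simp: hN)
  moreover have "bd (push (h N) z) = 0" using z by (simp add: bd_push)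
  ultimately obtain y' where y': "y' \<in> chain_group {us. set us \<subseteq> {c}} (Suc n)" "bd y' = push (h N) z"
    using acyclic_lists_all[of c "{c}"] unfolding acyclic_lists_def by blast
  have "{us. set us \<subseteq> {c}} \<subseteq> ?\<Omega>" using c assms(3) by (auto simp: small_lists_def subset_singleton_iff)
  then have "y + y' \<in> chain_group ?\<Omega> (Suc n)" using y' y chains_mono by (blast intro: chains_add)
  then show "\<exists>y\<in>chain_group ?\<Omega> (Suc n). bd y = z" using y y' by (intro bexI[of _ "y + y'"]) auto
qed

section \<open>Agreement with the signs of permutations\<close>

lemma list_sign_append:
  "list_sign (us @ vs) = list_sign us * list_sign vs * (\<Prod>u\<leftarrow>us. \<Prod>v\<leftarrow>vs. ord_sign u v)"
  by (induction us) (simp_all add: mult_ac)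

lemma prod_list_uminus:
  fixes f :: "'a \<Rightarrow> int"
  shows "(\<Prod>u\<leftarrow>us. - f u) = (- 1) ^ length us * (\<Prod>u\<leftarrow>us. f u)"
  by (induction us) simp_all

text \<open>Exchanging \<open>x\<close> and \<open>y\<close> reverses two pairs for each element of
  \<open>vs\<close>, and in addition the pair \<open>x\<close>, \<open>y\<close> itself.\<close>

lemma list_sign_swap: "list_sign (us @ x # vs @ y # ws) = - list_sign (us @ y # vs @ x # ws)"
proof -
  have "(\<Prod>v\<leftarrow>vs. ord_sign v z) = (- 1) ^ length vs * (\<Prod>v\<leftarrow>vs. ord_sign z v)" for z
    unfolding prod_list_uminus[symmetric] by (rule arg_cong[where f = prod_list]) (auto simp: ord_sign_swap[of _ z])
  then show ?thesis
    by (simp add: list_sign_append prod_list_map_mult ord_sign_swap[of y x] mult_ac)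
qed

lemma list_sign_transpose:
  assumes "i < length us" "j < length us" "i \<noteq> j"
  shows "list_sign (us[i := us ! j, j := us ! i]) = - list_sign us"
proof -
  have *: "list_sign (us[i := us ! j, j := us ! i]) = - list_sign us" if "i < j" "j < length us" for i j
  proof -
    define as where "as = take i us"
    define bs where "bs = take (j - Suc i) (drop (Suc i) us)"
    define cs where "cs = drop (Suc j) us"
    have "us = as @ us ! i # drop (Suc i) us"
      unfolding as_def using that by (intro id_take_nth_drop) simp
    moreover have "drop (Suc i) us = bs @ us ! j # cs"
      using id_take_nth_drop[of "j - Suc i" "drop (Suc i) us"] that by (simp add: bs_def cs_def)
    ultimately have 1: "us = as @ us ! i # bs @ us ! j # cs" by simp
    have l: "i = length as" "j = length as + Suc (length bs)" using that by (auto simp: as_def bs_def)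
    have "(as @ x # bs @ y # cs)[i := v, j := w] = as @ v # bs @ w # cs" for x y v w
      unfolding l by (simp add: list_update_append)
    then have "us[i := us ! j, j := us ! i] = as @ us ! j # bs @ us ! i # cs" using 1 by metis
    then show ?thesis using 1 list_sign_swap by metis
  qed
  show ?thesis
  proof (cases "i < j")
    case False
    then have "us[i := us ! j, j := us ! i] = us[j := us ! i, i := us ! j]"
      using assms by (simp add: list_update_swap)
    then show ?thesis using *[of j i] False assms by simp
  qed (use * assms in blast)
qed

lemma list_sign_permute:
  assumes "\<pi> permutes {..<length us}"
  shows "list_sign (permute_list \<pi> us) = sign \<pi> * list_sign us"
  using finite_lessThan[of "length us"] assms
proof (induction rule: permutes_rev_induct)
  case id
  then show ?case by simp
next
  case (swap a b p)
  let ?vs = "permute_list p us"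
  have "permute_list (p \<circ> Transposition.transpose a b) us = ?vs[a := ?vs ! b, b := ?vs ! a]"
    using swap by (intro nth_equalityI) (auto simp: permute_list_def Transposition.transpose_def nth_list_update)
  moreover have "list_sign (?vs[a := ?vs ! b, b := ?vs ! a]) = - list_sign ?vs"
    using swap by (intro list_sign_transpose) auto
  moreover have "sign (p \<circ> Transposition.transpose a b) = - sign p"
    using swap permutes_imp_permutation[of "{..<length us}" p]
    by (simp add: sign_compose sign_swap_id permutation_swap_id)
  ultimately show ?case using swap by (simp add: o_def)
qed

text \<open>Replaces the definite description by signs that multiply. The permutation is unique
  because \<open>vs\<close> is distinct, and \<open>list_sign vs\<close> is its own inverse; a list
  \<open>us\<close> with repetitions has sign zero.\<close>

lemma oriented_coeff_list_sign:
  assumes "distinct vs"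
  shows "oriented_coeff vs us = (if set us = set vs then of_int (list_sign vs * list_sign us) else 0)"
proof (cases "distinct us \<and> set us = set vs")
  case True
  then have "mset us = mset vs" using assms by (simp add: set_eq_iff_mset_eq_distinct[symmetric])
  then obtain \<pi> where \<pi>: "\<pi> permutes {..<length vs}" "permute_list \<pi> vs = us"
    by (rule mset_eq_permutation)
  have unique: "\<sigma> = \<pi>" if "\<sigma> permutes {..<length vs}" "permute_list \<sigma> vs = us" for \<sigma>
  proof
    fix i
    show "\<sigma> i = \<pi> i"
    proof (cases "i < length vs")
      case i: True
      then have "vs ! \<sigma> i = vs ! \<pi> i" using that \<pi> by (metis permute_list_nth)
      moreover have "\<sigma> i < length vs" "\<pi> i < length vs"
        using i that \<pi> permutes_in_image[of _ "{..<length vs}" i] by auto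
      ultimately show ?thesis using assms by (simp add: nth_eq_iff_index_eq)
    next
      case False
      then show ?thesis using that(1) \<pi>(1) by (simp add: permutes_def)
    qed
  qed
  have "(THE \<pi>. \<pi> permutes {..<length vs} \<and> permute_list \<pi> vs = us) = \<pi>"
    by (intro the_equality conjI \<pi>) (simp add: unique)
  moreover have "sign \<pi> = list_sign vs * list_sign us"
  proof -
    have "list_sign vs * list_sign us = sign \<pi> * (list_sign vs * list_sign vs)"
      using list_sign_permute[OF \<pi>(1)] by (simp add: \<pi>(2))
    then show ?thesis using list_sign_sq[OF assms] by simp
  qed
  ultimately show ?thesis using True by (simp add: oriented_coeff_def)
next
  case False
  then show ?thesis by (auto simp: oriented_coeff_def list_sign_not_distinct)
qed

section \<open>The Lefschetz fixed point theorem for simplicial approximations\<close>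

text \<open>Simplices are stored as vertex sets, the empty set included, so that the combinatorial
  complex and its realisation share one object.\<close>

definition geom_complex :: "'a::euclidean_space set set \<Rightarrow> bool" where
  "geom_complex K \<longleftrightarrow> abstract_complex K \<and> (\<forall>s\<in>K. \<not> affine_dependent s) \<and>
     (\<forall>s\<in>K. \<forall>t\<in>K. convex hull s \<inter> convex hull t \<subseteq> convex hull (s \<inter> t))"

definition body :: "'a::euclidean_space set set \<Rightarrow> 'a set" where
  "body K = (\<Union>s\<in>K. convex hull s)"

text \<open>On the polyhedron of \<open>K\<close> this is the open star of the vertex \<open>v\<close>; off the polyhedron the
  condition is vacuous.\<close>

definition star :: "'a::euclidean_space set set \<Rightarrow> 'a \<Rightarrow> 'a set" where
  "star K v = {x. \<forall>s\<in>K. x \<in> convex hull s \<longrightarrow> v \<in> s}"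

definition subdivides :: "'a::euclidean_space set set \<Rightarrow> 'a set set \<Rightarrow> bool" where
  "subdivides M K \<longleftrightarrow> (\<forall>m\<in>M. \<exists>t\<in>K. m \<subseteq> convex hull t) \<and>
     (\<forall>t\<in>K. \<forall>x\<in>convex hull t. \<exists>m\<in>M. x \<in> convex hull m \<and> m \<subseteq> convex hull t)"

lemma subdividesD:
  assumes "subdivides M K"
  shows "m \<in> M \<Longrightarrow> \<exists>t\<in>K. m \<subseteq> convex hull t"
    and "t \<in> K \<Longrightarrow> x \<in> convex hull t \<Longrightarrow> \<exists>m\<in>M. x \<in> convex hull m \<and> m \<subseteq> convex hull t"
  using assms unfolding subdivides_def by simp_all

lemma geom_complexD:
  assumes "geom_complex K"
  shows "abstract_complex K" "finite K" "{} \<in> K" "s \<in> K \<Longrightarrow> finite s" "s \<in> K \<Longrightarrow> w \<subseteq> s \<Longrightarrow> w \<in> K"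
    "s \<in> K \<Longrightarrow> \<not> affine_dependent s"
    "s \<in> K \<Longrightarrow> t \<in> K \<Longrightarrow> x \<in> convex hull s \<Longrightarrow> x \<in> convex hull t \<Longrightarrow> x \<in> convex hull (s \<inter> t)"
proof -
  show "x \<in> convex hull (s \<inter> t)" if "s \<in> K" "t \<in> K" "x \<in> convex hull s" "x \<in> convex hull t"
    using assms that unfolding geom_complex_def by blast
qed (use assms in \<open>auto simp: geom_complex_def abstract_complex_def\<close>)

lemma compact_body: "geom_complex K \<Longrightarrow> compact (body K)"
  unfolding body_def
  by (intro compact_UN) (auto simp: geom_complexD finite_imp_compact_convex_hull)

lemma body_subdivides:
  assumes "subdivides M K" shows "body M = body K"
proof
  show "body M \<subseteq> body K"
  proof
    fix x assume "x \<in> body M"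
    then obtain m t where "m \<in> M" "x \<in> convex hull m" "t \<in> K" "m \<subseteq> convex hull t"
      using assms by (auto simp: body_def subdivides_def)
    then show "x \<in> body K" using hull_minimal[of m "convex hull t" convex] by (auto simp: body_def)
  qed
  show "body K \<subseteq> body M" using assms by (fastforce simp: body_def subdivides_def)
qed

text \<open>Take a simplex of least cardinality around \<open>x\<close>: its intersection with any
  other simplex around \<open>x\<close> is again a simplex around \<open>x\<close>, hence not
  smaller.\<close>

lemma carrier_simplex:
  assumes "geom_complex K" "x \<in> body K"
  obtains k where "k \<in> K" "x \<in> convex hull k" "\<And>l. l \<in> K \<Longrightarrow> x \<in> convex hull l \<Longrightarrow> k \<subseteq> l"
proof -
  obtain k where k: "k \<in> K" "x \<in> convex hull k"
    and min: "\<And>l. l \<in> K \<Longrightarrow> x \<in> convex hull l \<Longrightarrow> card k \<le> card l"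
    using assms(2) arg_min_nat_lemma[of "\<lambda>k. k \<in> K \<and> x \<in> convex hull k" _ card] unfolding body_def by blast
  have "k \<subseteq> l" if "l \<in> K" "x \<in> convex hull l" for l
  proof -
    have "card k \<le> card (k \<inter> l)"
      using geom_complexD(5)[OF assms(1) k(1), of "k \<inter> l"] geom_complexD(7)[OF assms(1) k(1) that(1) k(2) that(2)]
      by (intro min) auto
    then have "k \<inter> l = k" using geom_complexD(4)[OF assms(1) k(1)] by (intro card_seteq) auto
    then show ?thesis by blast
  qed
  with k show thesis using that by blast
qed

text \<open>Any simplex around \<open>x\<close> has all of \<open>W\<close> among its vertices. This
  is the means of showing that images of points span a simplex: exhibit a point common to their
  stars.\<close>

lemma star_subset:
  assumes "geom_complex K" "x \<in> body K" "\<And>v. v \<in> W \<Longrightarrow> x \<in> star K v"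
  shows "W \<in> K"
proof -
  obtain k where "k \<in> K" "x \<in> convex hull k" using assms(2) by (auto simp: body_def)
  moreover from this have "W \<subseteq> k" using assms(3) by (auto simp: star_def)
  ultimately show ?thesis using geom_complexD(5)[OF assms(1)] by blast
qed

text \<open>\<delta> is a Lebesgue number of the cover by open stars, and \<open>r\<close> selects a
  vertex whose star contains the \<delta>-ball around the point. So \<open>r\<close> behaves like a
  simplicial approximation of the identity that is defined at all points of the polyhedron.\<close>

lemma star_retraction:
  assumes K: "geom_complex K"
  obtains \<delta> r where "\<delta> > 0"
    "\<And>x y. x \<in> body K \<Longrightarrow> y \<in> body K \<Longrightarrow> dist x y < \<delta> \<Longrightarrow> y \<in> star K (r x)"
proof -
  \<comment> \<open>Open in the whole space, since only finitely many closed simplices are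
    removed.\<close>
  define U where "U v = - (\<Union>k\<in>{k \<in> K. v \<notin> k}. convex hull k)" for v
  have U: "x \<in> U v \<longleftrightarrow> x \<in> star K v" for x v
    unfolding U_def star_def by auto
  have op: "open (U v)" for v
    unfolding U_def using geom_complexD(2,4)[OF K]
    by (intro open_Compl closed_UN) (auto intro: compact_imp_closed finite_imp_compact_convex_hull)
  have cover: "body K \<subseteq> \<Union> (range U)"
  proof
    fix x assume "x \<in> body K"
    from carrier_simplex[OF K this] obtain k where
      k: "k \<in> K" "x \<in> convex hull k" "\<And>l. l \<in> K \<Longrightarrow> x \<in> convex hull l \<Longrightarrow> k \<subseteq> l" by blast
    then obtain v where "v \<in> k" by fastforce
    with k have "x \<in> U v" unfolding U star_def by blast
    then show "x \<in> \<Union> (range U)" by blast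
  qed
  obtain \<delta> where \<delta>: "\<delta> > 0" "\<And>x. x \<in> body K \<Longrightarrow> \<exists>G\<in>range U. ball x \<delta> \<subseteq> G"
  proof -
    have "open G" if "G \<in> range U" for G using op that by auto
    then have "\<exists>e>0. \<forall>x\<in>body K. \<exists>G\<in>range U. ball x e \<subseteq> G"
      by (rule Heine_Borel_lemma[OF compact_body[OF K] cover]) blast+
    then show thesis using that by blast
  qed
  define r where "r x = (SOME v. ball x \<delta> \<subseteq> U v)" for x
  have r: "ball x \<delta> \<subseteq> U (r x)" if "x \<in> body K" for x
  proof -
    from \<delta>(2)[OF that] have "\<exists>v. ball x \<delta> \<subseteq> U v" by auto
    then show ?thesis unfolding r_def by (rule someI_ex)
  qed
  have "y \<in> star K (r x)" if "x \<in> body K" "dist x y < \<delta>" for x y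
    using subsetD[OF r[OF that(1)], of y] that(2) U by simp
  with \<delta>(1) show thesis using that by blast
qed

lemma small_map_exists:
  assumes K: "geom_complex K" and "\<delta> > 0"
  obtains a where "carried_map K (\<lambda>k. small_lists \<delta> (convex hull k)) a"
proof -
  have "\<exists>a. carried_map K (\<lambda>k. small_lists \<delta> (convex hull k)) a"
  proof (rule carried_map_exists[OF geom_complexD(1)[OF K]])
    show "acyclic_lists (small_lists \<delta> (convex hull s))" if "s \<noteq> {}" for s :: "'a set"
      using that assms(2) by (intro acyclic_small_lists) auto
  qed (auto simp: small_lists_mono hull_mono, simp add: small_lists_def)
  then show thesis using that by blast
qed

text \<open>The first point of the tuple lies in the stars of all the images.\<close>

lemma retraction_small_list:
  assumes K: "geom_complex K"
    and r: "\<And>x y. x \<in> body K \<Longrightarrow> y \<in> body K \<Longrightarrow> dist x y < \<delta> \<Longrightarrow> y \<in> star K (r x)"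
    and us: "set us \<subseteq> body K" "\<And>x y. x \<in> set us \<Longrightarrow> y \<in> set us \<Longrightarrow> dist x y < \<delta>"
  shows "r ` set us \<in> K"
proof (cases us)
  case (Cons x xs)
  show ?thesis
    by (rule star_subset[OF K, of x]) (use Cons us r in auto)
qed (simp add: geom_complexD[OF K])

text \<open>Both complexes and a fine subdivision \<open>M\<close> of \<open>K\<close> are compared with the complex of small
  tuples of points, on which \<open>g\<close> acts pointwise: \<open>a\<close> fills simplices with small tuples, \<open>r\<close> moves
  points to vertices whose open star contains a whole neighbourhood. The trace is carried over to
  \<open>M\<close>, where every simplex is moved off itself.\<close>

theorem aug_trace_fixed_point_free:
  fixes K K' :: "'a::euclidean_space set set"
  assumes K: "geom_complex K" and K': "geom_complex K'" and KK': "subdivides K' K"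
    and g: "continuous_on (body K) g" "g ` body K \<subseteq> body K" and nofix: "\<And>x. x \<in> body K \<Longrightarrow> g x \<noteq> x"
    and \<phi>: "\<And>s. s \<in> K' \<Longrightarrow> \<phi> ` s \<in> K"
    and \<phi>_star: "\<And>x v. x \<in> body K \<Longrightarrow> x \<in> star K' v \<Longrightarrow> g x \<in> star K (\<phi> v)"
    and \<alpha>: "carried_map K (\<lambda>t. {us. set us \<in> K' \<and> set us \<subseteq> convex hull t}) \<alpha>"
    and fine: "\<And>e. e > 0 \<Longrightarrow> \<exists>M. geom_complex M \<and> subdivides M K \<and>
      (\<forall>m\<in>M. \<forall>x\<in>convex hull m. \<forall>y\<in>convex hull m. dist x y \<le> e)"
  shows "aug_trace K (\<lambda>t. push \<phi> (\<alpha> t)) = 1"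
proof -
  \<comment> \<open>A lower bound for the displacement of \<open>g\<close>, attained and hence
    positive by compactness.\<close>
  obtain \<epsilon> where \<epsilon>: "\<epsilon> > 0" "\<And>x. x \<in> body K \<Longrightarrow> dist (g x) x \<ge> \<epsilon>"
  proof (cases "body K = {}")
    case False
    have "continuous_on (body K) (\<lambda>x. dist (g x) x)" by (intro continuous_intros g)
    from continuous_attains_inf[OF compact_body[OF K] False this] obtain x0 where
      "x0 \<in> body K" "\<And>y. y \<in> body K \<Longrightarrow> dist (g x0) x0 \<le> dist (g y) y" by blast
    then show thesis using that[of "dist (g x0) x0"] nofix by auto
  qed (use that[of 1] in auto)
  \<comment> \<open>The mesh leaves room for two distances: from \<open>g x\<close> to
    \<open>rM (g x)\<close> and from there back to \<open>x\<close>, together at most two thirds of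
    \<epsilon>.\<close>
  obtain M where M: "geom_complex M" "subdivides M K"
    and diam: "\<And>m x y. m \<in> M \<Longrightarrow> x \<in> convex hull m \<Longrightarrow> y \<in> convex hull m \<Longrightarrow> dist x y \<le> \<epsilon> / 3"
    using fine[of "\<epsilon> / 3"] \<epsilon>(1) by auto
  have bM: "body M = body K" and bK': "body K' = body K"
    using body_subdivides M(2) KK' by blast+
  obtain \<delta>K rK where rK: "\<delta>K > 0"
    "\<And>x y. x \<in> body K \<Longrightarrow> y \<in> body K \<Longrightarrow> dist x y < \<delta>K \<Longrightarrow> y \<in> star K (rK x)"
    using star_retraction[OF K] by blast
  obtain \<delta>K' rK' where rK': "\<delta>K' > 0"
    "\<And>x y. x \<in> body K \<Longrightarrow> y \<in> body K \<Longrightarrow> dist x y < \<delta>K' \<Longrightarrow> y \<in> star K' (rK' x)"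
    using star_retraction[OF K'] unfolding bK' by blast
  obtain \<delta>M rM where rM: "\<delta>M > 0"
    "\<And>x y. x \<in> body K \<Longrightarrow> y \<in> body K \<Longrightarrow> dist x y < \<delta>M \<Longrightarrow> y \<in> star M (rM x)"
    using star_retraction[OF M(1)] unfolding bM by blast
  have "uniformly_continuous_on (body K) g"
    using compact_uniformly_continuous[OF g(1) compact_body[OF K]] .
  then obtain \<delta>1 where \<delta>1: "\<delta>1 > 0"
    "\<And>x y. x \<in> body K \<Longrightarrow> y \<in> body K \<Longrightarrow> dist x y < \<delta>1 \<Longrightarrow> dist (g x) (g y) < min \<delta>K \<delta>M"
    using rK(1) rM(1) unfolding uniformly_continuous_on_def by (metis dist_commute min_less_iff_conj)
  define \<delta> where "\<delta> = Min {\<delta>1, \<delta>K', \<delta>M}"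
  have \<delta>: "\<delta> > 0" "\<delta> \<le> \<delta>1" "\<delta> \<le> \<delta>K'" "\<delta> \<le> \<delta>M"
    using \<delta>1(1) rK'(1) rM(1) by (auto simp: \<delta>_def)
  define S where "S C = small_lists \<delta> (C :: 'a set)" for C
  have S_mono: "C \<subseteq> C' \<Longrightarrow> S C \<subseteq> S C'" for C C' unfolding S_def by (rule small_lists_mono)
  have hull_sub: "convex hull s \<subseteq> body K" if "s \<in> K" for s using that by (auto simp: body_def)
  have S_hull_mono: "S (convex hull w) \<subseteq> S (convex hull s)" if "w \<subseteq> s" for w s
    by (rule S_mono[OF hull_mono[OF that]])
  have acyclic: "acyclic_lists (S C)" if "convex C" "C \<noteq> {}" for C
    unfolding S_def using that \<delta>(1) by (rule acyclic_small_lists)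
  have acyclic_hull: "acyclic_lists (S (convex hull s))" if "s \<noteq> {}" for s
    using that by (intro acyclic) auto
  obtain aK where aK: "carried_map K (\<lambda>k. S (convex hull k)) aK"
    using small_map_exists[OF K \<delta>(1)] unfolding S_def by blast
  obtain aK' where aK': "carried_map K' (\<lambda>k. S (convex hull k)) aK'"
    using small_map_exists[OF K' \<delta>(1)] unfolding S_def by blast
  obtain aM where aM: "carried_map M (\<lambda>k. S (convex hull k)) aM"
    using small_map_exists[OF M(1) \<delta>(1)] unfolding S_def by blast

  have rK_in: "rK x \<in> t" if "t \<in> K" "x \<in> convex hull t" for x t
    using rK(2)[of x x] rK(1) that hull_sub by (auto simp: star_def)
  have rK'_in: "rK' x \<in> s" if "s \<in> K'" "x \<in> convex hull s" for x s
    using rK'(2)[of x x] rK'(1) that bK' by (auto simp: star_def body_def)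
  have rM_in: "rM x \<in> m" if "m \<in> M" "x \<in> convex hull m" for x m
    using rM(2)[of x x] rM(1) that bM by (auto simp: star_def body_def)
  have rM_hull: "rM x \<in> convex hull t" if "t \<in> K" "x \<in> convex hull t" for x t
    using subdividesD(2)[OF M(2) that] rM_in by blast
  \<comment> \<open>\<open>rK\<close> approximates the identity from \<open>M\<close> to
    \<open>K\<close>: some simplex of \<open>M\<close> around \<open>x\<close> lies inside the hull
    of \<open>t\<close>, and it has \<open>v\<close> as a vertex.\<close>
  have star_M: "x \<in> star K (rK v)" if x: "x \<in> star M v" "x \<in> body K" for x v
    unfolding star_def
  proof (intro CollectI ballI impI)
    fix t assume t: "t \<in> K" "x \<in> convex hull t"
    then obtain m where "m \<in> M" "x \<in> convex hull m" "m \<subseteq> convex hull t"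
      using subdividesD(2)[OF M(2) t] by blast
    then have "v \<in> convex hull t" using x by (auto simp: star_def)
    then show "rK v \<in> t" using rK_in t by blast
  qed
  have S_sub: "set us \<subseteq> C" if "us \<in> S C" for us C
    using that by (simp add: S_def small_lists_def)
  have S_dist: "dist x y < \<delta>" if "us \<in> S C" "x \<in> set us" "y \<in> set us" for us C x y
    using that by (simp add: S_def small_lists_def)
  have S_M: "rM ` set us \<in> M" if "us \<in> S C" "C \<subseteq> body K" for us C
  proof (rule retraction_small_list[OF M(1) rM(2)[folded bM]])
    show "set us \<subseteq> body M" using S_sub[OF that(1)] that(2) bM by simp
    show "dist x y < \<delta>M" if "x \<in> set us" "y \<in> set us" for x y
      using S_dist[OF \<open>us \<in> S C\<close> that] \<delta>(4) by simp
  qed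
  have S_g: "g x \<in> star K (rK (g u))" "g x \<in> star M (rM (g u))"
    if "us \<in> S C" "C \<subseteq> body K" "x \<in> set us" "u \<in> set us" for us C x u
  proof -
    have "x \<in> body K" "u \<in> body K" "dist u x < \<delta>1"
      using S_sub[OF that(1)] S_dist[OF that(1,4,3)] that(2-4) \<delta>(2) by auto
    then have "g x \<in> body K" "g u \<in> body K" "dist (g u) (g x) < min \<delta>K \<delta>M"
      using g(2) \<delta>1(2) by auto
    then show "g x \<in> star K (rK (g u))" "g x \<in> star M (rM (g u))" using rK(2) rM(2) by auto
  qed
  have g_M: "(rM \<circ> g) ` set us \<in> M" if "us \<in> S C" "C \<subseteq> body K" for us C
  proof (cases us)
    case (Cons x xs)
    have "x \<in> body K" using that Cons by (auto simp: S_def small_lists_def)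
    then show ?thesis
      using S_g(2)[OF that, of x] Cons g(2) bM by (intro star_subset[OF M(1), of "g x"]) auto
  qed (simp add: geom_complexD[OF M(1)])

  let ?G = "\<lambda>m. push (rM \<circ> g) (aM m)"
  let ?F = "\<lambda>t. push (rK \<circ> g) (aK t)"

  \<comment> \<open>The empty simplex contributes 1. Any other nonzero diagonal entry would make
    \<open>m\<close> the image of points of its own hull, contradicting the displacement.\<close>
  have trace_M: "aug_trace M ?G = 1"
  proof -
    have 0: "Poly_Mapping.lookup (alt (?G m)) m = 0" if m: "m \<in> M" "m \<noteq> {}" for m
    proof (rule ccontr)
      assume "Poly_Mapping.lookup (alt (?G m)) m \<noteq> 0"
      then have "m \<in> Poly_Mapping.keys (alt (?G m))" by (simp add: in_keys_iff)
      moreover have "?G m \<in> chain_group {us. set us \<in> {(rM \<circ> g) ` set vs |vs. vs \<in> S (convex hull m)}} (card m)"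
        by (rule chains_push[OF carried_chains[OF aM m(1)]]) auto
      ultimately have "m \<in> {(rM \<circ> g) ` set vs |vs. vs \<in> S (convex hull m)}"
        using keys_alt(1) by blast
      then obtain vs where vs: "m = (rM \<circ> g) ` set vs" "vs \<in> S (convex hull m)" by blast
      then obtain x where x: "x \<in> set vs" using m(2) by fastforce
      have xm: "x \<in> convex hull m" using x vs(2) by (auto simp: S_def small_lists_def)
      then have xK: "x \<in> body K" using m(1) bM by (auto simp: body_def)
      then have "g x \<in> body M" using g(2) bM by auto
      then obtain k where k: "k \<in> M" "g x \<in> convex hull k" by (auto simp: body_def)
      have "rM (g x) \<in> convex hull k" using rM_in[OF k] by (rule hull_inc)
      then have "dist (g x) (rM (g x)) \<le> \<epsilon> / 3" by (rule diam[OF k])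
      moreover have "rM (g x) \<in> convex hull m" using vs(1) x by (simp add: hull_inc)
      then have "dist (rM (g x)) x \<le> \<epsilon> / 3" using xm by (rule diam[OF m(1)])
      ultimately have "dist (g x) x \<le> \<epsilon> / 3 + \<epsilon> / 3"
        using dist_triangle[of "g x" x "rM (g x)"] by linarith
      then show False using \<epsilon>(2)[OF xK] \<epsilon>(1) by simp
    qed
    have "aug_trace M ?G = (\<Sum>m\<in>M. if m = {} then 1 else 0)"
      unfolding aug_trace_def
    proof (rule sum.cong)
      fix m assume "m \<in> M"
      show "(- 1) ^ card m * Poly_Mapping.lookup (alt (?G m)) m = (if m = {} then 1 else 0)"
      proof (cases "m = {}")
        case True
        then show ?thesis using aM by (simp add: carried_map_def)
      qed (simp add: 0 \<open>m \<in> M\<close>)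
    qed simp
    then show ?thesis using geom_complexD(2,3)[OF M(1)] by simp
  qed

  have \<alpha>1: "carried_map K (\<lambda>t. {us. set us \<in> M \<and> set us \<subseteq> convex hull t}) (\<lambda>t. push rM (aK t))"
  proof (rule carried_push[OF aK])
    fix t us assume t: "t \<in> K" and us: "us \<in> S (convex hull t)"
    have "rM ` set us \<in> M" by (rule S_M[OF us hull_sub[OF t]])
    moreover have "rM ` set us \<subseteq> convex hull t" using S_sub[OF us] rM_hull[OF t] by auto
    ultimately show "map rM us \<in> {us. set us \<in> M \<and> set us \<subseteq> convex hull t}" by simp
  qed
  \<comment> \<open>Small fillings of \<open>K\<close> obtained by way of \<open>M\<close>. The
    carrier is that of \<open>aK\<close>, so the two are interchangeable in the trace.\<close>
  define \<beta> where "\<beta> t = frag_extend aM (alt (push rM (aK t)))" for t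
  have \<beta>: "carried_map K (\<lambda>k. S (convex hull k)) \<beta>"
    unfolding \<beta>_def
    by (rule carried_comp[OF geom_complexD(1)[OF M(1)] \<alpha>1 aM]) (simp add: S_mono hull_minimal)
  have contig1: "(rK \<circ> (rM \<circ> g)) ` set us \<union> (rK \<circ> g) ` set us \<in> K" if "s \<in> K" "us \<in> S (convex hull s)" for s us
  proof (cases us)
    case (Cons x xs)
    have "x \<in> body K" using that Cons hull_sub by (auto simp: S_def small_lists_def)
    then have gx: "g x \<in> body K" using g(2) by auto
    show ?thesis
      using S_g[OF that(2) hull_sub[OF that(1)], of x] Cons star_M gx
      by (intro star_subset[OF K gx]) auto
  qed (simp add: geom_complexD[OF K])
  have "aug_trace K ?F = aug_trace K (\<lambda>t. push (rK \<circ> (rM \<circ> g)) (\<beta> t))"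
    by (rule aug_trace_contiguous[OF geom_complexD(1)[OF K] S_hull_mono acyclic_hull \<beta> aK contig1, symmetric])
  also have "\<dots> = aug_trace K (\<lambda>t. push rK (push (rM \<circ> g) (\<beta> t)))"
    by (simp add: push_push)
  \<comment> \<open>Cyclic permutation: the factor \<open>rK\<close> from \<open>M\<close> back to
    \<open>K\<close> is now applied before the others, and the trace is taken over
    \<open>M\<close>.\<close>
  also have "\<dots> = aug_trace M (\<lambda>m. frag_extend (\<lambda>t. push (rM \<circ> g) (\<beta> t)) (alt (push rK (frag_of (sorted_list m)))))"
  proof (rule aug_trace_cyclic)
    show "finite m \<and> rK ` m \<in> K" if m: "m \<in> M" for m
    proof -
      obtain t where "t \<in> K" "m \<subseteq> convex hull t" using subdividesD(1)[OF M(2) m] by blast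
      then have "rK ` m \<subseteq> t" using rK_in by blast
      then show ?thesis using \<open>t \<in> K\<close> geom_complexD(5)[OF K] geom_complexD(4)[OF M(1) m] by blast
    qed
    show "push (rM \<circ> g) (\<beta> t) \<in> chain_group {us. set us \<in> M} (card t)" if "t \<in> K" for t
      by (rule chains_push[OF carried_chains[OF \<beta> that]]) (use g_M hull_sub that in auto)
  qed (use geom_complexD[OF K] geom_complexD[OF M(1)] in auto)
  also have "\<dots> = aug_trace M (\<lambda>m. push (rM \<circ> g) (frag_extend \<beta> (alt (push rK (frag_of (sorted_list m))))))"
    by (simp add: push_extend)
  also have "\<dots> = aug_trace M ?G"
  proof -
    \<comment> \<open>\<open>rK\<close> may move vertices of \<open>m\<close> out of its hull, but
      not out of any simplex of \<open>K\<close> whose hull contains \<open>m\<close>. The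
      intersection of these hulls is a convex carrier for both chain maps on
      \<open>M\<close>.\<close>
    define C where "C m = (\<Inter>t\<in>{t \<in> K. m \<subseteq> convex hull t}. convex hull t)" for m
    have C_sub: "C m \<subseteq> body K" if m: "m \<in> M" for m
    proof -
      obtain t where "t \<in> K" "m \<subseteq> convex hull t" using subdividesD(1)[OF M(2) m] by blast
      then have "C m \<subseteq> convex hull t" unfolding C_def by (intro INT_lower) simp
      then show ?thesis using hull_sub[OF \<open>t \<in> K\<close>] by (rule order.trans)
    qed
    have "carried_map M (\<lambda>m. {us. set us \<in> K \<and> (\<forall>t\<in>K. m \<subseteq> convex hull t \<longrightarrow> set us \<subseteq> t)})
      (\<lambda>m. push rK (frag_of (sorted_list m)))"
    proof (rule carried_push[OF carried_sorted_list[OF geom_complexD(1)[OF M(1)]]])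
      fix m us assume m: "m \<in> M" and us: "us \<in> {us. set us \<subseteq> m}"
      obtain t where "t \<in> K" "m \<subseteq> convex hull t" using subdividesD(1)[OF M(2) m] by blast
      moreover have *: "set (map rK us) \<subseteq> t" if "t \<in> K" "m \<subseteq> convex hull t" for t
        using rK_in[OF that(1)] us that(2) by auto
      ultimately show "map rK us \<in> {us. set us \<in> K \<and> (\<forall>t\<in>K. m \<subseteq> convex hull t \<longrightarrow> set us \<subseteq> t)}"
        using geom_complexD(5)[OF K] by blast
    qed
    then have \<gamma>: "carried_map M (\<lambda>m. S (C m)) (\<lambda>m. frag_extend \<beta> (alt (push rK (frag_of (sorted_list m)))))"
    proof (rule carried_comp[OF geom_complexD(1)[OF K] _ \<beta>])
      fix m and us :: "'a list"
      assume us: "us \<in> {us. set us \<in> K \<and> (\<forall>t\<in>K. m \<subseteq> convex hull t \<longrightarrow> set us \<subseteq> t)}"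
      then have "convex hull (set us) \<subseteq> C m"
        unfolding C_def by (intro INT_greatest hull_mono) simp
      then show "set us \<in> K \<and> S (convex hull (set us)) \<subseteq> S (C m)"
        using us by (simp add: S_mono)
    qed
    have aM2: "carried_map M (\<lambda>m. S (C m)) aM"
    proof (rule carried_mono[OF aM])
      fix m
      have "convex hull m \<subseteq> C m" unfolding C_def by (intro INT_greatest hull_minimal) simp_all
      then show "S (convex hull m) \<subseteq> S (C m)" by (rule S_mono)
    qed
    show ?thesis
    proof (rule aug_trace_contiguous[OF geom_complexD(1)[OF M(1)] _ _ \<gamma> aM2])
      show "S (C w) \<subseteq> S (C m)" if "w \<subseteq> m" for w m
      proof (rule S_mono)
        show "C w \<subseteq> C m" unfolding C_def by (rule INT_anti_mono) (use that in auto)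
      qed
      show "acyclic_lists (S (C m))" if "m \<in> M" "m \<noteq> {}" for m
      proof (rule acyclic)
        show "convex (C m)" unfolding C_def by (intro convex_INT) auto
        show "C m \<noteq> {}" using that(2) unfolding C_def by auto
      qed
      show "(rM \<circ> g) ` set us \<union> (rM \<circ> g) ` set us \<in> M" if "m \<in> M" "us \<in> S (C m)" for m us
        using g_M[OF that(2) C_sub[OF that(1)]] by simp
    qed
  qed
  finally have trace_F: "aug_trace K ?F = 1" using trace_M by simp

  \<comment> \<open>The identity of \<open>K'\<close> and the detour through small tuples and
    \<open>rK'\<close> are both carried by the faces of each simplex. After this replacement
    \<open>\<phi> \<circ> rK'\<close> and \<open>rK \<circ> g\<close> are contiguous on small
    tuples, because \<phi> approximates \<open>g\<close>.\<close>
  let ?J = "\<lambda>s. frag_of (sorted_list s)"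
  have "aug_trace K (\<lambda>t. push \<phi> (\<alpha> t)) = aug_trace K (\<lambda>t. push \<phi> (frag_extend ?J (alt (\<alpha> t))))"
    unfolding aug_trace_def by (simp only: alt_push_sorted[of \<phi> "\<alpha> _"])
  also have "\<dots> = aug_trace K (\<lambda>t. push \<phi> (frag_extend (\<lambda>s. push rK' (aK' s)) (alt (\<alpha> t))))"
  proof (rule aug_trace_comp_cong[OF geom_complexD(1)[OF K] geom_complexD(1)[OF K'],
        where \<Phi> = "\<lambda>s. {us. set us \<subseteq> s}"])
    show "carried_map K (\<lambda>_. {us. set us \<in> K'}) \<alpha>" by (rule carried_mono[OF \<alpha>]) auto
    show "acyclic_lists {us. set us \<subseteq> s}" if s: "s \<noteq> {}" for s :: "'a set"
    proof -
      from s obtain x where "x \<in> s" by blast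
      then show ?thesis by (rule acyclic_lists_all)
    qed
    show "carried_map K' (\<lambda>s. {us. set us \<subseteq> s}) ?J" by (rule carried_sorted_list[OF geom_complexD(1)[OF K']])
    show "carried_map K' (\<lambda>s. {us. set us \<subseteq> s}) (\<lambda>s. push rK' (aK' s))"
    proof (rule carried_push[OF aK'])
      fix s us assume s: "s \<in> K'" and us: "us \<in> S (convex hull s)"
      show "map rK' us \<in> {us. set us \<subseteq> s}" using S_sub[OF us] rK'_in[OF s] by auto
    qed
    show "\<phi> ` set us \<in> K" if "s \<in> K'" "us \<in> {us. set us \<subseteq> s}" for s us
      using \<phi>[OF geom_complexD(5)[OF K' that(1), of "set us"]] that(2) by simp
  qed auto
  also have "\<dots> = aug_trace K (\<lambda>t. push (\<phi> \<circ> rK') (frag_extend aK' (alt (\<alpha> t))))"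
    by (simp only: push_extend[symmetric] push_push)
  also have "\<dots> = aug_trace K ?F"
  proof (rule aug_trace_contiguous[OF geom_complexD(1)[OF K] S_hull_mono acyclic_hull _ aK])
    show "carried_map K (\<lambda>k. S (convex hull k)) (\<lambda>t. frag_extend aK' (alt (\<alpha> t)))"
      by (rule carried_comp[OF geom_complexD(1)[OF K'] \<alpha> aK']) (simp add: S_mono hull_minimal)
    show "(\<phi> \<circ> rK') ` set us \<union> (rK \<circ> g) ` set us \<in> K" if "s \<in> K" "us \<in> S (convex hull s)" for s us
    proof (cases us)
      case (Cons x xs)
      have sub: "set us \<subseteq> body K" using S_sub[OF that(2)] hull_sub[OF that(1)] by (rule order.trans)
      then have x: "x \<in> body K" using Cons by simp
      then have gx: "g x \<in> body K" using g(2) by auto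
      have "g x \<in> star K (\<phi> (rK' u))" if "u \<in> set us" for u
      proof (rule \<phi>_star[OF x rK'(2)])
        show "dist u x < \<delta>K'" using S_dist[OF \<open>us \<in> S (convex hull s)\<close> that, of x] Cons \<delta>(3) by simp
      qed (use that sub x in auto)
      then show ?thesis
        using S_g(1)[OF that(2) hull_sub[OF that(1)], of x] Cons by (intro star_subset[OF K gx]) auto
    qed (simp add: geom_complexD[OF K])
  qed
  finally show ?thesis using trace_F by simp
qed

section \<open>Barycentric coordinates and oriented volumes\<close>

definition affine_fn :: "('a::real_vector \<Rightarrow> real) \<Rightarrow> bool" where
  "affine_fn f \<longleftrightarrow> linear (\<lambda>x. f x - f 0)"

lemma affine_fnI: "linear L \<Longrightarrow> affine_fn (\<lambda>x. L x + c)"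
  by (simp add: affine_fn_def linear_0)

lemma affine_fn_combination:
  assumes "affine_fn f" "sum c A = 1"
  shows "f (\<Sum>u\<in>A. c u *\<^sub>R u) = (\<Sum>u\<in>A. c u * f u)"
proof -
  interpret L: linear "\<lambda>x. f x - f 0" using assms(1) by (simp add: affine_fn_def)
  have "f (\<Sum>u\<in>A. c u *\<^sub>R u) - f 0 = (\<Sum>u\<in>A. c u * (f u - f 0))"
    by (simp add: L.sum L.scale)
  also have "\<dots> = (\<Sum>u\<in>A. c u * f u) - sum c A * f 0"
    by (simp add: right_diff_distrib sum_subtractf sum_distrib_right)
  finally show ?thesis using assms(2) by simp
qed

lemma affine_fn_sum:
  assumes "\<And>j. j \<in> J \<Longrightarrow> affine_fn (f j)"
  shows "affine_fn (\<lambda>x. \<Sum>j\<in>J. f j x * c j)"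
  unfolding affine_fn_def sum_subtractf[symmetric] left_diff_distrib[symmetric]
proof (intro linear_compose_sum ballI)
  fix j assume "j \<in> J"
  then have "linear (\<lambda>x. f j x - f j 0)" using assms by (simp add: affine_fn_def)
  moreover have "linear (\<lambda>y. y * c j)" by (intro linearI) (simp_all add: algebra_simps)
  ultimately show "linear (\<lambda>x. (f j x - f j 0) * c j)" using linear_compose by (fastforce simp: o_def)
qed

text \<open>Barycentric coordinates, extended affinely to the whole space so that affinity need not
  be relativised to the hull of \<open>t\<close>. On the affine hull of an independent
  \<open>t\<close> the values are the usual ones.\<close>

definition bary :: "'a::euclidean_space set \<Rightarrow> 'a \<Rightarrow> 'a \<Rightarrow> real" where
  "bary t v = (SOME f. affine_fn f \<and> (\<forall>u\<in>t. f u = (if u = v then 1 else 0)))"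

lemma bary:
  fixes t :: "'a::euclidean_space set"
  assumes "\<not> affine_dependent t"
  shows "affine_fn (bary t v)" "u \<in> t \<Longrightarrow> bary t v u = (if u = v then 1 else 0)"
proof -
  have "\<exists>f. affine_fn f \<and> (\<forall>u\<in>t. f u = (if u = v then 1 else 0))"
  proof (cases "t = {}")
    case True
    have "affine_fn (\<lambda>x :: 'a. 0)" by (simp add: affine_fn_def linear_zero)
    with True show ?thesis by blast
  next
    case False
    then obtain a where a: "a \<in> t" by blast
    define c where "c u = (if u = v then 1 else 0 :: real)" for u
    have "independent ((\<lambda>x. - a + x) ` (t - {a}))"
      using assms affine_dependent_iff_dependent2[OF a] by simp
    from linear_independent_extend[OF this, of "\<lambda>y. c (y + a) - c a"]
    obtain g where g: "linear g" "\<forall>y\<in>(\<lambda>x. - a + x) ` (t - {a}). g y = c (y + a) - c a" by blast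
    have "affine_fn (\<lambda>x. g x + (c a - g a))" by (rule affine_fnI[OF g(1)])
    moreover have "g u + (c a - g a) = c u" if "u \<in> t" for u
    proof (cases "u = a")
      case False
      then have "g (- a + u) = c u - c a" using g(2) that by auto
      then show ?thesis using linear_diff[OF g(1), of u a] by simp
    qed simp
    ultimately show ?thesis unfolding c_def by blast
  qed
  from someI_ex[OF this] show "affine_fn (bary t v)" "u \<in> t \<Longrightarrow> bary t v u = (if u = v then 1 else 0)"
    unfolding bary_def by simp_all
qed

lemma bary_combination:
  fixes t :: "'a::euclidean_space set"
  assumes "\<not> affine_dependent t" "sum c t = 1" "v \<in> t"
  shows "bary t v (\<Sum>u\<in>t. c u *\<^sub>R u) = c v"
proof -
  have "bary t v (\<Sum>u\<in>t. c u *\<^sub>R u) = (\<Sum>u\<in>t. if u = v then c u else 0)"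
    unfolding affine_fn_combination[OF bary(1)[OF assms(1)] assms(2)]
    by (rule sum.cong) (auto simp: bary(2)[OF assms(1)])
  then show ?thesis using assms aff_independent_finite[OF assms(1)] by simp
qed

lemma bary_affine_hull:
  fixes t :: "'a::euclidean_space set"
  assumes t: "\<not> affine_dependent t" and x: "x \<in> affine hull t"
  shows "(\<Sum>v\<in>t. bary t v x) = 1" "(\<Sum>v\<in>t. bary t v x *\<^sub>R v) = x"
proof -
  have "\<exists>c. sum c t = 1 \<and> (\<Sum>v\<in>t. c v *\<^sub>R v) = x"
    using x affine_hull_finite[OF aff_independent_finite[OF t]] by simp
  then obtain c where c: "sum c t = 1" "(\<Sum>v\<in>t. c v *\<^sub>R v) = x" by blast
  have "bary t v x = c v" if "v \<in> t" for v
    using bary_combination[OF t c(1) that] c(2) by simp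
  then show "(\<Sum>v\<in>t. bary t v x) = 1" "(\<Sum>v\<in>t. bary t v x *\<^sub>R v) = x"
    using c by simp_all
qed

lemma bary_convex_hull:
  fixes t :: "'a::euclidean_space set"
  assumes t: "\<not> affine_dependent t"
  shows "x \<in> convex hull t \<longleftrightarrow> x \<in> affine hull t \<and> (\<forall>v\<in>t. 0 \<le> bary t v x)"
proof (intro iffI conjI ballI)
  assume "x \<in> convex hull t"
  then have "\<exists>c. (\<forall>v\<in>t. 0 \<le> c v) \<and> sum c t = 1 \<and> (\<Sum>v\<in>t. c v *\<^sub>R v) = x"
    using convex_hull_finite[OF aff_independent_finite[OF t]] by simp
  then obtain c where c: "\<forall>v\<in>t. 0 \<le> c v" "sum c t = 1" "(\<Sum>v\<in>t. c v *\<^sub>R v) = x" by blast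
  show "0 \<le> bary t v x" if "v \<in> t" for v
    using bary_combination[OF t c(2) that] c(1,3) that by simp
  show "x \<in> affine hull t" by (rule subsetD[OF convex_hull_subset_affine_hull \<open>x \<in> convex hull t\<close>])
next
  assume *: "x \<in> affine hull t \<and> (\<forall>v\<in>t. 0 \<le> bary t v x)"
  then show "x \<in> convex hull t"
    using bary_affine_hull[OF t, of x]
    unfolding convex_hull_finite[OF aff_independent_finite[OF t]]
    by (intro CollectI exI[of _ "\<lambda>v. bary t v x"]) simp
qed

lemma bary_subset:
  fixes t :: "'a::euclidean_space set"
  assumes t: "\<not> affine_dependent t" and r: "r \<subseteq> t" and x: "x \<in> affine hull r" and v: "v \<in> t"
  shows "bary t v x = (if v \<in> r then bary r v x else 0)"
proof -
  have ri: "\<not> affine_dependent r" using t r affine_independent_subset by blast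
  define c where "c u = (if u \<in> r then bary r u x else 0)" for u
  have fin: "finite t" "t \<inter> r = r" using aff_independent_finite[OF t] r by auto
  have "sum c t = 1" "(\<Sum>u\<in>t. c u *\<^sub>R u) = x"
    using bary_affine_hull[OF ri x] fin unfolding c_def
    by (simp_all add: if_distrib[of "\<lambda>c. c *\<^sub>R _"] sum.inter_restrict[symmetric] cong: if_cong)
  then show ?thesis using bary_combination[OF t _ v, of c] by (simp add: c_def)
qed

section \<open>Determinants of barycentric coordinates\<close>

definition list_det :: "('a \<Rightarrow> 'b \<Rightarrow> real) \<Rightarrow> 'a list \<Rightarrow> 'b list \<Rightarrow> real" where
  "list_det f vs us = Determinant.det (Matrix.mat (length vs) (length vs) (\<lambda>(i, j). f (vs ! j) (us ! i)))"

lemma list_det_transpose: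
  assumes "length us = length vs"
  shows "list_det f vs us = list_det (\<lambda>x y. f y x) us vs"
proof -
  let ?A = "Matrix.mat (length vs) (length vs) (\<lambda>(i, j). f (vs ! j) (us ! i))"
  have "Determinant.det (transpose_mat ?A) = Determinant.det ?A" by (rule det_transpose[of _ "length vs"]) simp
  moreover have "transpose_mat ?A = Matrix.mat (length us) (length us) (\<lambda>(i, j). f (vs ! i) (us ! j))"
    by (rule eq_matI) (auto simp: assms)
  ultimately show ?thesis by (simp add: list_det_def)
qed

lemma list_det_permute:
  assumes "distinct us" "distinct us'" "set us = set us'" "length us = length vs"
  shows "list_sign us * list_det f vs us = list_sign us' * list_det f vs us'"
proof -
  have "mset us' = mset us" using assms by (simp add: set_eq_iff_mset_eq_distinct[symmetric])
  then obtain \<pi> where \<pi>: "\<pi> permutes {..<length us}" "permute_list \<pi> us = us'"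
    by (rule mset_eq_permutation)
  let ?n = "length vs"
  let ?A = "Matrix.mat ?n ?n (\<lambda>(i, j). f (vs ! j) (us ! i))"
  have p: "\<pi> permutes {0..<?n}" using \<pi>(1) assms(4) by (simp add: atLeast0LessThan)
  have lt: "\<pi> i < ?n" if "i < ?n" for i using permutes_in_image[OF p, of i] that by simp
  have "Matrix.mat ?n ?n (\<lambda>(i, j). ?A $$ (\<pi> i, j)) = Matrix.mat ?n ?n (\<lambda>(i, j). f (vs ! j) (us' ! i))"
    using \<pi> assms(4) lt by (intro eq_matI) (auto simp: permute_list_nth)
  then have "list_det f vs us' = of_int (sign \<pi>) * list_det f vs us"
    using det_permute_rows[OF _ p, of ?A] by (simp add: list_det_def)
  moreover have "list_sign us' = sign \<pi> * list_sign us" using list_sign_permute[OF \<pi>(1)] \<pi>(2) by simp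
  moreover have "sign \<pi> * sign \<pi> = 1" by (simp add: sign_def)
  then have "real_of_int (sign \<pi>) * real_of_int (sign \<pi>) = 1" by (metis of_int_1 of_int_mult)
  moreover have "real_of_int (sign \<pi>) * y * (real_of_int (sign \<pi>) * z) =
    real_of_int (sign \<pi>) * real_of_int (sign \<pi>) * (y * z)" for y z
    by (simp only: mult_ac)
  ultimately show ?thesis by (simp only: of_int_mult mult_1)
qed

text \<open>The oriented volume of the simplex \<open>us\<close> relative to that of \<open>vs\<close>.\<close>

definition bdet :: "'a::euclidean_space list \<Rightarrow> 'a list \<Rightarrow> real" where
  "bdet vs us = list_det (bary (set vs)) vs us"

lemma bdet_permute:
  assumes "distinct us" "distinct us'" "set us = set us'" "length us = length vs"
  shows "list_sign us * bdet vs us = list_sign us' * bdet vs us'"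
  unfolding bdet_def by (rule list_det_permute[OF assms])

text \<open>Only the order of the base changes, not its coordinate functions, so transposing reduces
  this to a permutation of rows.\<close>

lemma bdet_permute_base:
  assumes "distinct vs" "distinct vs'" "set vs = set vs'" "length us = length vs"
  shows "list_sign vs * bdet vs us = list_sign vs' * bdet vs' us"
proof -
  have "length vs' = length vs" using assms by (metis distinct_card)
  then show ?thesis
    using list_det_permute[of vs vs' us "\<lambda>x y. bary (set vs) y x"] assms
      list_det_transpose[of us vs "bary (set vs)"] list_det_transpose[of us vs' "bary (set vs)"]
    by (simp add: bdet_def)
qed

text \<open>In row 0 the index \<open>i - 1\<close> truncates to 0, which is harmless: the cofactor
  deletes that row. Hence the cofactors do not depend on the point \<open>x\<close> of
  \<open>bdet_Cons\<close>, and the determinant is affine in \<open>x\<close>.\<close>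

definition bcof :: "'a::euclidean_space list \<Rightarrow> 'a list \<Rightarrow> nat \<Rightarrow> real" where
  "bcof vs ws j = cofactor (Matrix.mat (length vs) (length vs) (\<lambda>(i, j). bary (set vs) (vs ! j) (ws ! (i - 1)))) 0 j"

lemma bdet_Cons:
  assumes "length vs = Suc (length ws)"
  shows "bdet vs (x # ws) = (\<Sum>j<length vs. bary (set vs) (vs ! j) x * bcof vs ws j)"
proof -
  let ?n = "length vs"
  let ?A = "Matrix.mat ?n ?n (\<lambda>(i, j). bary (set vs) (vs ! j) ((x # ws) ! i))"
  let ?B = "Matrix.mat ?n ?n (\<lambda>(i, j). bary (set vs) (vs ! j) (ws ! (i - 1)))"
  have "mat_delete ?A 0 j = mat_delete ?B 0 j" for j
    by (rule eq_matI) (auto simp: mat_delete_def)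
  then have c: "cofactor ?A 0 j = bcof vs ws j" for j
    by (simp add: bcof_def cofactor_def)
  have "Determinant.det ?A = (\<Sum>j<?n. ?A $$ (0, j) * cofactor ?A 0 j)"
    using assms by (intro laplace_expansion_row) auto
  also have "\<dots> = (\<Sum>j<?n. bary (set vs) (vs ! j) x * bcof vs ws j)"
    unfolding c using assms by (intro sum.cong) auto
  finally show ?thesis by (simp add: bdet_def list_det_def)
qed

lemma bdet_affine_fn:
  assumes "\<not> affine_dependent (set vs)" "length vs = Suc (length ws)"
  shows "affine_fn (\<lambda>x. bdet vs (x # ws))"
  unfolding bdet_Cons[OF assms(2)] by (rule affine_fn_sum) (rule bary(1)[OF assms(1)])

lemma bdet_mem:
  assumes "length vs = Suc (length ws)" "x \<in> set ws"
  shows "bdet vs (x # ws) = 0"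
proof -
  obtain k where k: "k < length ws" "ws ! k = x" using assms(2) by (metis in_set_conv_nth)
  show ?thesis
    unfolding bdet_def list_det_def
  proof (rule det_identical_rows[of _ _ 0 "Suc k"])
    show "Matrix.row (Matrix.mat (length vs) (length vs) (\<lambda>(i, j). bary (set vs) (vs ! j) ((x # ws) ! i))) 0 =
      Matrix.row (Matrix.mat (length vs) (length vs) (\<lambda>(i, j). bary (set vs) (vs ! j) ((x # ws) ! i))) (Suc k)"
      using k assms(1) by (intro eq_vecI) auto
  qed (use k assms in auto)
qed

text \<open>Expansion along the row of \<open>v\<close>, which is a unit vector. The remaining minor
  consists of coordinates in the facet, since those of points of its affine hull do not change when
  \<open>v\<close> is added.\<close>

lemma bdet_facet:
  assumes vs: "\<not> affine_dependent (set (v # vs))" "distinct (v # vs)"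
    and ws: "length ws = length vs" "set ws \<subseteq> affine hull (set vs)"
  shows "bdet (v # vs) (v # ws) = bdet vs ws"
proof -
  let ?V = "set (v # vs)"
  let ?A = "Matrix.mat (length (v # vs)) (length (v # vs)) (\<lambda>(i, j). bary ?V ((v # vs) ! j) (ws ! (i - 1)))"
  have "mat_delete ?A 0 0 = Matrix.mat (length vs) (length vs) (\<lambda>(i, j). bary (set vs) (vs ! j) (ws ! i))"
  proof (rule eq_matI)
    fix i j
    assume "i < dim_row (Matrix.mat (length vs) (length vs) (\<lambda>(i, j). bary (set vs) (vs ! j) (ws ! i)))"
      "j < dim_col (Matrix.mat (length vs) (length vs) (\<lambda>(i, j). bary (set vs) (vs ! j) (ws ! i)))"
    then have ij: "i < length vs" "j < length vs" by auto
    then have "ws ! i \<in> affine hull (set vs)" using ws by (metis nth_mem subsetD)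
    then have "bary ?V (vs ! j) (ws ! i) = bary (set vs) (vs ! j) (ws ! i)"
      using bary_subset[OF vs(1), of "set vs" "ws ! i" "vs ! j"] ij by auto
    then show "mat_delete ?A 0 0 $$ (i, j) =
      Matrix.mat (length vs) (length vs) (\<lambda>(i, j). bary (set vs) (vs ! j) (ws ! i)) $$ (i, j)"
      using ij by (simp add: mat_delete_def)
  qed (auto simp: mat_delete_def)
  then have c: "bcof (v # vs) ws 0 = bdet vs ws"
    by (simp add: bcof_def cofactor_def bdet_def list_det_def)
  have len: "length (v # vs) = Suc (length ws)" using ws by simp
  have "bdet (v # vs) (v # ws) = (\<Sum>j<length (v # vs). if j = 0 then bdet vs ws else 0)"
    unfolding bdet_Cons[OF len]
  proof (intro sum.cong)
    fix j assume "j \<in> {..<length (v # vs)}"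
    then show "bary ?V ((v # vs) ! j) v * bcof (v # vs) ws j = (if j = 0 then bdet vs ws else 0)"
      using bary(2)[OF vs(1), of v "(v # vs) ! j"] vs(2) c by (cases j) auto
  qed simp
  then show ?thesis by (simp del: sum.lessThan_Suc)
qed

text \<open>A kernel vector of the transposed matrix is an affine dependence of \<open>us\<close>:
  its entries sum to zero because barycentric coordinates sum to one, and the combination of the
  points vanishes coordinate by coordinate.\<close>

lemma bdet_nonzero:
  fixes vs :: "'a::euclidean_space list"
  assumes vs: "\<not> affine_dependent (set vs)" "distinct vs"
    and us: "\<not> affine_dependent (set us)" "distinct us" "length us = length vs" "set us \<subseteq> affine hull (set vs)"
  shows "bdet vs us \<noteq> 0"
proof
  let ?n = "length vs"
  let ?A = "Matrix.mat ?n ?n (\<lambda>(i, j). bary (set vs) (vs ! i) (us ! j))"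
  assume "bdet vs us = 0"
  then have "Determinant.det ?A = 0"
    using list_det_transpose[OF us(3), of "bary (set vs)"] us(3) by (simp add: bdet_def list_det_def)
  then obtain c where c: "c \<in> carrier_vec ?n" "c \<noteq> 0\<^sub>v ?n" "?A *\<^sub>v c = 0\<^sub>v ?n"
    using iffD1[OF det_0_iff_vec_prod_zero_field[of ?A ?n]] mat_carrier[of ?n ?n] by blast
  have eq: "(\<Sum>i<?n. bary (set vs) v (us ! i) * vec_index c i) = 0" if v: "v \<in> set vs" for v
  proof -
    obtain j where j: "j < ?n" "v = vs ! j" using v by (auto simp: in_set_conv_nth)
    have "vec_index (?A *\<^sub>v c) j = scalar_prod (Matrix.row ?A j) c"
      using j(1) by (intro index_mult_mat_vec) simp
    also have "\<dots> = (\<Sum>i\<in>{0..<?n}. vec_index (Matrix.row ?A j) i * vec_index c i)"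
      using c(1) by (simp only: scalar_prod_def carrier_vecD)
    also have "\<dots> = (\<Sum>i<?n. bary (set vs) v (us ! i) * vec_index c i)"
      using j(1) unfolding j(2) by (intro sum.cong) auto
    finally show ?thesis unfolding c(3) using j(1) by simp
  qed
  have u: "us ! i \<in> affine hull (set vs)" if "i < ?n" for i using us(3,4) that by (metis nth_mem subsetD)
  have "(\<Sum>i<?n. vec_index c i) = (\<Sum>i<?n. (\<Sum>v\<in>set vs. bary (set vs) v (us ! i)) * vec_index c i)"
    by (rule sum.cong) (simp_all add: bary_affine_hull(1)[OF vs(1) u])
  also have "\<dots> = (\<Sum>v\<in>set vs. \<Sum>i<?n. bary (set vs) v (us ! i) * vec_index c i)"
    unfolding sum_distrib_right by (rule sum.swap)
  finally have s0: "(\<Sum>i<?n. vec_index c i) = 0" by (simp add: eq)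
  have "(\<Sum>i<?n. vec_index c i *\<^sub>R us ! i) =
    (\<Sum>i<?n. vec_index c i *\<^sub>R (\<Sum>v\<in>set vs. bary (set vs) v (us ! i) *\<^sub>R v))"
    by (rule sum.cong) (simp_all add: bary_affine_hull(2)[OF vs(1) u])
  also have "\<dots> = (\<Sum>i<?n. \<Sum>v\<in>set vs. (bary (set vs) v (us ! i) * vec_index c i) *\<^sub>R v)"
    by (simp add: scaleR_sum_right mult.commute)
  also have "\<dots> = (\<Sum>v\<in>set vs. (\<Sum>i<?n. bary (set vs) v (us ! i) * vec_index c i) *\<^sub>R v)"
    unfolding scaleR_sum_left by (rule sum.swap)
  finally have s1: "(\<Sum>i<?n. vec_index c i *\<^sub>R us ! i) = 0" by (simp add: eq)
  have inj: "inj_on ((!) us) {..<?n}" using us(2,3) by (simp add: inj_on_nth)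
  have img: "(!) us ` {..<?n} = set us" using us(3) by (auto simp: set_conv_nth)
  \<comment> \<open>Coefficients indexed by points instead of positions, as affine dependence is
    stated for sets.\<close>
  define U where "U u = vec_index c (the_inv_into {..<?n} ((!) us) u)" for u
  have U: "U (us ! i) = vec_index c i" if "i < ?n" for i
    unfolding U_def using the_inv_into_f_f[OF inj, of i] that by simp
  have "sum U (set us) = 0" "(\<Sum>u\<in>set us. U u *\<^sub>R u) = 0"
    using s0 s1 unfolding img[symmetric] sum.reindex[OF inj] by (simp_all add: U)
  moreover obtain i where "i < ?n" "vec_index c i \<noteq> 0"
    using c(1,2) by (metis carrier_vecD eq_vecI index_zero_vec(1) index_zero_vec(2))
  then have "\<exists>u\<in>set us. U u \<noteq> 0" using U us(3) by (metis nth_mem)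
  ultimately show False
    using us(1) affine_dependent_explicit_finite[of "set us"] by blast
qed

section \<open>Simplices around a face of codimension one\<close>

definition isgn :: "real \<Rightarrow> int" where
  "isgn x = (if 0 < x then 1 else if x < 0 then - 1 else 0)"

lemma isgn_mult: "e * e = 1 \<Longrightarrow> isgn (real_of_int e * x) = e * isgn x"
proof -
  assume "e * e = 1"
  then have "e = 1 \<or> e = - 1" by (auto simp: zmult_eq_1_iff)
  then show ?thesis by (auto simp: isgn_def)
qed

lemma sum_isgn:
  fixes h :: "'a \<Rightarrow> real"
  assumes V: "finite V" "\<And>v. v \<in> V \<Longrightarrow> h v \<noteq> 0"
    and unique: "\<And>u v. u \<in> V \<Longrightarrow> v \<in> V \<Longrightarrow> h u * h v > 0 \<Longrightarrow> u = v"
    and a: "a \<in> V" "h a > 0" and b: "b \<in> V" "h b < 0"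
  shows "(\<Sum>v\<in>V. isgn (h v)) = 0"
proof -
  have "v = a \<or> v = b" if "v \<in> V" for v
    using unique[OF that a(1)] unique[OF that b(1)] V(2)[OF that] a(2) b(2)
    by (cases "h v > 0") (auto simp: zero_less_mult_iff)
  then have "V = {a, b}" using a(1) b(1) by blast
  moreover have "a \<noteq> b" using a b by auto
  ultimately show ?thesis using a(2) b(2) by (simp add: isgn_def)
qed

lemma affine_fn_line: "affine_fn f \<Longrightarrow> f (x + c *\<^sub>R (y - x)) = f x + c * (f y - f x)"
proof -
  assume "affine_fn f"
  then interpret L: linear "\<lambda>x. f x - f 0" by (simp add: affine_fn_def)
  show ?thesis using L.add[of x "c *\<^sub>R (y - x)"] L.scale[of c "y - x"] L.diff[of y x] by (simp add: algebra_simps)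
qed

lemma affine_fn_zero_hull:
  assumes "affine_fn f" "finite w" "\<And>u. u \<in> w \<Longrightarrow> f u = 0" "x \<in> affine hull w"
  shows "f x = 0"
proof -
  have "\<exists>c. sum c w = 1 \<and> (\<Sum>v\<in>w. c v *\<^sub>R v) = x"
    using assms(4) affine_hull_finite[OF assms(2)] by simp
  then obtain c where c: "sum c w = 1" "(\<Sum>v\<in>w. c v *\<^sub>R v) = x" by blast
  show ?thesis using affine_fn_combination[OF assms(1) c(1)] c(2) assms(3) by simp
qed

text \<open>In the locale below, \<open>ws\<close> spans a simplex of codimension one in the subdivided simplex \<open>vs\<close>,
  and the sign of the affine function \<open>h\<close> tells its two sides apart. The set \<open>W\<close> consists of the
  vertices opposite to \<open>ws\<close> in the top-dimensional simplices containing it.\<close>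

locale facet =
  fixes K :: "'a::euclidean_space set set" and vs ws :: "'a list"
  assumes K: "geom_complex K"
    and vs: "distinct vs" "\<not> affine_dependent (set vs)"
    and cover: "\<And>x. x \<in> convex hull (set vs) \<Longrightarrow> \<exists>m\<in>K. x \<in> convex hull m \<and> m \<subseteq> convex hull (set vs)"
    and ws: "distinct ws" "set ws \<in> K" "set ws \<subseteq> convex hull (set vs)" "length vs = Suc (length ws)" "ws \<noteq> []"
begin

definition h :: "'a \<Rightarrow> real" where "h x = bdet vs (x # ws)"

definition W :: "'a set" where
  "W = {v. v \<notin> set ws \<and> insert v (set ws) \<in> K \<and> insert v (set ws) \<subseteq> convex hull (set vs)}"

definition centre :: 'a where "centre = (\<Sum>u\<in>set ws. (1 / length ws) *\<^sub>R u)"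

lemma h_affine: "affine_fn h"
  unfolding h_def using vs(2) ws(4) by (rule bdet_affine_fn)

lemma ws_independent: "\<not> affine_dependent (set ws)"
  by (rule geom_complexD(6)[OF K ws(2)])

lemma hull_sub: "convex hull (set vs) \<subseteq> affine hull (set vs)"
  by (rule convex_hull_subset_affine_hull)

lemma h_zero: "x \<in> affine hull (set ws) \<Longrightarrow> h x = 0"
  using affine_fn_zero_hull[OF h_affine, of "set ws" x] bdet_mem[OF ws(4)] by (simp add: h_def)

lemma h_nonzero:
  assumes "v \<notin> set ws" "\<not> affine_dependent (insert v (set ws))" "v \<in> affine hull (set vs)"
  shows "h v \<noteq> 0"
  unfolding h_def
proof (rule bdet_nonzero[OF vs(2,1)])
  show "set (v # ws) \<subseteq> affine hull (set vs)" using assms(3) ws(3) hull_sub by auto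
qed (use assms ws in auto)

lemma W_nonzero: "v \<in> W \<Longrightarrow> h v \<noteq> 0"
  using geom_complexD(6)[OF K, of "insert v (set ws)"] hull_sub by (intro h_nonzero) (auto simp: W_def)

lemma finite_W: "finite W"
proof (rule finite_subset)
  show "W \<subseteq> \<Union> K" by (auto simp: W_def)
  show "finite (\<Union> K)" using geom_complexD(2,4)[OF K] by auto
qed

lemma sum_weights: "(\<Sum>u\<in>set ws. 1 / real (length ws)) = 1"
  using ws(1,5) by (simp add: distinct_card)

lemma centre_hull: "centre \<in> convex hull (set ws)"
  unfolding centre_def
  by (rule convex_sum) (use sum_weights in \<open>auto intro: hull_inc\<close>)

lemma bary_centre: "u \<in> set ws \<Longrightarrow> bary (set ws) u centre = 1 / length ws"
  unfolding centre_def by (rule bary_combination[OF ws_independent sum_weights])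

lemma h_centre: "h centre = 0"
  using centre_hull convex_hull_subset_affine_hull by (intro h_zero) blast

lemma h_line: "h (centre + c *\<^sub>R (y - centre)) = c * h y"
  using affine_fn_line[OF h_affine, of centre c y] h_centre by simp

text \<open>All barycentric coordinates of the centre are positive, so it lies in no proper face of
  \<open>ws\<close>.\<close>

lemma centre_simplex:
  assumes m: "m \<in> K" "centre \<in> convex hull m" shows "set ws \<subseteq> m"
proof
  fix u assume u: "u \<in> set ws"
  have "centre \<in> convex hull (set ws \<inter> m)"
    by (rule geom_complexD(7)[OF K ws(2) m(1) centre_hull m(2)])
  then have "centre \<in> affine hull (set ws \<inter> m)" by (rule subsetD[OF convex_hull_subset_affine_hull])
  from bary_subset[OF ws_independent _ this u] show "u \<in> m"
    using bary_centre[OF u] u ws(5) by (auto split: if_splits)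
qed

text \<open>Two such simplices on the same side would overlap: a point slightly away from the centre
  towards \<open>v\<close> has nonnegative coordinates in both, so it lies in the hull of their
  common part \<open>ws\<close>, where \<open>h\<close> vanishes.\<close>

lemma side_unique:
  assumes v: "v \<in> W" and v': "v' \<in> W" and same: "h v * h v' > 0"
  shows "v = v'"
proof (rule ccontr)
  assume ne: "v \<noteq> v'"
  let ?m = "insert v (set ws)" and ?m' = "insert v' (set ws)"
  have m: "?m \<in> K" "?m' \<in> K" "v \<notin> set ws" "v' \<notin> set ws" "?m' \<subseteq> convex hull (set vs)" "v \<in> convex hull (set vs)"
    using v v' by (auto simp: W_def)
  have i': "\<not> affine_dependent ?m'" by (rule geom_complexD(6)[OF K m(2)])
  have "affine hull ?m' = affine hull (set vs)"
  proof (rule affine_dim_equal)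
    show "affine hull ?m' \<subseteq> affine hull (set vs)"
      using m(5) hull_sub by (intro hull_minimal) auto
    have "int (card ?m') = int (card (set vs))" using m(4) ws(1,4) vs(1) by (simp add: distinct_card)
    then show "aff_dim (affine hull ?m') = aff_dim (affine hull (set vs))"
      using aff_dim_affine_independent[OF i'] aff_dim_affine_independent[OF vs(2)] by simp
  qed auto
  then have v_aff: "v \<in> affine hull ?m'" using m(6) hull_sub by blast
  have hv: "h v = bary ?m' v' v * h v'"
  proof -
    have "h v = (\<Sum>u\<in>?m'. bary ?m' u v * h u)"
      using affine_fn_combination[OF h_affine bary_affine_hull(1)[OF i' v_aff]] bary_affine_hull(2)[OF i' v_aff] by simp
    also have "\<dots> = bary ?m' v' v * h v'"
      using m(4) by (simp add: h_zero hull_inc)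
    finally show ?thesis .
  qed
  have pos: "bary ?m' v' v > 0"
  proof (rule ccontr)
    assume "\<not> bary ?m' v' v > 0"
    then have "bary ?m' v' v * (h v' * h v') \<le> 0" by (intro mult_nonpos_nonneg) auto
    then show False using same by (simp add: hv mult.assoc)
  qed
  let ?z = "\<lambda>\<epsilon>. centre + \<epsilon> *\<^sub>R (v - centre)"
  have c_aff: "centre \<in> affine hull ?m'"
    using subsetD[OF hull_mono[of "set ws" ?m' convex] centre_hull] subsetD[OF convex_hull_subset_affine_hull] by blast
  have c_ws: "centre \<in> affine hull (set ws)"
    by (rule subsetD[OF convex_hull_subset_affine_hull centre_hull])
  have bw: "bary ?m' u centre > 0" if "u \<in> set ws" for u
    using bary_subset[OF i' subset_insertI c_ws, of u] that bary_centre[OF that] ws(5) by simp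
  have bv: "bary ?m' v' centre = 0"
    using bary_subset[OF i' subset_insertI c_ws, of v'] m(4) by simp
  have "eventually (\<lambda>\<epsilon>. \<forall>u\<in>?m'. bary ?m' u (?z \<epsilon>) \<ge> 0) (at_right 0)"
  proof (rule eventually_ball_finite)
    show "\<forall>u\<in>?m'. eventually (\<lambda>\<epsilon>. bary ?m' u (?z \<epsilon>) \<ge> 0) (at_right 0)"
    proof
      fix u assume u: "u \<in> ?m'"
      have l: "bary ?m' u (?z \<epsilon>) = bary ?m' u centre + \<epsilon> * (bary ?m' u v - bary ?m' u centre)" for \<epsilon>
        by (rule affine_fn_line[OF bary(1)[OF i']])
      show "eventually (\<lambda>\<epsilon>. bary ?m' u (?z \<epsilon>) \<ge> 0) (at_right 0)"
      proof (cases "u = v'")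
        case True
        show ?thesis
          using eventually_at_right_less[of 0]
        proof eventually_elim
          fix \<epsilon> :: real assume "0 < \<epsilon>"
          then show "bary ?m' u (?z \<epsilon>) \<ge> 0" using pos bv unfolding l by (simp add: True)
        qed
      next
        case False
        then have "u \<in> set ws" using u by simp
        have "((\<lambda>\<epsilon>. bary ?m' u (?z \<epsilon>)) \<longlongrightarrow> bary ?m' u centre + 0 * (bary ?m' u v - bary ?m' u centre)) (at_right 0)"
          unfolding l by (intro tendsto_intros)
        from order_tendstoD(1)[OF this, of 0] bw[OF \<open>u \<in> set ws\<close>]
        have "eventually (\<lambda>\<epsilon>. 0 < bary ?m' u (?z \<epsilon>)) (at_right 0)" by simp
        then show ?thesis by eventually_elim simp
      qed
    qed
  qed simp
  moreover have "eventually (\<lambda>\<epsilon>::real. \<epsilon> < 1) (at_right 0)"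
    by (rule order_tendstoD(2)[OF tendsto_ident_at]) simp
  moreover note eventually_at_right_less[of "0::real"]
  ultimately have "eventually (\<lambda>\<epsilon>. (\<forall>u\<in>?m'. bary ?m' u (?z \<epsilon>) \<ge> 0) \<and> \<epsilon> < 1 \<and> 0 < \<epsilon>) (at_right 0)"
    by eventually_elim simp
  then obtain \<epsilon> where \<epsilon>: "\<forall>u\<in>?m'. bary ?m' u (?z \<epsilon>) \<ge> 0" "\<epsilon> < 1" "0 < \<epsilon>"
    using eventually_happens'[OF trivial_limit_at_right_real] by blast
  have z: "?z \<epsilon> = (1 - \<epsilon>) *\<^sub>R centre + \<epsilon> *\<^sub>R v" by (simp add: algebra_simps)
  have "?z \<epsilon> \<in> affine hull ?m'"
    unfolding z using c_aff v_aff by (intro mem_affine[OF affine_affine_hull]) auto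
  then have "?z \<epsilon> \<in> convex hull ?m'" using \<epsilon>(1) bary_convex_hull[OF i'] by blast
  moreover have "?z \<epsilon> \<in> convex hull ?m"
    unfolding z using \<epsilon> subsetD[OF hull_mono[of "set ws" ?m convex] centre_hull]
    by (intro convexD[OF convex_convex_hull]) (auto intro: hull_inc)
  ultimately have "?z \<epsilon> \<in> convex hull (?m \<inter> ?m')" using geom_complexD(7)[OF K m(1,2)] by blast
  moreover have "?m \<inter> ?m' = set ws" using ne m by auto
  ultimately have "h (?z \<epsilon>) = 0" using subsetD[OF convex_hull_subset_affine_hull] by (intro h_zero) auto
  then show False using h_line[of \<epsilon> v] \<epsilon>(3) same by simp
qed

text \<open>Finitely many simplices cover the start of the segment from the centre to
  \<open>y\<close>, so one of them meets it arbitrarily close to the centre. Being closed, it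
  contains the centre, hence \<open>ws\<close>, and a count of dimensions leaves room for a single
  further vertex.\<close>

lemma side_exists:
  assumes ev: "eventually (\<lambda>\<epsilon>. centre + \<epsilon> *\<^sub>R (y - centre) \<in> convex hull (set vs)) (at_right 0)"
    and y: "h y \<noteq> 0"
  shows "\<exists>v\<in>W. h v * h y > 0"
proof -
  let ?z = "\<lambda>\<epsilon>. centre + \<epsilon> *\<^sub>R (y - centre)"
  let ?M = "{m \<in> K. m \<subseteq> convex hull (set vs)}"
  obtain m where m: "m \<in> ?M" "frequently (\<lambda>\<epsilon>. ?z \<epsilon> \<in> convex hull m) (at_right 0)"
  proof (rule ccontr)
    assume "\<not> thesis"
    then have "\<forall>m\<in>?M. eventually (\<lambda>\<epsilon>. ?z \<epsilon> \<notin> convex hull m) (at_right 0)"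
      using that unfolding frequently_def by blast
    then have "eventually (\<lambda>\<epsilon>. \<forall>m\<in>?M. ?z \<epsilon> \<notin> convex hull m) (at_right 0)"
      using geom_complexD(2)[OF K] by (intro eventually_ball_finite) auto
    with ev have "eventually (\<lambda>\<epsilon>::real. False) (at_right 0)"
      by eventually_elim (use cover in fastforce)
    then show False by (simp add: trivial_limit_at_right_real)
  qed
  have mK: "m \<in> K" "m \<subseteq> convex hull (set vs)" using m(1) by auto
  have fin: "finite m" by (rule geom_complexD(4)[OF K mK(1)])
  have "centre \<in> convex hull m"
  proof (rule ccontr)
    assume "centre \<notin> convex hull m"
    then have "centre \<in> - (convex hull m)" "open (- (convex hull m))"
      using compact_imp_closed[OF finite_imp_compact_convex_hull[OF fin]] by auto
    moreover have "(?z \<longlongrightarrow> centre + 0 *\<^sub>R (y - centre)) (at_right 0)"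
      by (intro tendsto_intros)
    ultimately have "eventually (\<lambda>\<epsilon>. ?z \<epsilon> \<in> - (convex hull m)) (at_right 0)"
      by (intro topological_tendstoD) auto
    then show False using m(2) by (simp add: frequently_def)
  qed
  then have sub: "set ws \<subseteq> m" by (rule centre_simplex[OF mK(1)])
  have "frequently (\<lambda>\<epsilon>. ?z \<epsilon> \<in> convex hull m \<and> 0 < \<epsilon>) (at_right 0)"
    using m(2) eventually_at_right_less[of "0::real"] by (rule frequently_eventually_frequently)
  then obtain \<epsilon> where \<epsilon>: "?z \<epsilon> \<in> convex hull m" "0 < \<epsilon>" using frequently_ex by blast
  have hz: "h (?z \<epsilon>) = \<epsilon> * h y" by (rule h_line)
  have "m \<noteq> set ws"
  proof
    assume "m = set ws"
    then have "h (?z \<epsilon>) = 0" using \<epsilon>(1) subsetD[OF convex_hull_subset_affine_hull] by (intro h_zero) auto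
    then show False using hz \<epsilon>(2) y by simp
  qed
  then obtain v where v: "v \<in> m" "v \<notin> set ws" using sub by blast
  have im: "\<not> affine_dependent m" by (rule geom_complexD(6)[OF K mK(1)])
  have "int (card m) \<le> aff_dim (affine hull (set vs)) + 1"
    using independent_card_le_aff_dim[OF _ im] mK(2) hull_sub by blast
  then have "card m \<le> length vs"
    using aff_dim_affine_independent[OF vs(2)] vs(1) by (simp add: distinct_card)
  moreover have "card (insert v (set ws)) = length vs" using v(2) ws(1,4) by (simp add: distinct_card)
  ultimately have mv: "insert v (set ws) = m"
    using v sub fin by (intro card_seteq) auto
  then have vW: "v \<in> W" using mK v by (auto simp: W_def)
  have z_aff: "?z \<epsilon> \<in> affine hull m" by (rule subsetD[OF convex_hull_subset_affine_hull \<epsilon>(1)])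
  have "h (?z \<epsilon>) = (\<Sum>u\<in>m. bary m u (?z \<epsilon>) * h u)"
    using affine_fn_combination[OF h_affine bary_affine_hull(1)[OF im z_aff]] bary_affine_hull(2)[OF im z_aff] by simp
  also have "\<dots> = bary m v (?z \<epsilon>) * h v"
    unfolding mv[symmetric] using v(2) by (simp add: h_zero hull_inc)
  finally have "\<epsilon> * (h y * h y) = bary m v (?z \<epsilon>) * (h v * h y)" using hz by simp
  moreover have "\<epsilon> * (h y * h y) > 0" using \<epsilon>(2) y by (metis mult_pos_pos not_real_square_gt_zero)
  moreover have "bary m v (?z \<epsilon>) \<ge> 0" using bary_convex_hull[OF im] \<epsilon>(1) v(1) by blast
  ultimately have "h v * h y > 0" by (metis mult_eq_0_iff less_irrefl linorder_not_less mult_nonneg_nonpos order_le_less)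
  with vW show ?thesis by blast
qed

lemma vertex_nonzero: "\<exists>u\<in>set vs. h u \<noteq> 0"
proof -
  have "\<exists>u\<in>set vs. u \<notin> affine hull (set ws)"
  proof (rule ccontr)
    assume "\<not> ?thesis"
    then have "set vs \<subseteq> affine hull (set ws)" by blast
    then have "int (card (set vs)) \<le> aff_dim (affine hull (set ws)) + 1"
      by (rule independent_card_le_aff_dim[OF _ vs(2)])
    then show False
      using aff_dim_affine_independent[OF ws_independent] vs(1) ws(1,4) by (simp add: distinct_card)
  qed
  then obtain u where u: "u \<in> set vs" "u \<notin> affine hull (set ws)" by blast
  have "h u \<noteq> 0"
  proof (rule h_nonzero)
    show "u \<notin> set ws" using u(2) hull_inc by fast
    show "\<not> affine_dependent (insert u (set ws))"
      using affine_independent_insert[OF ws_independent u(2)] .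
    show "u \<in> affine hull (set vs)" using u(1) by (rule hull_inc)
  qed
  with u show ?thesis by blast
qed

text \<open>The face and the facet opposite to \<open>v\<close> span the same affine space, so
  \<open>h\<close> vanishes on that facet and is a multiple of the coordinate of
  \<open>v\<close>.\<close>

lemma facet_value:
  assumes v: "v \<in> set vs" and sub: "set ws \<subseteq> convex hull (set vs - {v})" and x: "x \<in> affine hull (set vs)"
  shows "h x = bary (set vs) v x * h v"
proof -
  let ?F = "set vs - {v}"
  have iF: "\<not> affine_dependent ?F" using vs(2) affine_independent_subset by blast
  have "affine hull (set ws) = affine hull ?F"
  proof (rule affine_dim_equal)
    show "affine hull (set ws) \<subseteq> affine hull ?F"
      using sub convex_hull_subset_affine_hull by (intro hull_minimal) auto
    have "card (set ws) = card ?F" using v vs(1) ws(1,4) by (simp add: distinct_card)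
    then show "aff_dim (affine hull (set ws)) = aff_dim (affine hull ?F)"
      using aff_dim_affine_independent[OF ws_independent] aff_dim_affine_independent[OF iF] by simp
  qed (use ws(5) in auto)
  then have 0: "h u = 0" if "u \<in> ?F" for u using hull_inc[OF that, of affine] by (intro h_zero) simp
  have "h x = (\<Sum>u\<in>set vs. bary (set vs) u x * h u)"
    using affine_fn_combination[OF h_affine bary_affine_hull(1)[OF vs(2) x]] bary_affine_hull(2)[OF vs(2) x] by simp
  also have "\<dots> = (\<Sum>u\<in>set vs. if u = v then bary (set vs) v x * h v else 0)"
    by (rule sum.cong) (use 0 in auto)
  finally show ?thesis using v by simp
qed

lemma facet_hull:
  assumes v: "v \<in> set vs" and x: "x \<in> convex hull (set vs)" "bary (set vs) v x = 0"
  shows "x \<in> convex hull (set vs - {v})"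
proof -
  have x_aff: "x \<in> affine hull (set vs)" using x(1) hull_sub by blast
  have "(\<Sum>u\<in>set vs - {v}. bary (set vs) u x) = 1" "(\<Sum>u\<in>set vs - {v}. bary (set vs) u x *\<^sub>R u) = x"
    using bary_affine_hull[OF vs(2) x_aff] v x(2) by (simp_all add: sum.remove[of "set vs" v])
  moreover have "\<forall>u\<in>set vs - {v}. 0 \<le> bary (set vs) u x" using bary_convex_hull[OF vs(2)] x(1) by blast
  ultimately show ?thesis
    unfolding convex_hull_finite[OF finite_Diff[OF finite_set]]
    by (intro CollectI exI[of _ "\<lambda>u. bary (set vs) u x"]) simp
qed

text \<open>The left sum will be the coefficient of the face in the boundary of the subdivided
  simplex, the right one its coefficient in the subdivision of the boundary. For a face in the
  interior both are 0; for one in a facet both are the sign of \<open>h\<close> at the opposite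
  vertex.\<close>

theorem facet_count:
  "(\<Sum>v\<in>W. isgn (h v)) = (\<Sum>v\<in>{v \<in> set vs. set ws \<subseteq> convex hull (set vs - {v})}. isgn (h v))"
proof (cases "\<exists>v\<in>set vs. set ws \<subseteq> convex hull (set vs - {v})")
  case True
  then obtain v where v: "v \<in> set vs" "set ws \<subseteq> convex hull (set vs - {v})" by blast
  obtain u where u: "u \<in> set vs" "h u \<noteq> 0" using vertex_nonzero by blast
  have hn: "h v' \<noteq> 0" if "v' \<in> set vs" "set ws \<subseteq> convex hull (set vs - {v'})" for v'
    using facet_value[OF that hull_inc[OF u(1)]] u(2) by auto
  have "v' = v" if "v' \<in> set vs" "set ws \<subseteq> convex hull (set vs - {v'})" for v'
    using facet_value[OF v hull_inc[OF that(1)]] bary(2)[OF vs(2) that(1), of v] hn[OF that] by (auto split: if_splits)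
  then have R: "{v \<in> set vs. set ws \<subseteq> convex hull (set vs - {v})} = {v}" using v by blast
  have "eventually (\<lambda>\<epsilon>::real. \<epsilon> < 1) (at_right 0)"
    by (rule order_tendstoD(2)[OF tendsto_ident_at]) simp
  moreover note eventually_at_right_less[of "0::real"]
  ultimately have "eventually (\<lambda>\<epsilon>. centre + \<epsilon> *\<^sub>R (v - centre) \<in> convex hull (set vs)) (at_right 0)"
  proof eventually_elim
    fix \<epsilon> :: real assume \<epsilon>: "\<epsilon> < 1" "0 < \<epsilon>"
    have z: "centre + \<epsilon> *\<^sub>R (v - centre) = (1 - \<epsilon>) *\<^sub>R centre + \<epsilon> *\<^sub>R v" by (simp add: algebra_simps)
    have c: "centre \<in> convex hull (set vs)" using centre_hull hull_minimal[OF ws(3)] by auto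
    show "centre + \<epsilon> *\<^sub>R (v - centre) \<in> convex hull (set vs)"
      unfolding z by (rule convexD[OF convex_convex_hull c hull_inc[OF v(1)]]) (use \<epsilon> in auto)
  qed
  then obtain v1 where v1: "v1 \<in> W" "h v1 * h v > 0" using side_exists hn[OF v] by blast
  have "v2 = v1" if v2: "v2 \<in> W" for v2
  proof (rule side_unique[OF v2 v1(1)])
    have "v2 \<in> convex hull (set vs)" using v2 by (auto simp: W_def)
    then have "h v2 = bary (set vs) v v2 * h v" "0 \<le> bary (set vs) v v2"
      using facet_value[OF v, of v2] hull_sub bary_convex_hull[OF vs(2)] v(1) by auto
    moreover have "bary (set vs) v v2 \<noteq> 0" using W_nonzero[OF v2] \<open>h v2 = _\<close> by auto
    ultimately have "bary (set vs) v v2 * (h v1 * h v) > 0" by (intro mult_pos_pos[OF _ v1(2)]) simp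
    then show "h v2 * h v1 > 0" using \<open>h v2 = _\<close> by (simp add: mult_ac)
  qed
  then have "W = {v1}" using v1(1) by blast
  then show ?thesis unfolding R using v1(2) by (auto simp: isgn_def zero_less_mult_iff)
next
  case False
  obtain u where u: "u \<in> set vs" "h u \<noteq> 0" using vertex_nonzero by blast
  have c_hull: "centre \<in> convex hull (set vs)" using centre_hull hull_minimal[OF ws(3)] by auto
  \<comment> \<open>Otherwise all of \<open>ws\<close> would lie in the facet opposite to
    \<open>v\<close>. So the centre is an interior point, and one can leave it in both
    directions.\<close>
  have pos: "bary (set vs) v centre > 0" if v: "v \<in> set vs" for v
  proof -
    have "bary (set vs) v centre = (\<Sum>u\<in>set ws. 1 / real (length ws) * bary (set vs) v u)"
      unfolding centre_def by (rule affine_fn_combination[OF bary(1)[OF vs(2)] sum_weights])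
    moreover have "\<exists>u\<in>set ws. bary (set vs) v u > 0"
    proof (rule ccontr)
      assume *: "\<not> ?thesis"
      have "u \<in> convex hull (set vs - {v})" if u: "u \<in> set ws" for u
      proof (rule facet_hull[OF v])
        show "u \<in> convex hull (set vs)" using u ws(3) by blast
        then show "bary (set vs) v u = 0" using bary_convex_hull[OF vs(2), of u] * u v by force
      qed
      then show False using False v by blast
    qed
    moreover have "0 \<le> bary (set vs) v u" if "u \<in> set ws" for u
      using bary_convex_hull[OF vs(2), of u] ws(3) that v by blast
    moreover obtain w where "w \<in> set ws" "bary (set vs) v w > 0" using \<open>\<exists>u\<in>set ws. _\<close> by blast
    ultimately show ?thesis using ws(5) by (auto intro!: sum_pos2[where i = w])
  qed
  have ev: "eventually (\<lambda>\<epsilon>. centre + \<epsilon> *\<^sub>R (y - centre) \<in> convex hull (set vs)) (at_right 0)"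
    if y: "y \<in> affine hull (set vs)" for y
  proof -
    let ?z = "\<lambda>\<epsilon>. centre + \<epsilon> *\<^sub>R (y - centre)"
    have "eventually (\<lambda>\<epsilon>. \<forall>v\<in>set vs. 0 < bary (set vs) v (?z \<epsilon>)) (at_right 0)"
    proof (rule eventually_ball_finite[OF finite_set], rule ballI)
      fix v assume v: "v \<in> set vs"
      have "((\<lambda>\<epsilon>. bary (set vs) v (?z \<epsilon>)) \<longlongrightarrow>
        bary (set vs) v centre + 0 * (bary (set vs) v y - bary (set vs) v centre)) (at_right 0)"
        unfolding affine_fn_line[OF bary(1)[OF vs(2)]] by (intro tendsto_intros)
      from order_tendstoD(1)[OF this, of 0] pos[OF v]
      show "eventually (\<lambda>\<epsilon>. 0 < bary (set vs) v (?z \<epsilon>)) (at_right 0)" by simp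
    qed
    then show ?thesis
    proof eventually_elim
      fix \<epsilon> assume *: "\<forall>v\<in>set vs. 0 < bary (set vs) v (?z \<epsilon>)"
      have "?z \<epsilon> = (1 - \<epsilon>) *\<^sub>R centre + \<epsilon> *\<^sub>R y" by (simp add: algebra_simps)
      then have "?z \<epsilon> \<in> affine hull (set vs)"
        using subsetD[OF hull_sub c_hull] y by (simp add: mem_affine[OF affine_affine_hull])
      then show "?z \<epsilon> \<in> convex hull (set vs)" using * bary_convex_hull[OF vs(2)] by fastforce
    qed
  qed
  \<comment> \<open>The reflection of \<open>u\<close> in the centre, where \<open>h\<close> has the
    opposite sign.\<close>
  let ?u' = "centre + (- 1) *\<^sub>R (u - centre)"
  have u_aff: "u \<in> affine hull (set vs)" using u(1) by (rule hull_inc)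
  have "?u' = 2 *\<^sub>R centre + (- 1) *\<^sub>R u" by (simp add: algebra_simps scaleR_2)
  then have u'_aff: "?u' \<in> affine hull (set vs)"
    using subsetD[OF hull_sub c_hull] u_aff by (simp only: mem_affine[OF affine_affine_hull])
  have hu': "h ?u' = - h u" using h_line[of "- 1" u] by simp
  obtain v1 where v1: "v1 \<in> W" "h v1 * h u > 0" using side_exists[OF ev[OF u_aff] u(2)] by blast
  obtain v2 where v2: "v2 \<in> W" "h v2 * h ?u' > 0" using side_exists[OF ev[OF u'_aff]] hu' u(2) by auto
  have "(\<Sum>v\<in>W. isgn (h v)) = 0"
  proof (cases "h u > 0")
    case True
    then show ?thesis
      using v1 v2 hu' by (intro sum_isgn[OF finite_W W_nonzero side_unique, where a = v1 and b = v2]) (auto simp: zero_less_mult_iff)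
  next
    case False
    then show ?thesis
      using v1 v2 hu' u(2) by (intro sum_isgn[OF finite_W W_nonzero side_unique, where a = v2 and b = v1]) (auto simp: zero_less_mult_iff)
  qed
  moreover have "{v \<in> set vs. set ws \<subseteq> convex hull (set vs - {v})} = {}" using False by blast
  ultimately show ?thesis by (simp only: sum.empty)
qed

end

section \<open>The subdivision operator as a chain map\<close>

definition sub_coeff :: "'a::euclidean_space set \<Rightarrow> 'a set \<Rightarrow> int" where
  "sub_coeff t s = isgn (bdet (sorted_list t) (sorted_list s))"

definition sub_simplices :: "'a::euclidean_space set set \<Rightarrow> 'a set \<Rightarrow> 'a set set" where
  "sub_simplices K' t = {s \<in> K'. s \<subseteq> convex hull t \<and> card s = card t}"

definition sub_chain :: "'a::euclidean_space set set \<Rightarrow> 'a set \<Rightarrow> 'a chain" where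
  "sub_chain K' t = (\<Sum>s\<in>sub_simplices K' t. frag_cmul (sub_coeff t s) (frag_of (sorted_list s)))"

lemma eps_alt: "finite w \<Longrightarrow> eps v w = list_sign (v # sorted_list w)"
  using sorted_list[of w] list_sign_sorted[of "sorted_list w"] by (simp only: list_sign_distinct_Cons mult_1_right)

lemma sub_coeff_insert:
  assumes "finite w" "v \<notin> w" "finite t" "card t = Suc (card w)"
  shows "eps v w * sub_coeff t (insert v w) = isgn (bdet (sorted_list t) (v # sorted_list w))"
proof -
  have d: "distinct (v # sorted_list w)" using assms by (simp add: sorted_list)
  have "list_sign (sorted_list (insert v w)) * bdet (sorted_list t) (sorted_list (insert v w)) =
    list_sign (v # sorted_list w) * bdet (sorted_list t) (v # sorted_list w)"
    using assms d by (intro bdet_permute) (simp_all add: sorted_list length_sorted_list)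
  then have "bdet (sorted_list t) (sorted_list (insert v w)) =
    real_of_int (eps v w) * bdet (sorted_list t) (v # sorted_list w)"
    using assms(1) by (simp add: eps_alt[symmetric] list_sign_sorted sorted_list del: list_sign.simps)
  moreover have e: "eps v w * eps v w = 1" by (rule eps_sq[OF assms(2)])
  ultimately have "sub_coeff t (insert v w) = eps v w * isgn (bdet (sorted_list t) (v # sorted_list w))"
    by (simp add: sub_coeff_def isgn_mult)
  then show ?thesis using e by (simp add: mult.assoc[symmetric])
qed

text \<open>Brings \<open>v\<close> to the front of the base, where \<open>bdet_facet\<close>
  removes it. With \<open>sub_coeff_insert\<close>, both sides of the chain map identity become sums
  of signs of determinants of the same form.\<close>

lemma sub_coeff_facet:
  assumes t: "\<not> affine_dependent t" "v \<in> t" and w: "finite w" "card t = Suc (card w)" "w \<subseteq> convex hull (t - {v})"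
  shows "eps v (t - {v}) * sub_coeff (t - {v}) w = isgn (bdet (sorted_list t) (v # sorted_list w))"
proof -
  have fin: "finite t" by (rule aff_independent_finite[OF t(1)])
  let ?vs = "sorted_list (t - {v})"
  have vs: "set ?vs = t - {v}" "distinct ?vs" "length ?vs = card w"
    using fin t(2) w(2) by (simp_all add: sorted_list length_sorted_list)
  have t_eq: "set (v # ?vs) = t" using vs t(2) by auto
  have "list_sign (v # ?vs) * bdet (v # ?vs) (v # sorted_list w) =
    list_sign (sorted_list t) * bdet (sorted_list t) (v # sorted_list w)"
  proof (rule bdet_permute_base)
    show "distinct (v # ?vs)" using vs by simp
    show "length (v # sorted_list w) = length (v # ?vs)" using vs w by (simp add: length_sorted_list)
  qed (use fin t_eq in \<open>simp_all add: sorted_list\<close>)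
  moreover have "bdet (v # ?vs) (v # sorted_list w) = bdet ?vs (sorted_list w)"
  proof (rule bdet_facet)
    show "\<not> affine_dependent (set (v # ?vs))" using t_eq t(1) by simp
    show "set (sorted_list w) \<subseteq> affine hull (set ?vs)"
      using w vs convex_hull_subset_affine_hull[of "t - {v}"] by (auto simp: sorted_list)
  qed (use vs w in \<open>simp_all add: length_sorted_list\<close>)
  ultimately have "real_of_int (eps v (t - {v})) * bdet ?vs (sorted_list w) = bdet (sorted_list t) (v # sorted_list w)"
    using fin by (simp add: eps_alt[symmetric] list_sign_sorted sorted_list del: list_sign.simps)
  moreover have "eps v (t - {v}) * eps v (t - {v}) = 1" by (rule eps_sq) simp
  ultimately show ?thesis by (simp add: sub_coeff_def isgn_mult[symmetric])
qed

lemma facet_sum: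
  assumes K: "geom_complex K" and K': "geom_complex K'" and sub: "subdivides K' K"
    and t: "t \<in> K" and w: "w \<in> K'" "w \<subseteq> convex hull t" "card t = Suc (card w)"
  shows "(\<Sum>v\<in>{v. v \<notin> w \<and> insert v w \<in> K' \<and> insert v w \<subseteq> convex hull t}.
      isgn (bdet (sorted_list t) (v # sorted_list w))) =
    (\<Sum>v\<in>{v \<in> t. w \<subseteq> convex hull (t - {v})}. isgn (bdet (sorted_list t) (v # sorted_list w)))"
proof (cases "w = {}")
  \<comment> \<open>The locale requires a nonempty face. The empty one is the augmentation:
    \<open>t\<close> is a single vertex, and both sums consist of its term.\<close>
  case True
  then obtain a where a: "t = {a}" using w(3) card_1_singletonE[of t] by auto
  obtain m where "m \<in> K'" "a \<in> convex hull m" "m \<subseteq> convex hull {a}"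
    using subdividesD(2)[OF sub t, of a] a by auto
  then have "{a} \<in> K'" by (cases "m = {}") (auto simp: subset_singleton_iff)
  then have "{v. v \<notin> w \<and> insert v w \<in> K' \<and> insert v w \<subseteq> convex hull t} = {a}"
    using True a by auto
  moreover have "{v \<in> t. w \<subseteq> convex hull (t - {v})} = {a}" using True a by auto
  ultimately show ?thesis by simp
next
  case False
  have fin: "finite t" "finite w" using geom_complexD(4) K K' t w(1) by blast+
  interpret facet K' "sorted_list t" "sorted_list w"
  proof
    show "sorted_list w \<noteq> []" using False sorted_list(1)[OF fin(2)] by auto
    show "\<exists>m\<in>K'. x \<in> convex hull m \<and> m \<subseteq> convex hull set (sorted_list t)"
      if "x \<in> convex hull set (sorted_list t)" for x
      using subdividesD(2)[OF sub t, of x] that by (simp add: sorted_list fin)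
  qed (use K' geom_complexD(6)[OF K t] w fin in \<open>simp_all add: sorted_list length_sorted_list\<close>)
  show ?thesis using facet_count by (simp add: W_def h_def sorted_list fin)
qed

lemma lookup_sum_frag:
  assumes "finite A"
  shows "Poly_Mapping.lookup (\<Sum>s\<in>A. frag_cmul (c s) (frag_of s)) w = (if w \<in> A then c w else 0)"
proof -
  have "Poly_Mapping.lookup (\<Sum>s\<in>A. frag_cmul (c s) (frag_of s)) w = (\<Sum>s\<in>A. if s = w then c s else 0)"
    unfolding lookup_sum by (rule sum.cong) auto
  then show ?thesis using assms by simp
qed

theorem carried_sub_chain:
  assumes K: "geom_complex K" and K': "geom_complex K'" and sub: "subdivides K' K"
  shows "carried_map K (\<lambda>t. {us. set us \<in> K' \<and> set us \<subseteq> convex hull t}) (sub_chain K')"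
  unfolding carried_map_def
proof (intro conjI ballI)
  note fin' = geom_complexD(4)[OF K']
  have "sub_simplices K' {} = {{}}"
    using geom_complexD(3)[OF K'] by (auto simp: sub_simplices_def)
  moreover have "sub_coeff ({} :: 'a set) {} = 1" by (simp add: sub_coeff_def bdet_def list_det_def isgn_def)
  ultimately show "sub_chain K' {} = frag_of []" by (simp add: sub_chain_def)
  fix t assume t: "t \<in> K"
  have fin: "finite t" by (rule geom_complexD(4)[OF K t])
  have finS: "finite (sub_simplices K' r)" for r
    using geom_complexD(2)[OF K'] by (simp add: sub_simplices_def)
  show "sub_chain K' t \<in> chain_group {us. set us \<in> K' \<and> set us \<subseteq> convex hull t} (card t)"
    unfolding sub_chain_def
    by (intro chains_sum chains_cmul) (auto simp: sub_simplices_def sorted_list length_sorted_list fin')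
  \<comment> \<open>The subdivision chain in oriented form, where the coefficients of a face can be
    compared.\<close>
  define A where "A r = (\<Sum>s\<in>sub_simplices K' r. frag_cmul (sub_coeff r s) (frag_of s))" for r
  let ?J = "\<lambda>s. frag_of (sorted_list s)"
  have A: "sub_chain K' r = frag_extend ?J (A r)" for r
    unfolding sub_chain_def A_def using finS by (simp add: frag_extend_sum frag_extend_cmul o_def)
  have key: "frag_extend sbd (A t) = frag_extend A (sbd t)"
  proof (rule poly_mapping_eqI)
    fix w
    let ?W = "{v. v \<notin> w \<and> insert v w \<in> K' \<and> insert v w \<subseteq> convex hull t}"
    have lA: "Poly_Mapping.lookup (A r) w = (if w \<in> sub_simplices K' r then sub_coeff r w else 0)" for r
      unfolding A_def by (rule lookup_sum_frag[OF finS])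
    have L: "Poly_Mapping.lookup (frag_extend sbd (A t)) w =
      (\<Sum>s\<in>sub_simplices K' t. sub_coeff t s * Poly_Mapping.lookup (sbd s) w)"
      unfolding A_def using finS by (simp add: frag_extend_sum frag_extend_cmul o_def lookup_sum)
    have R: "Poly_Mapping.lookup (frag_extend A (sbd t)) w =
      (\<Sum>v\<in>t. eps v (t - {v}) * (if w \<in> sub_simplices K' (t - {v}) then sub_coeff (t - {v}) w else 0))"
      unfolding extend_sbd[OF fin] by (simp add: lookup_sum lA)
    have sbdl: "Poly_Mapping.lookup (sbd s) w = (\<Sum>v\<in>s. if s - {v} = w then eps v w else 0)" for s
      unfolding sbd_def by (simp add: lookup_sum when_def) (rule sum.cong, auto)
    show "Poly_Mapping.lookup (frag_extend sbd (A t)) w = Poly_Mapping.lookup (frag_extend A (sbd t)) w"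
    proof (cases "w \<in> K' \<and> w \<subseteq> convex hull t \<and> card t = Suc (card w)")
      case True
      then have w: "w \<in> K'" "w \<subseteq> convex hull t" "card t = Suc (card w)" by auto
      have fw: "finite w" by (rule fin'[OF w(1)])
      \<comment> \<open>Only simplices of the form \<open>insert v w\<close> have \<open>w\<close>
        in their boundary.\<close>
      have "(\<Sum>s\<in>sub_simplices K' t. sub_coeff t s * Poly_Mapping.lookup (sbd s) w) =
        (\<Sum>s\<in>(\<lambda>v. insert v w) ` ?W. sub_coeff t s * Poly_Mapping.lookup (sbd s) w)"
      proof (rule sum.mono_neutral_right[OF finS])
        show "(\<lambda>v. insert v w) ` ?W \<subseteq> sub_simplices K' t"
          using w fw by (auto simp: sub_simplices_def)
        show "\<forall>s\<in>sub_simplices K' t - (\<lambda>v. insert v w) ` ?W. sub_coeff t s * Poly_Mapping.lookup (sbd s) w = 0"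
        proof
          fix s assume s: "s \<in> sub_simplices K' t - (\<lambda>v. insert v w) ` ?W"
          have "s - {v} \<noteq> w" if v: "v \<in> s" for v
          proof
            assume "s - {v} = w"
            then have "s = insert v w" "v \<in> ?W" using v s by (auto simp: sub_simplices_def insert_absorb)
            then show False using s by blast
          qed
          then show "sub_coeff t s * Poly_Mapping.lookup (sbd s) w = 0" by (simp add: sbdl)
        qed
      qed
      also have "\<dots> = (\<Sum>v\<in>?W. sub_coeff t (insert v w) * Poly_Mapping.lookup (sbd (insert v w)) w)"
        by (rule sum.reindex_cong[OF _ refl refl]) (auto simp: inj_on_def insert_eq_iff)
      also have "\<dots> = (\<Sum>v\<in>?W. isgn (bdet (sorted_list t) (v # sorted_list w)))"
      proof (rule sum.cong[OF refl])
        fix v assume v: "v \<in> ?W"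
        have "Poly_Mapping.lookup (sbd (insert v w)) w = (\<Sum>u\<in>insert v w. if u = v then eps v w else 0)"
          unfolding sbdl using v by (intro sum.cong) auto
        then have "Poly_Mapping.lookup (sbd (insert v w)) w = eps v w" using fw by simp
        then show "sub_coeff t (insert v w) * Poly_Mapping.lookup (sbd (insert v w)) w =
          isgn (bdet (sorted_list t) (v # sorted_list w))"
          using sub_coeff_insert[OF fw _ fin w(3), of v] v by (simp add: mult.commute)
      qed
      also have "\<dots> = (\<Sum>v\<in>{v \<in> t. w \<subseteq> convex hull (t - {v})}. isgn (bdet (sorted_list t) (v # sorted_list w)))"
        by (rule facet_sum[OF K K' sub t w])
      also have "\<dots> = (\<Sum>v\<in>{v \<in> t. w \<subseteq> convex hull (t - {v})}. eps v (t - {v}) * sub_coeff (t - {v}) w)"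
        by (rule sum.cong) (use sub_coeff_facet[OF geom_complexD(6)[OF K t] _ fw w(3)] in auto)
      also have "\<dots> = (\<Sum>v\<in>t. eps v (t - {v}) * (if w \<in> sub_simplices K' (t - {v}) then sub_coeff (t - {v}) w else 0))"
        by (rule sum.mono_neutral_cong_left) (use fin w in \<open>auto simp: sub_simplices_def\<close>)
      finally show ?thesis unfolding L R .
    next
      \<comment> \<open>For reasons of degree or position, \<open>w\<close> occurs on neither
        side.\<close>
      case False
      have "Poly_Mapping.lookup (sbd s) w = 0" if s: "s \<in> sub_simplices K' t" for s
      proof -
        have "s - {v} \<noteq> w" if v: "v \<in> s" for v
        proof
          assume e: "s - {v} = w"
          have "s \<in> K'" "s \<subseteq> convex hull t" "card s = card t" using s by (auto simp: sub_simplices_def)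
          then have "w \<in> K'" "w \<subseteq> convex hull t" "card t = Suc (card w)"
            using e geom_complexD(5)[OF K', of s w] card.remove[OF fin' v] by auto
          then show False using False by blast
        qed
        then show ?thesis by (simp add: sbdl)
      qed
      moreover have "w \<notin> sub_simplices K' (t - {v})" if v: "v \<in> t" for v
      proof
        assume "w \<in> sub_simplices K' (t - {v})"
        then have "w \<in> K'" "w \<subseteq> convex hull (t - {v})" "card w = card (t - {v})"
          by (auto simp: sub_simplices_def)
        then have "w \<in> K'" "w \<subseteq> convex hull t" "card t = Suc (card w)"
          using hull_mono[of "t - {v}" t convex] card.remove[OF fin v] by auto
        then show False using False by blast
      qed
      ultimately show ?thesis unfolding L R by simp
    qed
  qed
  have kA: "Poly_Mapping.keys (A t) \<subseteq> K'"
    unfolding A_def by (rule order.trans[OF keys_sum]) (auto simp: sub_simplices_def)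
  have "bd (sub_chain K' t) = frag_extend ?J (frag_extend sbd (A t))"
    unfolding A by (rule extend_carried[OF carried_sorted_list[OF geom_complexD(1)[OF K']] kA])
  also have "\<dots> = frag_extend (sub_chain K') (sbd t)"
    unfolding key by (simp add: A[abs_def] frag_extend_frag_extend)
  finally show "bd (sub_chain K' t) = frag_extend (sub_chain K') (sbd t)" .
qed

section \<open>Comparison with determinants of edge vectors\<close>

lemma det_unit_lower_triangular:
  fixes A :: "real Matrix.mat"
  assumes "A \<in> carrier_mat n n" "\<And>i j. i < j \<Longrightarrow> j < n \<Longrightarrow> A $$ (i, j) = 0" "\<And>i. i < n \<Longrightarrow> A $$ (i, i) = 1"
  shows "Determinant.det A = 1"
  using det_lower_triangular[OF assms(2,1)] assms(1,3) by (simp add: prod_list_diag_prod)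

text \<open>Passing to differences with the first vertex removes the row and column of that vertex.\<close>

lemma det_differences:
  fixes e :: "nat \<Rightarrow> nat \<Rightarrow> real"
  assumes e: "\<And>i. i \<le> p \<Longrightarrow> (\<Sum>j\<le>p. e i j) = 1"
  shows "Determinant.det (Matrix.mat p p (\<lambda>(i, j). e (Suc i) (Suc j) - e 0 (Suc j))) =
    Determinant.det (Matrix.mat (Suc p) (Suc p) (\<lambda>(i, j). e i j))"
proof -
  let ?n = "Suc p"
  let ?E = "Matrix.mat ?n ?n (\<lambda>(i, j). e i j)"
  \<comment> \<open>Multiplication by \<open>?C\<close> replaces the first column by the row sums,
    all equal to 1; \<open>?R\<close> then subtracts the first row from the others, which clears the
    rest of that column. Both factors have determinant 1.\<close>
  let ?C = "Matrix.mat ?n ?n (\<lambda>(i, j). if j = 0 \<or> i = j then 1 else 0 :: real)"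
  let ?R = "Matrix.mat ?n ?n (\<lambda>(i, j). if i = j then 1 else if j = 0 then - 1 else 0 :: real)"
  let ?G = "Matrix.mat ?n ?n (\<lambda>(i, j). if j = 0 then 1 else e i j)"
  let ?F = "Matrix.mat ?n ?n (\<lambda>(i, j). if i = 0 then (if j = 0 then 1 else e 0 j) else if j = 0 then 0 else e i j - e 0 j)"
  have G: "?E * ?C = ?G"
  proof (rule eq_matI)
    fix i j assume "i < dim_row ?G" "j < dim_col ?G"
    then have ij: "i < ?n" "j < ?n" by auto
    then have "(?E * ?C) $$ (i, j) = (\<Sum>k\<le>p. e i k * (if j = 0 \<or> k = j then 1 else 0))"
      by (simp add: scalar_prod_def atLeast0LessThan lessThan_Suc_atMost)
    also have "\<dots> = (if j = 0 then 1 else e i j)"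
      using e[of i] ij by (cases "j = 0") (simp_all add: if_distrib cong: if_cong)
    finally show "(?E * ?C) $$ (i, j) = ?G $$ (i, j)" using ij by simp
  qed auto
  have F: "?R * ?G = ?F"
  proof (rule eq_matI)
    fix i j assume "i < dim_row ?F" "j < dim_col ?F"
    then have ij: "i < ?n" "j < ?n" by auto
    define g where "g k = (if j = 0 then 1 else e k j)" for k
    have "(?R * ?G) $$ (i, j) = (\<Sum>k\<le>p. (if i = k then 1 else if k = 0 then - 1 else 0) * g k)"
      using ij by (simp add: scalar_prod_def atLeast0LessThan lessThan_Suc_atMost g_def)
    also have "\<dots> = (\<Sum>k\<le>p. (if k = i then g k else 0) + (if k = 0 then (if i = 0 then 0 else - g k) else 0))"
      by (rule sum.cong) auto
    also have "\<dots> = g i + (if i = 0 then 0 else - g 0)"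
      using ij unfolding sum.distrib by simp
    finally show "(?R * ?G) $$ (i, j) = ?F $$ (i, j)" using ij by (simp add: g_def)
  qed auto
  have "Determinant.det ?F = (\<Sum>i<?n. ?F $$ (i, 0) * cofactor ?F i 0)"
    by (rule laplace_expansion_column) auto
  also have "\<dots> = (\<Sum>i<?n. if i = 0 then cofactor ?F 0 0 else 0)"
    by (rule sum.cong) auto
  also have "\<dots> = cofactor ?F 0 0" by (simp del: sum.lessThan_Suc)
  also have "mat_delete ?F 0 0 = Matrix.mat p p (\<lambda>(i, j). e (Suc i) (Suc j) - e 0 (Suc j))"
    by (rule eq_matI) (auto simp: mat_delete_def)
  then have "cofactor ?F 0 0 = Determinant.det (Matrix.mat p p (\<lambda>(i, j). e (Suc i) (Suc j) - e 0 (Suc j)))"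
    by (simp add: cofactor_def)
  finally have dF: "Determinant.det ?F =
    Determinant.det (Matrix.mat p p (\<lambda>(i, j). e (Suc i) (Suc j) - e 0 (Suc j)))" .
  have "Determinant.det ?R = 1" by (rule det_unit_lower_triangular[of _ ?n]) auto
  moreover have "Determinant.det ?C = 1" by (rule det_unit_lower_triangular[of _ ?n]) auto
  moreover have "Determinant.det ?F = Determinant.det ?R * Determinant.det ?G"
    unfolding F[symmetric] by (rule det_mult[OF mat_carrier mat_carrier])
  moreover have "Determinant.det ?G = Determinant.det ?E * Determinant.det ?C"
    unfolding G[symmetric] by (rule det_mult[OF mat_carrier mat_carrier])
  ultimately show ?thesis using dF by simp
qed

text \<open>The differences of coordinates sum to zero, so in the combination for
  \<open>x - y\<close> each vertex \<open>u\<close> may be replaced by \<open>u - a\<close>, and the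
  term of \<open>a\<close> drops out.\<close>

lemma representation_bary:
  fixes t :: "'a::euclidean_space set"
  assumes t: "\<not> affine_dependent t" "a \<in> t" "v \<in> t" "v \<noteq> a" and xy: "x \<in> affine hull t" "y \<in> affine hull t"
  shows "representation ((\<lambda>v. v - a) ` (t - {a})) (x - y) (v - a) = bary t v x - bary t v y"
proof -
  let ?B = "(\<lambda>v. v - a) ` (t - {a})"
  have fin: "finite t" by (rule aff_independent_finite[OF t(1)])
  have B: "independent ?B"
    using t(1) affine_dependent_iff_dependent2[OF t(2)] by (simp add: image_def)
  define c where "c u = bary t u x - bary t u y" for u
  have c0: "sum c t = 0"
    using bary_affine_hull(1)[OF t(1)] xy by (simp add: c_def sum_subtractf)
  have "x - y = (\<Sum>u\<in>t. c u *\<^sub>R u)"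
    using bary_affine_hull(2)[OF t(1)] xy by (simp add: c_def scaleR_left_diff_distrib sum_subtractf)
  also have "\<dots> = (\<Sum>u\<in>t. c u *\<^sub>R (u - a))"
    using c0 by (simp add: scaleR_right_diff_distrib sum_subtractf scaleR_sum_left[symmetric])
  also have "\<dots> = (\<Sum>u\<in>t - {a}. c u *\<^sub>R (u - a))"
    using fin t(2) by (simp add: sum.remove[of t a])
  finally have "x - y = (\<Sum>u\<in>t - {a}. c u *\<^sub>R (u - a))" .
  moreover have "c u *\<^sub>R (u - a) \<in> span ?B" if "u \<in> t - {a}" for u
    using that by (intro span_scale span_base) auto
  ultimately have "representation ?B (x - y) (v - a) =
    (\<Sum>u\<in>t - {a}. representation ?B (c u *\<^sub>R (u - a)) (v - a))"
    using real_vector.representation_sum[OF B, of "t - {a}" "\<lambda>u. c u *\<^sub>R (u - a)"] by simp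
  also have "\<dots> = (\<Sum>u\<in>t - {a}. if u = v then c u else 0)"
    using B by (intro sum.cong) (auto simp: real_vector.representation_scale real_vector.representation_basis span_base)
  also have "\<dots> = c v" using fin t(3,4) by simp
  finally show ?thesis by (simp add: c_def)
qed

lemma relative_orientation_bdet:
  fixes vs us :: "'a::euclidean_space list"
  assumes vs: "distinct vs" "\<not> affine_dependent (set vs)" "vs \<noteq> []"
    and us: "length us = length vs" "set us \<subseteq> affine hull (set vs)"
  shows "relative_orientation vs us = of_int (isgn (bdet vs us))"
proof -
  obtain p where p: "length vs = Suc p" using vs(3) by (cases vs) auto
  define e where "e i j = bary (set vs) (vs ! j) (us ! i)" for i j
  have u: "us ! i \<in> affine hull (set vs)" if "i \<le> p" for i
    using us p that by (metis le_imp_less_Suc nth_mem subsetD)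
  have tl: "set (tl vs) = set vs - {vs ! 0}"
    using vs(1,3) by (cases vs) auto
  have e1: "(\<Sum>j\<le>p. e i j) = 1" if "i \<le> p" for i
  proof -
    have inj: "inj_on ((!) vs) {..p}" using vs(1) p by (simp add: inj_on_nth)
    have "set vs = (!) vs ` {..p}" using p by (auto simp: set_conv_nth less_Suc_eq_le)
    then have "(\<Sum>v\<in>set vs. bary (set vs) v (us ! i)) = (\<Sum>j\<le>p. e i j)"
      using sum.reindex[OF inj, of "\<lambda>v. bary (set vs) v (us ! i)"] by (simp add: e_def)
    then show ?thesis using bary_affine_hull(1)[OF vs(2) u[OF that]] by simp
  qed
  have "Matrix.mat p p (\<lambda>(i, j). representation ((\<lambda>v. v - vs ! 0) ` set (tl vs)) (us ! Suc i - us ! 0) (vs ! Suc j - vs ! 0)) =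
    Matrix.mat p p (\<lambda>(i, j). e (Suc i) (Suc j) - e 0 (Suc j))"
  proof (rule eq_matI)
    fix i j
    assume "i < dim_row (Matrix.mat p p (\<lambda>(i, j). e (Suc i) (Suc j) - e 0 (Suc j)))"
      "j < dim_col (Matrix.mat p p (\<lambda>(i, j). e (Suc i) (Suc j) - e 0 (Suc j)))"
    then have ij: "i < p" "j < p" by auto
    have "vs ! Suc j \<noteq> vs ! 0" using vs(1) p ij by (simp add: nth_eq_iff_index_eq)
    then show "Matrix.mat p p (\<lambda>(i, j). representation ((\<lambda>v. v - vs ! 0) ` set (tl vs)) (us ! Suc i - us ! 0) (vs ! Suc j - vs ! 0)) $$ (i, j) =
      Matrix.mat p p (\<lambda>(i, j). e (Suc i) (Suc j) - e 0 (Suc j)) $$ (i, j)"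
      using ij p u by (simp add: tl e_def representation_bary[OF vs(2)])
  qed auto
  then have "Determinant.det (Matrix.mat p p (\<lambda>(i, j). representation ((\<lambda>v. v - vs ! 0) ` set (tl vs)) (us ! Suc i - us ! 0) (vs ! Suc j - vs ! 0))) = bdet vs us"
    using det_differences[OF e1] by (simp add: bdet_def list_det_def p e_def)
  then show ?thesis by (simp add: relative_orientation_def Let_def p isgn_def)
qed

section \<open>Open stars and matrices of simplicial complexes\<close>

lemma simplex_vertices:
  fixes s :: "'a::euclidean_space set"
  assumes "n simplex s"
  shows "\<not> affine_dependent (vertices s)" "convex hull (vertices s) = s" "int (card (vertices s)) = n + 1"
    "finite (vertices s)"
proof -
  obtain C where C: "\<not> affine_dependent C" "int (card C) = n + 1" "s = convex hull C"
    using assms unfolding simplex_def by blast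
  have "vertices s = C"
    unfolding vertices_def C(3) using extreme_point_of_convex_hull_affine_independent[OF C(1)] by simp
  then show "\<not> affine_dependent (vertices s)" "convex hull (vertices s) = s" "int (card (vertices s)) = n + 1"
    "finite (vertices s)"
    using C aff_independent_finite by auto
qed

lemma vertices_convex_hull: "\<not> affine_dependent C \<Longrightarrow> vertices (convex hull C) = (C :: 'a::euclidean_space set)"
  unfolding vertices_def by (simp add: extreme_point_of_convex_hull_affine_independent)

lemma simplicial_complexD:
  assumes "simplicial_complex L"
  shows "finite L" "s \<in> L \<Longrightarrow> \<exists>n. n simplex s" "s \<in> L \<Longrightarrow> c face_of s \<Longrightarrow> c \<in> L"
    "s \<in> L \<Longrightarrow> t \<in> L \<Longrightarrow> s \<inter> t face_of s"
proof -
  show "c \<in> L" if "s \<in> L" "c face_of s" using assms that unfolding simplicial_complex_def by blast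
qed (use assms in \<open>simp_all add: simplicial_complex_def\<close>)

lemma complex_vertices:
  assumes "simplicial_complex L" "s \<in> L"
  shows "\<not> affine_dependent (vertices s)" "convex hull (vertices s) = s" "finite (vertices s)"
  using simplicial_complexD(2)[OF assms] simplex_vertices by blast+

lemma hull_subset_face:
  fixes s :: "'a::euclidean_space set"
  assumes "simplicial_complex L" "s \<in> L" "w \<subseteq> vertices s"
  shows "convex hull w \<in> L" "vertices (convex hull w) = w"
proof -
  note v = complex_vertices[OF assms(1,2)]
  have "convex hull w face_of s"
    using face_of_convex_hull_affine_independent[OF v(1)] assms(3) unfolding v(2) by blast
  then show "convex hull w \<in> L" by (rule simplicial_complexD(3)[OF assms(1,2)])
  show "vertices (convex hull w) = w"
    by (rule vertices_convex_hull[OF affine_independent_subset[OF v(1) assms(3)]])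
qed

text \<open>The empty set is added so that the empty complex is augmented as well.\<close>

definition vsets :: "'a::euclidean_space set set \<Rightarrow> 'a set set" where
  "vsets L = insert {} (vertices ` L)"

lemma vertices_empty [simp]: "vertices {} = {}"
  by (simp add: vertices_def extreme_point_of_def)

lemma vertices_eq_empty: "simplicial_complex L \<Longrightarrow> s \<in> L \<Longrightarrow> vertices s = {} \<longleftrightarrow> s = {}"
  using complex_vertices(2)[of L s] by auto

lemma inj_on_vertices: "simplicial_complex L \<Longrightarrow> inj_on vertices L"
  by (rule inj_on_inverseI[where g = "\<lambda>C. convex hull C"]) (rule complex_vertices(2))

text \<open>Two simplices meet in a common face, which is the hull of a subset of either vertex set.
  These subsets agree, because an independent set is recovered from its hull as the set of extreme
  points.\<close>

lemma geom_complex_vsets: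
  assumes L: "simplicial_complex L" shows "geom_complex (vsets L)"
  unfolding geom_complex_def abstract_complex_def
proof (intro conjI ballI allI impI)
  show "finite (vsets L)" using simplicial_complexD(1)[OF L] by (simp add: vsets_def)
  show "{} \<in> vsets L" by (simp add: vsets_def)
  fix s assume s: "s \<in> vsets L"
  show "finite s" using s complex_vertices(3)[OF L] by (auto simp: vsets_def)
  show "\<not> affine_dependent s" using s complex_vertices(1)[OF L] by (auto simp: vsets_def)
  show "w \<in> vsets L" if "w \<subseteq> s" for w
  proof (cases "s = {}")
    case False
    then obtain \<sigma> where "\<sigma> \<in> L" "s = vertices \<sigma>" using s by (auto simp: vsets_def)
    then show ?thesis using hull_subset_face[OF L, of \<sigma> w] that unfolding vsets_def by force
  qed (use that in \<open>simp add: vsets_def\<close>)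
  fix t assume t: "t \<in> vsets L"
  show "convex hull s \<inter> convex hull t \<subseteq> convex hull (s \<inter> t)"
  proof (cases "s = {} \<or> t = {}")
    case False
    then obtain \<sigma> \<rho> where \<sigma>: "\<sigma> \<in> L" "s = vertices \<sigma>" "\<rho> \<in> L" "t = vertices \<rho>"
      using s t by (auto simp: vsets_def)
    note v\<sigma> = complex_vertices[OF L \<sigma>(1)] and v\<rho> = complex_vertices[OF L \<sigma>(3)]
    have f: "\<sigma> \<inter> \<rho> face_of \<sigma>" "\<rho> \<inter> \<sigma> face_of \<rho>"
      using simplicial_complexD(4)[OF L] \<sigma> by blast+
    then obtain c where c: "c \<subseteq> s" "\<sigma> \<inter> \<rho> = convex hull c"
      using face_of_convex_hull_affine_independent[OF v\<sigma>(1), of "\<sigma> \<inter> \<rho>"] unfolding v\<sigma>(2) \<sigma>(2) by blast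
    have "\<sigma> \<inter> \<rho> face_of \<rho>" using f(2) by (simp add: Int_commute)
    then obtain d where d: "d \<subseteq> t" "\<sigma> \<inter> \<rho> = convex hull d"
      using face_of_convex_hull_affine_independent[OF v\<rho>(1), of "\<sigma> \<inter> \<rho>"] unfolding v\<rho>(2) \<sigma>(4) by blast
    have "c = d"
      using c d vertices_convex_hull[of c] vertices_convex_hull[of d]
        affine_independent_subset[OF v\<sigma>(1), of c] affine_independent_subset[OF v\<rho>(1), of d] \<sigma> by simp
    then have "convex hull c \<subseteq> convex hull (s \<inter> t)" using c(1) d(1) by (intro hull_mono) simp
    then show ?thesis using c(2) v\<sigma>(2) v\<rho>(2) \<sigma>(2,4) by simp
  qed auto
qed

lemma body_vsets: "simplicial_complex L \<Longrightarrow> body (vsets L) = \<Union> L"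
  unfolding body_def vsets_def using complex_vertices(2)[of L] by simp

lemma vsets_subset_hull:
  assumes L: "simplicial_complex L" and k: "k \<in> vsets L" and x: "x \<in> convex hull k"
  obtains t where "t \<in> L" "k = vertices t" "x \<in> t"
proof -
  have "k \<noteq> {}" using x by auto
  then obtain t where "t \<in> L" "k = vertices t" using k by (auto simp: vsets_def)
  then show thesis using that[of t] x complex_vertices(2)[OF L] by simp
qed

lemma subdivides_vsets:
  assumes L: "simplicial_complex L" and M: "simplicial_complex M"
    and sub: "\<And>s. s \<in> M \<Longrightarrow> \<exists>t\<in>L. s \<subseteq> t" and cover: "\<And>t x. t \<in> L \<Longrightarrow> x \<in> t \<Longrightarrow> \<exists>s\<in>M. x \<in> s \<and> s \<subseteq> t"
  shows "subdivides (vsets M) (vsets L)"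
  unfolding subdivides_def
proof (intro conjI ballI)
  fix m assume m: "m \<in> vsets M"
  show "\<exists>t\<in>vsets L. m \<subseteq> convex hull t"
  proof (cases "m = {}")
    case False
    then obtain s where s: "s \<in> M" "m = vertices s" using m by (auto simp: vsets_def)
    then obtain t where "t \<in> L" "s \<subseteq> t" using sub by blast
    moreover have "m \<subseteq> s" using s hull_subset[of m convex] complex_vertices(2)[OF M] by auto
    ultimately show ?thesis
      using complex_vertices(2)[OF L] by (intro bexI[of _ "vertices t"]) (auto simp: vsets_def)
  qed (auto simp: vsets_def)
next
  fix k x assume k: "k \<in> vsets L" "x \<in> convex hull k"
  then obtain t where t: "t \<in> L" "k = vertices t" "x \<in> t" by (rule vsets_subset_hull[OF L])
  then obtain s where s: "s \<in> M" "x \<in> s" "s \<subseteq> t" using cover by blast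
  have "vertices s \<subseteq> s" using hull_subset[of "vertices s" convex] complex_vertices(2)[OF M s(1)] by auto
  then show "\<exists>m\<in>vsets M. x \<in> convex hull m \<and> m \<subseteq> convex hull k"
    using s t complex_vertices(2)[OF L t(1)] complex_vertices(2)[OF M s(1)]
    by (intro bexI[of _ "vertices s"]) (auto simp: vsets_def)
qed

lemma face_vertices: "s face_of t \<Longrightarrow> vertices s \<subseteq> vertices t"
  unfolding vertices_def using extreme_point_of_face by blast

section \<open>Carriers and open stars\<close>

lemma rel_interior_subset_simplex:
  assumes T: "simplicial_complex T" and st: "s \<in> T" "t \<in> T" and x: "x \<in> rel_interior s" "x \<in> t"
  shows "s face_of t"
proof -
  have "x \<in> (s \<inter> t) \<inter> rel_interior s" using x rel_interior_subset by blast
  then have "s \<subseteq> s \<inter> t"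
    using subset_of_face_of[OF simplicial_complexD(4)[OF T st], of s] by blast
  then have "s = t \<inter> s" by blast
  then show ?thesis using simplicial_complexD(4)[OF T st(2,1)] by simp
qed

lemma open_star_subset_star:
  assumes T: "simplicial_complex T" and x: "x \<in> open_star T v"
  shows "x \<in> star (vsets T) v"
  unfolding star_def
proof (intro CollectI ballI impI)
  fix k assume "k \<in> vsets T" "x \<in> convex hull k"
  then obtain t where t: "t \<in> T" "k = vertices t" "x \<in> t" by (rule vsets_subset_hull[OF T])
  obtain s where s: "s \<in> T" "v \<in> vertices s" "x \<in> rel_interior s" using x by (auto simp: open_star_def)
  have "s face_of t" by (rule rel_interior_subset_simplex[OF T s(1) t(1) s(3) t(3)])
  then show "v \<in> k" using face_vertices s(2) t(2) by blast
qed

text \<open>If the point were on the relative boundary of the smallest simplex around it, it would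
  lie in a smaller face.\<close>

lemma carrier_rel_interior:
  assumes L: "simplicial_complex L" and x: "x \<in> \<Union> L"
  obtains s where "s \<in> L" "x \<in> rel_interior s"
proof -
  have "x \<in> body (vsets L)" using x body_vsets[OF L] by simp
  from carrier_simplex[OF geom_complex_vsets[OF L] this]
  obtain k where k: "k \<in> vsets L" "x \<in> convex hull k"
    and min: "\<And>l. l \<in> vsets L \<Longrightarrow> x \<in> convex hull l \<Longrightarrow> k \<subseteq> l" by metis
  obtain s where s: "s \<in> L" "k = vertices s" "x \<in> s" using k by (rule vsets_subset_hull[OF L])
  note v = complex_vertices[OF L s(1)]
  have "x \<in> rel_interior s"
  proof (rule ccontr)
    assume "x \<notin> rel_interior s"
    then have "x \<in> convex hull (vertices s) - rel_interior (convex hull (vertices s))" using s(3) v(2) by simp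
    then obtain a where a: "a \<in> k" "x \<in> convex hull (k - {a})"
      unfolding rel_boundary_of_convex_hull[OF v(1)] s(2) by blast
    then have "k \<subseteq> k - {a}" using geom_complexD(5)[OF geom_complex_vsets[OF L] k(1), of "k - {a}"] by (intro min) auto
    then show False using a(1) by blast
  qed
  then show thesis using that s(1) by blast
qed

lemma star_subset_open_star:
  assumes L: "simplicial_complex L" and x: "x \<in> \<Union> L" "x \<in> star (vsets L) v" and sub: "L \<subseteq> T"
  shows "x \<in> open_star T v"
proof -
  obtain s where s: "s \<in> L" "x \<in> rel_interior s" using x(1) by (rule carrier_rel_interior[OF L])
  have "x \<in> convex hull (vertices s)"
    using s(2) rel_interior_subset complex_vertices(2)[OF L s(1)] by auto
  then have "v \<in> vertices s" using x(2) s(1) by (auto simp: star_def vsets_def)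
  then show ?thesis using s sub by (auto simp: open_star_def)
qed

lemma fine_subdivision:
  assumes L: "simplicial_complex L" and "e > 0"
  shows "\<exists>M. geom_complex M \<and> subdivides M (vsets L) \<and>
    (\<forall>m\<in>M. \<forall>x\<in>convex hull m. \<forall>y\<in>convex hull m. dist x y \<le> e)"
proof -
  obtain M where M: "simplicial_complex M" "\<And>k. k \<in> M \<Longrightarrow> diameter k < e"
    "\<And>t. t \<in> L \<Longrightarrow> \<exists>F. finite F \<and> F \<subseteq> M \<and> t = \<Union> F" "\<And>k. k \<in> M \<Longrightarrow> \<exists>t. t \<in> L \<and> k \<subseteq> t"
  proof (rule fine_simplicial_subdivision_of_cell_complex[OF assms(2) simplicial_complexD(1)[OF L]])
    show "polytope t" if "t \<in> L" for t using simplicial_complexD(2)[OF L that] simplex_imp_polytope by blast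
    show "s \<inter> t face_of s" if "s \<in> L" "t \<in> L" for s t using simplicial_complexD(4)[OF L that] .
  qed (rule that)
  have "subdivides (vsets M) (vsets L)"
  proof (rule subdivides_vsets[OF L M(1)])
    show "\<exists>t\<in>L. s \<subseteq> t" if "s \<in> M" for s using M(4)[OF that] by blast
    show "\<exists>s\<in>M. x \<in> s \<and> s \<subseteq> t" if "t \<in> L" "x \<in> t" for t x using M(3)[OF that(1)] that(2) by blast
  qed
  moreover have "dist x y \<le> e" if m: "m \<in> vsets M" and xy: "x \<in> convex hull m" "y \<in> convex hull m" for m x y
  proof -
    obtain s where s: "s \<in> M" "m = vertices s" using m xy(1) by (rule vsets_subset_hull[OF M(1)])
    have "bounded s"
      using simplicial_complexD(2)[OF M(1) s(1)] compact_simplex compact_imp_bounded by blast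
    then have "dist x y \<le> diameter s"
      using xy s complex_vertices(2)[OF M(1) s(1)] by (intro diameter_bounded_bound) auto
    then show ?thesis using M(2)[OF s(1)] by simp
  qed
  ultimately show ?thesis using geom_complex_vsets[OF M(1)] by blast
qed

section \<open>Diagonal entries of the chain matrices\<close>

lemma isgn_list_sign: "distinct us \<Longrightarrow> isgn (real_of_int (list_sign us) * x) = list_sign us * isgn x"
  by (rule isgn_mult[OF list_sign_sq])

lemma isgn_bdet_sorted:
  assumes vs: "distinct vs" "\<not> affine_dependent (set vs)" and us: "distinct us" "length us = length vs"
  shows "isgn (bdet vs us) = list_sign vs * list_sign us * sub_coeff (set vs) (set us)"
proof -
  let ?vs = "sorted_list (set vs)" and ?us = "sorted_list (set us)"
  have "list_sign vs * bdet vs us = bdet ?vs us"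
    using bdet_permute_base[of vs ?vs us] vs us by (simp add: sorted_list list_sign_sorted)
  moreover have "list_sign us * bdet ?vs us = bdet ?vs ?us"
    using bdet_permute[of us ?us ?vs] vs us by (simp add: sorted_list list_sign_sorted length_sorted_list distinct_card)
  ultimately have "sub_coeff (set vs) (set us) = list_sign us * (list_sign vs * isgn (bdet vs us))"
    unfolding sub_coeff_def using vs us by (metis isgn_list_sign)
  then have "list_sign vs * list_sign us * sub_coeff (set vs) (set us) =
    (list_sign vs * list_sign vs) * (list_sign us * list_sign us) * isgn (bdet vs us)"
    by (simp only: mult_ac)
  then show ?thesis by (simp only: list_sign_sq[OF vs(1)] list_sign_sq[OF us(1)] mult_1)
qed

lemma lookup_alt_of: "Poly_Mapping.lookup (alt (frag_of us)) k = (if set us = k then list_sign us else 0)"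
  by auto

text \<open>On the diagonal \<open>\<omega> t\<close> enters both factors, and so does
  \<open>\<omega>' s\<close> in every summand. Each sign occurs twice and cancels, so the entry is
  the one for increasing orientations.\<close>

lemma lookup_push_sub_chain:
  assumes T': "simplicial_complex T'" and \<omega>': "orientation T' \<omega>'"
    and L: "simplicial_complex L" and t: "t \<in> L" "int p simplex t" and \<omega>: "distinct (\<omega> t)" "set (\<omega> t) = vertices t"
    and L': "L' = {s \<in> T'. \<exists>t\<in>L. s \<subseteq> t}"
  shows "of_int (Poly_Mapping.lookup (alt (push \<phi> (sub_chain (vsets L') (vertices t)))) (vertices t)) =
    chain_endo_matrix p T' \<omega> \<omega>' \<phi> t t"
proof -
  let ?k = "vertices t"
  let ?S = "{s \<in> simplices p T'. s \<subseteq> t}"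
  note vt = simplex_vertices[OF t(2)]
  have card_k: "card ?k = Suc p" using vt(3) by simp
  have finT: "finite T'" by (rule simplicial_complexD(1)[OF T'])
  have S: "s \<in> T'" "s \<subseteq> t" "\<not> affine_dependent (vertices s)" "convex hull (vertices s) = s" "card (vertices s) = Suc p"
    if "s \<in> ?S" for s
    using that simplex_vertices[of "int p" s] by (auto simp: simplices_def)
  have inj: "inj_on vertices ?S"
    using inj_on_vertices[OF T'] by (rule inj_on_subset) (auto simp: simplices_def)
  have img: "sub_simplices (vsets L') ?k = vertices ` ?S"
  proof
    show "vertices ` ?S \<subseteq> sub_simplices (vsets L') ?k"
    proof (rule image_subsetI)
      fix s assume s: "s \<in> ?S"
      have "vertices s \<subseteq> s" using hull_subset[of "vertices s" convex] S(4)[OF s] by simp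
      moreover have "s \<in> L'" using S(1,2)[OF s] t(1) unfolding L' by blast
      ultimately show "vertices s \<in> sub_simplices (vsets L') ?k"
        using S[OF s] vt(2) card_k by (auto simp: sub_simplices_def vsets_def)
    qed
    show "sub_simplices (vsets L') ?k \<subseteq> vertices ` ?S"
    proof
      fix m assume m: "m \<in> sub_simplices (vsets L') ?k"
      then have "m \<noteq> {}" using card_k by (auto simp: sub_simplices_def)
      then obtain s where s: "s \<in> T'" "m = vertices s" using m by (auto simp: sub_simplices_def vsets_def L')
      obtain n where n: "n simplex s" using simplicial_complexD(2)[OF T' s(1)] by blast
      have "n = int p" using simplex_vertices(3)[OF n] m s card_k by (auto simp: sub_simplices_def)
      moreover have "convex hull m \<subseteq> convex hull ?k"
        using m by (intro hull_minimal) (simp_all add: sub_simplices_def)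
      then have "s \<subseteq> t" using s vt(2) complex_vertices(2)[OF T' s(1)] by simp
      ultimately show "m \<in> vertices ` ?S" using s n by (auto simp: simplices_def)
    qed
  qed
  have "alt (push \<phi> (sub_chain (vsets L') ?k)) =
    (\<Sum>m\<in>vertices ` ?S. frag_cmul (sub_coeff ?k m) (alt (frag_of (map \<phi> (sorted_list m)))))"
    unfolding sub_chain_def img alt_def using finT
    by (simp add: linear_sum frag_extend_sum frag_extend_cmul o_def simplices_def)
  then have "Poly_Mapping.lookup (alt (push \<phi> (sub_chain (vsets L') ?k))) ?k =
    (\<Sum>m\<in>vertices ` ?S. sub_coeff ?k m * Poly_Mapping.lookup (alt (frag_of (map \<phi> (sorted_list m)))) ?k)"
    by (simp add: lookup_sum del: alt_simps)
  also have "\<dots> = (\<Sum>s\<in>?S. sub_coeff ?k (vertices s) * Poly_Mapping.lookup (alt (frag_of (map \<phi> (sorted_list (vertices s))))) ?k)"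
    by (simp only: sum.reindex[OF inj] o_def)
  finally have lhs: "Poly_Mapping.lookup (alt (push \<phi> (sub_chain (vsets L') ?k))) ?k =
    (\<Sum>s\<in>?S. sub_coeff ?k (vertices s) * Poly_Mapping.lookup (alt (frag_of (map \<phi> (sorted_list (vertices s))))) ?k)" .
  have term_eq: "simplicial_chain_matrix \<omega> \<omega>' \<phi> t s * subdivision_matrix \<omega> \<omega>' s t =
    of_int (sub_coeff ?k (vertices s) * Poly_Mapping.lookup (alt (frag_of (map \<phi> (sorted_list (vertices s))))) ?k)"
    if s: "s \<in> ?S" for s
  proof -
    let ?us = "\<omega>' s"
    have us: "distinct ?us" "set ?us = vertices s" using \<omega>' S(1)[OF s] by (auto simp: orientation_def)
    have fs: "finite (vertices s)" using complex_vertices(3)[OF T' S(1)[OF s]] .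
    have len: "length ?us = length (\<omega> t)" using us \<omega> S(5)[OF s] card_k by (metis distinct_card)
    have "set ?us \<subseteq> affine hull (set (\<omega> t))"
    proof -
      have "vertices s \<subseteq> s" using hull_subset[of "vertices s" convex] S(4)[OF s] by simp
      also have "s \<subseteq> convex hull ?k" using S(2)[OF s] vt(2) by simp
      also have "\<dots> \<subseteq> affine hull ?k" by (rule convex_hull_subset_affine_hull)
      finally show ?thesis using us \<omega> by simp
    qed
    then have r: "relative_orientation (\<omega> t) ?us = of_int (isgn (bdet (\<omega> t) ?us))"
      using \<omega> vt(1) card_k len by (intro relative_orientation_bdet) auto
    have b: "isgn (bdet (\<omega> t) ?us) = list_sign (\<omega> t) * list_sign ?us * sub_coeff ?k (vertices s)"
      using isgn_bdet_sorted[of "\<omega> t" ?us] \<omega> us vt(1) len by simp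
    have m: "list_sign (map \<phi> ?us) * list_sign ?us = list_sign (map \<phi> (sorted_list (vertices s)))"
      using list_sign_map_permute[of ?us "sorted_list (vertices s)" \<phi>] us fs
      by (simp add: sorted_list list_sign_sorted)
    have "list_sign (\<omega> t) * list_sign (map \<phi> ?us) * (list_sign (\<omega> t) * list_sign ?us * sub_coeff ?k (vertices s)) =
      (list_sign (\<omega> t) * list_sign (\<omega> t)) * (sub_coeff ?k (vertices s) * (list_sign (map \<phi> ?us) * list_sign ?us))"
      by (simp only: mult_ac)
    then have e: "list_sign (\<omega> t) * list_sign (map \<phi> ?us) * isgn (bdet (\<omega> t) ?us) =
      sub_coeff ?k (vertices s) * list_sign (map \<phi> (sorted_list (vertices s)))"
      unfolding b m list_sign_sq[OF \<omega>(1)] by simp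
    have "rat_of_int (list_sign (\<omega> t)) * rat_of_int (list_sign (map \<phi> ?us)) * rat_of_int (isgn (bdet (\<omega> t) ?us)) =
      rat_of_int (sub_coeff ?k (vertices s)) * rat_of_int (list_sign (map \<phi> (sorted_list (vertices s))))"
      using arg_cong[OF e, of rat_of_int] by simp
    then show ?thesis
      unfolding simplicial_chain_matrix_def subdivision_matrix_def oriented_coeff_list_sign[OF \<omega>(1)] r
        of_int_mult[symmetric] lookup_alt_of
      using S(2)[OF s] us \<omega>(2) fs by (simp add: sorted_list)
  qed
  have "chain_endo_matrix p T' \<omega> \<omega>' \<phi> t t =
    (\<Sum>s\<in>?S. simplicial_chain_matrix \<omega> \<omega>' \<phi> t s * subdivision_matrix \<omega> \<omega>' s t)"
    unfolding chain_endo_matrix_def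
    by (rule sum.mono_neutral_right) (use finT in \<open>auto simp: simplices_def subdivision_matrix_def\<close>)
  also have "\<dots> = (\<Sum>s\<in>?S. of_int (sub_coeff ?k (vertices s) * Poly_Mapping.lookup (alt (frag_of (map \<phi> (sorted_list (vertices s))))) ?k))"
    by (rule sum.cong[OF refl term_eq])
  finally show ?thesis unfolding lhs by simp
qed

section \<open>Invariant unions of open simplices\<close>

lemma subcomplex:
  assumes "simplicial_complex T" "L \<subseteq> T" "\<And>s c. s \<in> L \<Longrightarrow> c face_of s \<Longrightarrow> c \<in> L"
  shows "simplicial_complex L"
  using assms(2,3) simplicial_complexD[OF assms(1)] finite_subset[OF assms(2)]
  unfolding simplicial_complex_def by (simp add: subset_iff) blast

definition face_closure :: "'a::euclidean_space set set \<Rightarrow> 'a set set \<Rightarrow> 'a set set" where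
  "face_closure T F = {s \<in> T. \<exists>t\<in>F. s face_of t}"

definition open_body :: "'a::euclidean_space set set \<Rightarrow> 'a set" where
  "open_body F = \<Union> (rel_interior ` F)"

lemma face_closure_complex: "simplicial_complex T \<Longrightarrow> simplicial_complex (face_closure T F)"
proof (rule subcomplex[of T])
  assume T: "simplicial_complex T"
  show "c \<in> face_closure T F" if "s \<in> face_closure T F" "c face_of s" for s c
    using that simplicial_complexD(3)[OF T] face_of_trans unfolding face_closure_def by blast
qed (auto simp: face_closure_def)

lemma complex_convex: "simplicial_complex T \<Longrightarrow> s \<in> T \<Longrightarrow> convex s"
  using simplicial_complexD(2)[of T s] convex_simplex by blast

lemma complex_closed: "simplicial_complex T \<Longrightarrow> s \<in> T \<Longrightarrow> closed s"
  using simplicial_complexD(2)[of T s] closed_simplex by blast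

lemma subset_face_closure: "simplicial_complex T \<Longrightarrow> F \<subseteq> T \<Longrightarrow> F \<subseteq> face_closure T F"
  using face_of_refl complex_convex unfolding face_closure_def by blast

lemma open_body_complex: "simplicial_complex L \<Longrightarrow> open_body (L - {{}}) = \<Union> L"
proof
  assume L: "simplicial_complex L"
  show "open_body (L - {{}}) \<subseteq> \<Union> L" using rel_interior_subset by (fastforce simp: open_body_def)
  show "\<Union> L \<subseteq> open_body (L - {{}})"
  proof
    fix x assume "x \<in> \<Union> L"
    then obtain s where "s \<in> L" "x \<in> rel_interior s" by (rule carrier_rel_interior[OF L])
    then show "x \<in> open_body (L - {{}})" unfolding open_body_def by (cases "s = {}") auto
  qed
qed

lemma open_body_Int:
  assumes T: "simplicial_complex T" and "F \<subseteq> T" "G \<subseteq> T"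
  shows "open_body F \<inter> open_body G = open_body (F \<inter> G)"
proof
  show "open_body F \<inter> open_body G \<subseteq> open_body (F \<inter> G)"
  proof
    fix x assume "x \<in> open_body F \<inter> open_body G"
    then obtain s t where st: "s \<in> F" "t \<in> G" and x: "x \<in> rel_interior s" "x \<in> rel_interior t"
      by (auto simp: open_body_def)
    then have "s \<in> T" "t \<in> T" "x \<in> s" "x \<in> t" using assms rel_interior_subset by blast+
    then have "s face_of t" "t face_of s" using rel_interior_subset_simplex[OF T] x by blast+
    then have "s = t" using face_of_imp_subset by blast
    then show "x \<in> open_body (F \<inter> G)" using st x by (auto simp: open_body_def)
  qed
qed (auto simp: open_body_def)

lemma open_body_Un: "open_body (F \<union> G) = open_body F \<union> open_body G"
  by (auto simp: open_body_def)

lemma closure_open_body: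
  assumes T: "simplicial_complex T" and F: "F \<subseteq> T"
  shows "closure (open_body F) = \<Union> (face_closure T F)"
proof
  have "closed (\<Union> (face_closure T F))"
    using simplicial_complexD(1)[OF face_closure_complex[OF T, of F]]
      complex_closed[OF face_closure_complex[OF T, of F]] by (intro closed_Union) auto
  moreover have "open_body F \<subseteq> \<Union> (face_closure T F)"
    using subset_face_closure[OF T F] rel_interior_subset by (fastforce simp: open_body_def)
  ultimately show "closure (open_body F) \<subseteq> \<Union> (face_closure T F)" by (intro closure_minimal)
  show "\<Union> (face_closure T F) \<subseteq> closure (open_body F)"
  proof
    fix x assume "x \<in> \<Union> (face_closure T F)"
    then obtain s t where "x \<in> s" "t \<in> F" "s face_of t" by (auto simp: face_closure_def)
    then have "x \<in> t" using face_of_imp_subset by blast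
    then have "x \<in> closure (rel_interior t)"
      using convex_closure_rel_interior[OF complex_convex[OF T, of t]] \<open>t \<in> F\<close> F closure_subset by blast
    moreover have "rel_interior t \<subseteq> open_body F" using \<open>t \<in> F\<close> by (auto simp: open_body_def)
    ultimately show "x \<in> closure (open_body F)" using closure_mono by blast
  qed
qed

locale approximation_data =
  fixes T T' :: "'a::euclidean_space set set" and g \<phi> :: "'a \<Rightarrow> 'a" and \<omega> \<omega>' :: "'a set \<Rightarrow> 'a list"
  assumes T: "simplicial_complex T" and sub: "subdivision_of T T'"
    and approx: "simplicial_approximation T' T g \<phi>"
    and \<omega>: "orientation T \<omega>" and \<omega>': "orientation T' \<omega>'"
    and cont: "continuous_on (\<Union> T) g"
begin

text \<open>The sign is that of \<open>aug_trace\<close>, opposite to the one in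
  \<open>alternating_trace\<close>, as a \<open>p\<close>-simplex has \<open>p + 1\<close>
  vertices.\<close>

definition diag :: "'a set \<Rightarrow> rat" where
  "diag t = (- 1) ^ card (vertices t) * chain_endo_matrix (card (vertices t) - 1) T' \<omega> \<omega>' \<phi> t t"

lemma T': "simplicial_complex T'"
  using sub by (simp add: subdivision_of_def)

lemma sub_cover:
  assumes "t \<in> T" "x \<in> t" shows "\<exists>s\<in>T'. x \<in> s \<and> s \<subseteq> t"
proof -
  have "\<exists>F\<subseteq>T'. t = \<Union> F" using sub assms(1) by (simp add: subdivision_of_def)
  then obtain F where "F \<subseteq> T'" "t = \<Union> F" by blast
  then show ?thesis using assms(2) by blast
qed

lemma approx_star:
  assumes v: "{v} \<in> T'" and x: "x \<in> open_star T' v" shows "g x \<in> star (vsets T) (\<phi> v)"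
proof -
  have "g ` open_star T' v \<subseteq> open_star T (\<phi> v)" using approx v by (simp add: simplicial_approximation_def)
  then show ?thesis using x by (intro open_star_subset_star[OF T]) blast
qed

lemma vertex_mem: "s \<in> T' \<Longrightarrow> v \<in> vertices s \<Longrightarrow> {v} \<in> T'"
  using hull_subset_face(1)[OF T', of s "{v}"] by simp

text \<open>The augmented trace is 1, which is exactly the contribution of the empty simplex; the
  sum over the other simplices is the remainder.\<close>

lemma sum_diag_closed:
  assumes L: "simplicial_complex L" and LT: "L \<subseteq> T"
    and gL: "g ` \<Union> L \<subseteq> \<Union> L" and nofix: "\<And>x. x \<in> \<Union> L \<Longrightarrow> g x \<noteq> x"
  shows "(\<Sum>t\<in>L - {{}}. diag t) = 0"
proof -
  define L' where "L' = {s \<in> T'. \<exists>t\<in>L. s \<subseteq> t}"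
  have L': "simplicial_complex L'"
  proof (rule subcomplex[OF T'])
    show "c \<in> L'" if s: "s \<in> L'" and c: "c face_of s" for s c
    proof -
      obtain t where "s \<in> T'" "t \<in> L" "s \<subseteq> t" using s by (auto simp: L'_def)
      moreover from this have "c \<in> T'" using simplicial_complexD(3)[OF T'] c by simp
      ultimately show ?thesis using face_of_imp_subset[OF c] by (auto simp: L'_def)
    qed
  qed (auto simp: L'_def)
  have K: "geom_complex (vsets L)" and K': "geom_complex (vsets L')"
    using geom_complex_vsets L L' by blast+
  have sub': "subdivides (vsets L') (vsets L)"
  proof (rule subdivides_vsets[OF L L'])
    show "\<exists>s\<in>L'. x \<in> s \<and> s \<subseteq> t" if "t \<in> L" "x \<in> t" for t x
      using sub_cover[of t x] that LT unfolding L'_def by blast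
  qed (simp add: L'_def)
  have UL': "\<Union> L' = \<Union> L" using body_subdivides[OF sub'] by (simp add: body_vsets L L')
  have "vsets L \<subseteq> vsets T" using LT by (auto simp: vsets_def)
  then have star_mono: "star (vsets T) v \<subseteq> star (vsets L) v" for v by (auto simp: star_def)
  \<comment> \<open>The approximation by itself only gives simplices of \<open>T\<close>. Invariance
    places \<open>g x\<close> in some \<open>u\<close> of \<open>L\<close>, and the star condition
    makes every \<open>\<phi> v\<close> a vertex of \<open>u\<close>.\<close>
  have \<phi>: "\<phi> ` k \<in> vsets L" if k: "k \<in> vsets L'" for k
  proof (cases "k = {}")
    case False
    then obtain s where s: "s \<in> L'" "k = vertices s" using k by (auto simp: vsets_def)
    then have s': "s \<in> T'" "s \<noteq> {}" using False by (auto simp: L'_def)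
    then obtain x where x: "x \<in> rel_interior s"
      using rel_interior_eq_empty[OF complex_convex[OF T' s'(1)]] by blast
    then have "x \<in> \<Union> L'" using s(1) rel_interior_subset by blast
    then have "g x \<in> \<Union> L" using gL UL' by blast
    then obtain u where u: "u \<in> L" "g x \<in> u" by blast
    have "\<phi> v \<in> vertices u" if v: "v \<in> k" for v
    proof -
      have "x \<in> open_star T' v" using x v s s' by (auto simp: open_star_def)
      then have "g x \<in> star (vsets T) (\<phi> v)" using vertex_mem s' v s(2) by (intro approx_star) auto
      moreover have "g x \<in> convex hull (vertices u)" using u complex_vertices(2)[OF L u(1)] by simp
      moreover have "vertices u \<in> vsets T" using u(1) LT by (auto simp: vsets_def)
      ultimately show ?thesis by (auto simp: star_def)
    qed
    then have "\<phi> ` k \<subseteq> vertices u" by blast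
    then show ?thesis using geom_complexD(5)[OF K, of "vertices u"] u(1) by (auto simp: vsets_def)
  qed (simp add: vsets_def)
  have \<phi>_star: "g x \<in> star (vsets L) (\<phi> v)" if x: "x \<in> \<Union> L" "x \<in> star (vsets L') v" for x v
  proof -
    have xL': "x \<in> \<Union> L'" using x(1) UL' by simp
    have op: "x \<in> open_star T' v"
      by (rule star_subset_open_star[OF L' xL' x(2)]) (auto simp: L'_def)
    then obtain s where "s \<in> T'" "v \<in> vertices s" by (auto simp: open_star_def)
    then have "g x \<in> star (vsets T) (\<phi> v)" using vertex_mem op by (intro approx_star) auto
    then show ?thesis using star_mono by blast
  qed
  have \<alpha>: "carried_map (vsets L) (\<lambda>t. {us. set us \<in> vsets L' \<and> set us \<subseteq> convex hull t}) (sub_chain (vsets L'))"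
    by (rule carried_sub_chain[OF K K' sub'])
  have trace: "aug_trace (vsets L) (\<lambda>k. push \<phi> (sub_chain (vsets L') k)) = 1"
  proof (rule aug_trace_fixed_point_free[OF K K' sub' _ _ _ \<phi> _ \<alpha> fine_subdivision[OF L]])
    show "continuous_on (body (vsets L)) g"
      using continuous_on_subset[OF cont] LT by (simp add: body_vsets[OF L] Union_mono)
    show "g ` body (vsets L) \<subseteq> body (vsets L)" using gL by (simp add: body_vsets[OF L])
    show "g x \<noteq> x" if "x \<in> body (vsets L)" for x using that nofix by (simp add: body_vsets[OF L])
    show "g x \<in> star (vsets L) (\<phi> v)" if "x \<in> body (vsets L)" "x \<in> star (vsets L') v" for x v
      using that \<phi>_star by (simp add: body_vsets[OF L])
  qed
  define c where "c k = (- 1) ^ card k * Poly_Mapping.lookup (alt (push \<phi> (sub_chain (vsets L') k))) k" for k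
  have diag: "of_int (c (vertices t)) = diag t" if t: "t \<in> L - {{}}" for t
  proof -
    obtain n where n: "n simplex t" using simplicial_complexD(2)[OF L] t by blast
    have "vertices t \<noteq> {}" using vertices_eq_empty[OF L] t by blast
    then have "card (vertices t) > 0" using simplex_vertices(4)[OF n] by (simp add: card_gt_0_iff)
    then have "int (card (vertices t) - 1) simplex t" using simplex_vertices(3)[OF n] n by (simp add: of_nat_diff)
    moreover have "distinct (\<omega> t)" "set (\<omega> t) = vertices t" using \<omega> t LT by (auto simp: orientation_def)
    ultimately show ?thesis
      using lookup_push_sub_chain[OF T' \<omega>' L _ _ _ _ L'_def, of t _ \<omega> \<phi>] t by (simp add: c_def diag_def)
  qed
  have "sub_chain (vsets L') {} = frag_of []" using \<alpha> by (simp add: carried_map_def)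
  then have c0: "c {} = 1" by (simp add: c_def)
  have fin: "finite L" by (rule simplicial_complexD(1)[OF L])
  have inj: "inj_on vertices (L - {{}})" using inj_on_vertices[OF L] by (rule inj_on_subset) auto
  have "vsets L = insert {} (vertices ` (L - {{}}))"
    unfolding vsets_def by (auto simp: image_iff)
  moreover have "{} \<notin> vertices ` (L - {{}})" using vertices_eq_empty[OF L] by auto
  ultimately have "aug_trace (vsets L) (\<lambda>k. push \<phi> (sub_chain (vsets L') k)) = 1 + (\<Sum>t\<in>L - {{}}. c (vertices t))"
    using fin c0 by (simp add: aug_trace_def c_def[symmetric] sum.reindex[OF inj])
  then have "(\<Sum>t\<in>L - {{}}. c (vertices t)) = 0" using trace by simp
  then have "of_int (\<Sum>t\<in>L - {{}}. c (vertices t)) = (0 :: rat)" by simp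
  then show ?thesis by (simp add: diag del: Diff_insert0)
qed

text \<open>The boundary \<open>C\<close> of \<open>F\<close> in its closure is again invariant, and so is what \<open>C\<close> misses
  of its own closure, because the latter lies in \<open>F\<close>. As the trace over the closed complex
  \<open>F \<union> C\<close> vanishes, the induction descends from \<open>F\<close> to \<open>C\<close>.\<close>

lemma sum_diag_invariant:
  assumes "F \<subseteq> T - {{}}" and "g ` open_body F \<subseteq> open_body F"
    and "g ` open_body (face_closure T F - {{}} - F) \<subseteq> open_body (face_closure T F - {{}} - F)"
    and "\<And>x. x \<in> \<Union> (face_closure T F) \<Longrightarrow> g x \<noteq> x"
  shows "(\<Sum>t\<in>F. diag t) = 0"
  using assms
proof (induction "card (face_closure T F)" arbitrary: F rule: less_induct)
  case less
  define L where "L = face_closure T F"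
  define C where "C = L - {{}} - F"
  note F = less.prems[folded L_def, folded C_def]
  have FT: "F \<subseteq> T" using F(1) by blast
  have L: "simplicial_complex L" unfolding L_def by (rule face_closure_complex[OF T])
  have LT: "L \<subseteq> T" by (auto simp: L_def face_closure_def)
  have finL: "finite L" by (rule simplicial_complexD(1)[OF L])
  have FL: "F \<subseteq> L - {{}}" using F(1) subset_face_closure[OF T FT] by (auto simp: L_def)
  have CT: "C \<subseteq> T" using LT by (auto simp: C_def)
  have CL: "L - {{}} = F \<union> C" "F \<inter> C = {}" using FL by (auto simp: C_def)
  have UL: "\<Union> L = open_body F \<union> open_body C"
    using open_body_complex[OF L] by (simp add: CL open_body_Un)
  have "g ` \<Union> L \<subseteq> \<Union> L" unfolding UL using F(2,3) by blast
  then have "(\<Sum>t\<in>L - {{}}. diag t) = 0"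
    by (rule sum_diag_closed[OF L LT]) (rule F(4))
  then have FC: "(\<Sum>t\<in>F. diag t) + (\<Sum>t\<in>C. diag t) = 0"
  proof -
    have "finite (F \<union> C)" using finL CL(1) by (metis finite_Diff)
    then show ?thesis using \<open>(\<Sum>t\<in>L - {{}}. diag t) = 0\<close> CL by (simp add: sum.union_disjoint)
  qed
  show ?case
  proof (cases "F = {}")
    case False
    define M where "M = face_closure T C"
    have M_sub: "M \<subseteq> L"
      using face_of_trans unfolding M_def C_def L_def face_closure_def by blast
    have M: "simplicial_complex M" unfolding M_def by (rule face_closure_complex[OF T])
    have CM: "C \<subseteq> M" unfolding M_def by (rule subset_face_closure[OF T CT])
    \<comment> \<open>A simplex of \<open>F\<close> with the most vertices is not a face of one in
      \<open>C\<close>: the simplices of \<open>C\<close> are faces of simplices of \<open>F\<close>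
      but do not belong to \<open>F\<close>. Hence the closure shrinks strictly from
      \<open>F\<close> to \<open>C\<close>.\<close>
    have "\<exists>t\<in>F. t \<notin> M"
    proof -
      have finF: "finite F" using finite_subset[OF FL] finL by simp
      obtain t where t: "t \<in> F" "\<And>r. r \<in> F \<Longrightarrow> card (vertices r) \<le> card (vertices t)"
      proof -
        let ?c = "\<lambda>t. card (vertices t)"
        have "Max (?c ` F) \<in> ?c ` F" using finF False by (intro Max_in) auto
        then obtain t where "t \<in> F" "Max (?c ` F) = ?c t" by blast
        moreover have "?c r \<le> Max (?c ` F)" if "r \<in> F" for r using finF that by (intro Max_ge) auto
        ultimately show thesis using that by simp
      qed
      have "t \<notin> M"
      proof
        assume "t \<in> M"
        then obtain s where s: "s \<in> C" "t face_of s" by (auto simp: M_def face_closure_def)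
        then obtain r where r: "r \<in> F" "s face_of r" by (auto simp: C_def L_def face_closure_def)
        have "vertices t \<subseteq> vertices s" "vertices s \<subseteq> vertices r" using s(2) r(2) by (auto dest: face_vertices)
        moreover have "finite (vertices r)" using complex_vertices(3)[OF T] r(1) FT by blast
        ultimately have "vertices s = vertices t"
          using t(2)[OF r(1)] by (metis card_seteq finite_subset order_trans subset_antisym)
        then have "s = t"
          using complex_vertices(2)[OF T, of s] complex_vertices(2)[OF T, of t] s(1) t(1) FT CT by auto
        then show False using s(1) t(1) CL(2) by blast
      qed
      with t show ?thesis by blast
    qed
    then have "M \<subset> L" using M_sub FL by blast
    then have less_card: "card (face_closure T C) < card (face_closure T F)"
      using finL unfolding M_def L_def by (rule psubset_card_mono[rotated])
    have clC: "closure (open_body C) = \<Union> M" unfolding M_def by (rule closure_open_body[OF T CT])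
    have "g ` closure (open_body C) \<subseteq> closure (open_body C)"
    proof (rule image_closure_subset)
      have "\<Union> M \<subseteq> \<Union> T" using M_sub LT by blast
      then show "continuous_on (closure (open_body C)) g" unfolding clC by (rule continuous_on_subset[OF cont])
      show "g ` open_body C \<subseteq> closure (open_body C)" using F(3) closure_subset by blast
    qed simp
    then have gM: "g ` \<Union> M \<subseteq> \<Union> M" unfolding clC .
    have C': "M - {{}} - C = F \<inter> (M - {{}})" using M_sub CL by auto
    have "open_body (M - {{}} - C) = open_body F \<inter> \<Union> M"
      unfolding C' open_body_complex[OF M, symmetric] using M_sub LT
      by (intro open_body_Int[OF T FT, symmetric]) auto
    then have "g ` open_body (M - {{}} - C) \<subseteq> open_body (M - {{}} - C)" using F(2) gM by blast
    moreover have "g x \<noteq> x" if "x \<in> \<Union> M" for x using F(4) that M_sub by blast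
    moreover have "C \<subseteq> T - {{}}" using CT by (auto simp: C_def)
    ultimately have "(\<Sum>t\<in>C. diag t) = 0"
      using F(3) less.hyps[OF less_card] by (simp add: M_def)
    then show ?thesis using FC by simp
  qed simp
qed

theorem alternating_trace_zero:
  assumes gT: "g ` \<Union> T \<subseteq> \<Union> T" and B: "\<exists>F\<subseteq>T. B = \<Union> (rel_interior ` F)"
    and gB: "g ` B \<subseteq> B" "g ` (\<Union> T - B) \<subseteq> \<Union> T - B" and nofix: "\<And>x. x \<in> closure B \<Longrightarrow> g x \<noteq> x"
  shows "alternating_trace T T' \<omega> \<omega>' \<phi> B = 0"
proof -
  \<comment> \<open>The empty simplex is left out: its relative interior is empty, hence contained
    in every \<open>B\<close>.\<close>
  define F where "F = {t \<in> T. t \<noteq> {} \<and> rel_interior t \<subseteq> B}"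
  have FT: "F \<subseteq> T" by (auto simp: F_def)
  have oF: "open_body F = B"
  proof
    obtain G where G: "G \<subseteq> T" "B = \<Union> (rel_interior ` G)" using B by blast
    have "rel_interior t \<subseteq> open_body F" if "t \<in> G" for t
      using that G by (cases "t = {}") (auto simp: open_body_def F_def)
    then show "B \<subseteq> open_body F" unfolding G(2) by blast
  qed (auto simp: open_body_def F_def)
  let ?L = "face_closure T F"
  have UL: "\<Union> ?L = closure B" using closure_open_body[OF T FT] oF by simp
  have L: "simplicial_complex ?L" by (rule face_closure_complex[OF T])
  have LT: "?L \<subseteq> T" by (auto simp: face_closure_def)
  then have ULT: "\<Union> ?L \<subseteq> \<Union> T" by blast
  have gcl: "g ` closure B \<subseteq> closure B"
  proof (rule image_closure_subset)
    show "continuous_on (closure B) g" using continuous_on_subset[OF cont ULT] UL by simp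
    show "g ` B \<subseteq> closure B" using gB(1) closure_subset by blast
  qed simp
  have FL: "F \<subseteq> ?L - {{}}" using subset_face_closure[OF T FT] by (auto simp: F_def)
  have "open_body (?L - {{}} - F) = closure B - B"
  proof -
    have "?L - {{}} = (?L - {{}} - F) \<union> F" using FL by blast
    then have "closure B = open_body (?L - {{}} - F) \<union> B"
      using open_body_complex[OF L] UL oF open_body_Un by metis
    moreover have "open_body (?L - {{}} - F) \<inter> B = {}"
    proof -
      have "?L - {{}} - F \<subseteq> T" using LT by blast
      then have "open_body (?L - {{}} - F) \<inter> open_body F = open_body ((?L - {{}} - F) \<inter> F)"
        by (rule open_body_Int[OF T _ FT])
      also have "(?L - {{}} - F) \<inter> F = {}" by blast
      finally show ?thesis unfolding oF by (simp add: open_body_def[of "{}"])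
    qed
    ultimately show ?thesis by blast
  qed
  note oC = this
  \<comment> \<open>Continuity keeps the image in the closure, and invariance of the complement
    keeps it out of \<open>B\<close>.\<close>
  have gC: "g ` (closure B - B) \<subseteq> closure B - B"
  proof (rule image_subsetI)
    fix x assume x: "x \<in> closure B - B"
    then have "x \<in> \<Union> T - B" using ULT UL by blast
    then have "g x \<in> \<Union> T - B" by (rule subsetD[OF gB(2) imageI])
    moreover have "g x \<in> closure B" using x by (intro subsetD[OF gcl imageI]) simp
    ultimately show "g x \<in> closure B - B" by simp
  qed
  have zero: "(\<Sum>t\<in>F. diag t) = 0"
  proof (rule sum_diag_invariant)
    show "F \<subseteq> T - {{}}" by (auto simp: F_def)
    show "g ` open_body F \<subseteq> open_body F" unfolding oF by (rule gB(1))
    show "g ` open_body (?L - {{}} - F) \<subseteq> open_body (?L - {{}} - F)" unfolding oC by (rule gC)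
    show "g x \<noteq> x" if "x \<in> \<Union> ?L" for x using that nofix[of x] unfolding UL by simp
  qed
  let ?p = "\<lambda>t. card (vertices t) - 1"
  have simp_iff: "int p simplex t \<longleftrightarrow> t \<noteq> {} \<and> ?p t = p" if t: "t \<in> T" for t p
  proof -
    obtain n where n: "n simplex t" using simplicial_complexD(2)[OF T t] by blast
    have nc: "int (card (vertices t)) = n + 1" by (rule simplex_vertices(3)[OF n])
    show ?thesis
    proof
      assume "int p simplex t"
      then have "card (vertices t) = Suc p" using simplex_vertices(3)[of "int p" t] by simp
      then show "t \<noteq> {} \<and> ?p t = p" by auto
    next
      assume *: "t \<noteq> {} \<and> ?p t = p"
      then have "vertices t \<noteq> {}" by (simp add: vertices_eq_empty[OF T t])
      then have "card (vertices t) > 0" using simplex_vertices(4)[OF n] by (simp add: card_gt_0_iff)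
      then have "n = int (card (vertices t) - 1)" using nc by linarith
      then have "n = int p" using * by simp
      then show "int p simplex t" using n by simp
    qed
  qed
  have dim: "?p t \<le> DIM('a)" if "t \<in> F" for t
  proof -
    have "\<not> affine_dependent (vertices t)" using complex_vertices(1)[OF T] that FT by blast
    from aff_dim_affine_independent[OF this] aff_dim_le_DIM[of "vertices t"] show ?thesis by linarith
  qed
  \<comment> \<open>The sums over dimensions are regrouped into one sum over \<open>F\<close>;
    \<open>dim\<close> ensures that no simplex is missed.\<close>
  have "alternating_trace T T' \<omega> \<omega>' \<phi> B = (\<Sum>p\<le>DIM('a). \<Sum>t\<in>{t \<in> F. ?p t = p}. - diag t)"
    unfolding alternating_trace_def sum_distrib_left
  proof (intro sum.cong)
    fix p
    show "{t \<in> simplices p T. rel_interior t \<subseteq> B} = {t \<in> F. ?p t = p}"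
      using simp_iff by (auto simp: simplices_def F_def)
    fix t assume t: "t \<in> {t \<in> F. ?p t = p}"
    then have "int p simplex t" using simp_iff FT by (auto simp: F_def)
    then have "card (vertices t) = Suc p" using simplex_vertices(3)[of "int p" t] by simp
    then show "(- 1) ^ p * chain_endo_matrix p T' \<omega> \<omega>' \<phi> t t = - diag t" by (simp add: diag_def)
  qed simp
  also have "\<dots> = (\<Sum>t\<in>F. - diag t)"
    using dim finite_subset[OF FT simplicial_complexD(1)[OF T]] by (intro sum.group) auto
  finally show ?thesis using zero by (simp add: sum_negf)
qed

end

theorem theorem3p11:
  fixes S :: "nat \<Rightarrow> real list set set"
    and X :: "(real ^ 'n) set set"
    and f :: "real ^ 'n \<Rightarrow> real ^ 'n"
    and A :: "(real ^ 'n) set"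
    and \<Lambda> :: rat
  assumes "ominimal_structure S" and "contains_semilinear S"
    and "simplicial_complex X"
    and "f ` \<Union>X \<subseteq> \<Union>X" and "continuous_on (\<Union>X) f"
    and "open_map (top_of_set (\<Union>X)) (top_of_set (\<Union>X)) f"
    and "A \<subseteq> \<Union>X" and "definable S A"
    and "f ` A \<subseteq> A" and "f ` (\<Union>X - A) \<subseteq> \<Union>X - A"
    and "is_combinatorial_Lefschetz_number TYPE('m::finite) S (\<Union>X) f A \<Lambda>"
    and "\<Lambda> \<noteq> 0"
  shows "\<exists>x \<in> top_of_set (\<Union>X) closure_of A. f x = x"
proof (rule ccontr)
  assume nofix: "\<not> ?thesis"
  obtain T :: "(real ^ 'm) set set" and \<tau> \<tau>' T' \<phi> \<omega> \<omega>' where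
    tri: "definable_triangulation S (\<Union>X) A T \<tau> \<tau>'" and
    data: "subdivision_of T T'" "simplicial_approximation T' T (\<tau>' \<circ> f \<circ> \<tau>) \<phi>"
      "orientation T \<omega>" "orientation T' \<omega>'" and
    \<Lambda>: "\<Lambda> = alternating_trace T T' \<omega> \<omega>' \<phi> {x \<in> \<Union>T. \<tau> x \<in> A}"
    using assms(11) unfolding is_combinatorial_Lefschetz_number_def by blast
  define g where "g = \<tau>' \<circ> f \<circ> \<tau>"
  define B where "B = {x \<in> \<Union>T. \<tau> x \<in> A}"
  have T: "simplicial_complex T" and h: "homeomorphism (\<Union>T) (\<Union>X) \<tau> \<tau>'"
    and B: "\<exists>F\<subseteq>T. B = \<Union> (rel_interior ` F)"
    using tri unfolding definable_triangulation_def B_def by auto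
  have \<tau>: "continuous_on (\<Union>T) \<tau>" "\<tau> ` \<Union>T = \<Union>X" "continuous_on (\<Union>X) \<tau>'" "\<tau>' ` \<Union>X = \<Union>T"
    "\<And>x. x \<in> \<Union>T \<Longrightarrow> \<tau>' (\<tau> x) = x" "\<And>y. y \<in> \<Union>X \<Longrightarrow> \<tau> (\<tau>' y) = y"
    using h unfolding homeomorphism_def by auto
  have f\<tau>: "f (\<tau> x) \<in> \<Union>X" if "x \<in> \<Union>T" for x using that \<tau>(2) assms(4) by blast
  have \<tau>g: "\<tau> (g x) = f (\<tau> x)" "g x \<in> \<Union>T" if "x \<in> \<Union>T" for x
    using \<tau>(4,6) f\<tau>[OF that] by (auto simp: g_def)
  have cont: "continuous_on (\<Union>T) g"
    unfolding g_def using \<tau>(1-3) assms(4,5)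
    by (intro continuous_on_compose) (auto intro: continuous_on_subset)
  interpret approximation_data T T' g \<phi> \<omega> \<omega>'
    by (rule approximation_data.intro[OF T data(1) data(2)[folded g_def] data(3,4) cont])
  have BT: "B \<subseteq> \<Union>T" by (auto simp: B_def)
  have "closed (\<Union>T)" using complex_closed[OF T] simplicial_complexD(1)[OF T] by (intro closed_Union) auto
  then have clB: "closure B \<subseteq> \<Union>T" using BT by (rule closure_minimal[rotated])
  have "alternating_trace T T' \<omega> \<omega>' \<phi> B = 0"
  proof (rule alternating_trace_zero[OF _ B])
    show "g ` \<Union>T \<subseteq> \<Union>T" using \<tau>g(2) by blast
    show "g ` B \<subseteq> B" using \<tau>g assms(9) by (auto simp: B_def)
    show "g ` (\<Union>T - B) \<subseteq> \<Union>T - B"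
    proof (rule image_subsetI)
      fix x assume x: "x \<in> \<Union>T - B"
      then have "\<tau> x \<in> \<Union>X - A" using \<tau>(2) by (auto simp: B_def)
      then have "f (\<tau> x) \<notin> A" using assms(10) by blast
      then show "g x \<in> \<Union>T - B" using x \<tau>g[of x] by (auto simp: B_def)
    qed
    \<comment> \<open>\<tau> carries a fixed point of \<open>g\<close> to one of \<open>f\<close>,
      and its continuity places the image in the closure of \<open>A\<close>.\<close>
    show "g x \<noteq> x" if x: "x \<in> closure B" for x
    proof
      assume gx: "g x = x"
      have xT: "x \<in> \<Union>T" using x clB by blast
      have fix_x: "f (\<tau> x) = \<tau> x" using \<tau>g(1)[OF xT] gx by simp
      have "\<tau> ` closure B \<subseteq> closure A"
      proof (rule image_closure_subset)
        show "continuous_on (closure B) \<tau>" using \<tau>(1) clB by (rule continuous_on_subset)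
        show "\<tau> ` B \<subseteq> closure A" using closure_subset by (auto simp: B_def)
      qed simp
      then have "\<tau> x \<in> closure A" using x by (rule subsetD[OF _ imageI])
      moreover have "\<tau> x \<in> \<Union>X" using \<tau>(2) xT by blast
      ultimately have "\<tau> x \<in> top_of_set (\<Union>X) closure_of A"
        using assms(7) by (simp add: closure_of_subtopology Int_absorb1)
      then show False using nofix fix_x by blast
    qed
  qed
  then show False using \<Lambda> assms(12) by (simp add: B_def)
qed

end
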